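(* Let $T$ be a tree rooted at infinity with vertex set $V$, endowed with a locally doubling flow measure $m$. Suppose that $\theta\in(0,1)$ and $\frac1q=1-\theta$. Then the following hold for the complex interpolation spaces: (i) $(L^1(m),BMO(m))_{[\theta]}=L^q(m)$; (ii) $(H^1(m),L^\infty(m))_{[\theta]}=L^q(m)$; (iii) $(H^1(m),BMO(m))_{[\theta]}=L^q(m)$.
   Context: Tree with root at infinity: $T=(V,E)$ is an (undirected) tree with geodesic distance $d$, $o\in V$ is a fixed origin, and a half-infinite geodesic starting at $o$ is fixed, identified with a boundary point, the root. For $x\in V$ let $\Pi(x)$ be the vertex of this geodesic closest to $x$; the level of $x$ is $\ell(x)=d(o,\Pi(x))-d(\Pi(x),x)$. Write $x\ge y$ iff $\ell(x)-\ell(y)=d(x,y)$. The set of sons of $x$ is $s(x)=\{y\sim x:\ \ell(y)=\ell(x)-1\}$. Flow measure: a function $m:V\to(0,\infty)$ with $m(x)=\sum_{y\in s(x)}m(y)$ for all $x\in V$; also regarded as the measure $m(A)=\sum_{x\in A}m(x)$, with $\int_A f\,dm=\sum_{y\in A}f(y)m(y)$. It is locally doubling if for every $r>0$ there is $C_r>1$ with $m(B_{2r}(x))\le C_r m(B_r(x))$ for all $x\in V$, where $B_r(x)$ is the closed ball of radius $r$ for $d$. Admissible trapezoids: for integers $h''>h'\ge1$ and $x_0\in V$, $R_{h'}^{h''}(x_0)=\{x\in V:\ x\le x_0,\ \ell(x_0)-h''<\ell(x)\le \ell(x_0)-h'\}$. Fix $\beta\ge12$. $\mathcal R$ is the family of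 all singletons $\{x_0\}$ and all $R_{h'}^{h''}(x_0)$ with $2\le h''/h'\le\beta$, $x_0\in V$. $BMO(m)$: $f_R=\frac1{m(R)}\int_R f\,dm$; $BMO(m)$ is the space of functions $f:V\to\mathbb C$ with $\|f\|_{BMO}=\sup_{R\in\mathcal R}\frac1{m(R)}\int_R|f-f_R|\,dm<\infty$, modulo constants. $H^1(m)$: a $(1,\infty)$-atom is a function $a$ supported in some $R\in\mathcal R$ with $\|a\|_\infty\le m(R)^{-1}$ and $\int_R a\,dm=0$. $H^1(m)$ is the space of all $g\in L^1(m)$ of the form $g=\sum_j\lambda_ja_j$ with $a_j$ $(1,\infty)$-atoms and $\lambda_j\in\mathbb C$, $\sum_j|\lambda_j|<\infty$; $\|g\|_{H^1}$ is the infimum of $\sum_j|\lambda_j|$ over all such decompositions. Complex interpolation: for compatible normed spaces $A_0,A_1$ let $\Sigma=\{z\in\mathbb C:\Re z\in(0,1)\}$ and let $\mathcal F(A_0,A_1)$ be the class of functions $F:\overline\Sigma\to A_0+A_1$ such that for every $\ell$ in the dual of $A_0+A_1$ the map $z\mapsto\langle F(z),\ell\rangle$ is continuous and bounded in $\overline\Sigma$ and analytic in $\Sigma$, and such that $t\mapsto F(it)$ is bounded with values in $A_0$ and $t\mapsto F(1+it)$ is bounded with values in $A_1$, $t\in\mathbb R$. Put $\|F\|_{\mathcal F}=\sup_{t\in\mathbb R}\max(\|F(it)\|_{A_0},\|F(1+it)\|_{A_1})$. Then $(A_0,A_1)_{[\theta]}$ consists of all $f=F(\theta)$ with $F\in\mathcal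 F(A_0,A_1)$, with norm $\|f\|_{[\theta]}=\inf\{\|F\|_{\mathcal F}:F(\theta)=f\}$ (Calderón's complex method). Equalities of spaces mean equality with equivalent norms; in couples involving $BMO(m)$, functions are considered modulo constants. *)

theory Defs
  imports "HOL-Analysis.Analysis" "HOL-Library.Function_Algebras"
begin

section \<open>Trees with root at infinity\<close>

text \<open>
  The vertex set of a graph is the whole type \<open>'v\<close>; \<open>E\<close> is its adjacency relation.
  Local finiteness is not part of the definition of a tree.
\<close>

definition cycle :: "('v \<Rightarrow> 'v \<Rightarrow> bool) \<Rightarrow> 'v list \<Rightarrow> bool" where
  "cycle E p \<longleftrightarrow> 3 \<le> length p \<and> distinct p \<and> successively E p \<and> E (last p) (hd p)"

definition tree :: "('v \<Rightarrow> 'v \<Rightarrow> bool) \<Rightarrow> bool" where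
  "tree E \<longleftrightarrow> symp E \<and> irreflp E \<and> (\<forall>x y. E\<^sup>*\<^sup>* x y) \<and> (\<nexists>p. cycle E p)"

definition gdist :: "('v \<Rightarrow> 'v \<Rightarrow> bool) \<Rightarrow> 'v \<Rightarrow> 'v \<Rightarrow> nat" where
  "gdist E x y = (LEAST n. (E ^^ n) x y)"

definition gball :: "('v \<Rightarrow> 'v \<Rightarrow> bool) \<Rightarrow> real \<Rightarrow> 'v \<Rightarrow> 'v set" where
  "gball E r x = {y. real (gdist E x y) \<le> r}"

text \<open>The origin is the starting point \<open>\<gamma> 0\<close> of the half-infinite geodesic \<open>\<gamma>\<close>.\<close>

definition geodesic_ray :: "('v \<Rightarrow> 'v \<Rightarrow> bool) \<Rightarrow> (nat \<Rightarrow> 'v) \<Rightarrow> bool" where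
  "geodesic_ray E \<gamma> \<longleftrightarrow> (\<forall>i j. i \<le> j \<longrightarrow> gdist E (\<gamma> i) (\<gamma> j) = j - i)"

definition ray_proj :: "('v \<Rightarrow> 'v \<Rightarrow> bool) \<Rightarrow> (nat \<Rightarrow> 'v) \<Rightarrow> 'v \<Rightarrow> 'v" where
  "ray_proj E \<gamma> x = arg_min_on (gdist E x) (range \<gamma>)"

definition level :: "('v \<Rightarrow> 'v \<Rightarrow> bool) \<Rightarrow> (nat \<Rightarrow> 'v) \<Rightarrow> 'v \<Rightarrow> int" where
  "level E \<gamma> x = int (gdist E (\<gamma> 0) (ray_proj E \<gamma> x)) - int (gdist E (ray_proj E \<gamma> x) x)"

definition below :: "('v \<Rightarrow> 'v \<Rightarrow> bool) \<Rightarrow> (nat \<Rightarrow> 'v) \<Rightarrow> 'v \<Rightarrow> 'v \<Rightarrow> bool" where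
  "below E \<gamma> y x \<longleftrightarrow> level E \<gamma> x - level E \<gamma> y = int (gdist E x y)"

definition sons :: "('v \<Rightarrow> 'v \<Rightarrow> bool) \<Rightarrow> (nat \<Rightarrow> 'v) \<Rightarrow> 'v \<Rightarrow> 'v set" where
  "sons E \<gamma> x = {y. E x y \<and> level E \<gamma> y = level E \<gamma> x - 1}"


section \<open>Flow measures\<close>

definition flow :: "('v \<Rightarrow> 'v \<Rightarrow> bool) \<Rightarrow> (nat \<Rightarrow> 'v) \<Rightarrow> ('v \<Rightarrow> real) \<Rightarrow> bool" where
  "flow E \<gamma> m \<longleftrightarrow> (\<forall>x. 0 < m x \<and> (m has_sum m x) (sons E \<gamma> x))"

definition vmeasure :: "('v \<Rightarrow> real) \<Rightarrow> 'v measure" where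
  "vmeasure m = point_measure UNIV (\<lambda>x. ennreal (m x))"

definition locally_doubling :: "('v \<Rightarrow> 'v \<Rightarrow> bool) \<Rightarrow> ('v \<Rightarrow> real) \<Rightarrow> bool" where
  "locally_doubling E m \<longleftrightarrow> (\<forall>r>0. \<exists>C>1. \<forall>x.
     emeasure (vmeasure m) (gball E (2 * r) x) \<le> ennreal C * emeasure (vmeasure m) (gball E r x))"


section \<open>Admissible trapezoids\<close>

definition trapezoid ::
    "('v \<Rightarrow> 'v \<Rightarrow> bool) \<Rightarrow> (nat \<Rightarrow> 'v) \<Rightarrow> int \<Rightarrow> int \<Rightarrow> 'v \<Rightarrow> 'v set" where
  "trapezoid E \<gamma> h' h'' x0 =
     {x. below E \<gamma> x x0 \<and> level E \<gamma> x0 - h'' < level E \<gamma> x \<and> level E \<gamma> x \<le> level E \<gamma> x0 - h'}"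

definition admissible :: "('v \<Rightarrow> 'v \<Rightarrow> bool) \<Rightarrow> (nat \<Rightarrow> 'v) \<Rightarrow> real \<Rightarrow> 'v set set" where
  "admissible E \<gamma> \<beta> = {{x0} | x0. True} \<union>
     {trapezoid E \<gamma> h' h'' x0 | h' h'' x0. 1 \<le> h' \<and> h' < h'' \<and>
        2 \<le> real_of_int h'' / real_of_int h' \<and> real_of_int h'' / real_of_int h' \<le> \<beta>}"


section \<open>Complex vector spaces\<close>

class complex_vector = ab_group_add +
  fixes scaleC :: "complex \<Rightarrow> 'a \<Rightarrow> 'a" (infixr \<open>*\<^sub>C\<close> 75)
  assumes scaleC_add_right: "c *\<^sub>C (x + y) = c *\<^sub>C x + c *\<^sub>C y"
    and scaleC_add_left: "(c + d) *\<^sub>C x = c *\<^sub>C x + d *\<^sub>C x"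
    and scaleC_scaleC: "c *\<^sub>C (d *\<^sub>C x) = (c * d) *\<^sub>C x"
    and scaleC_one: "1 *\<^sub>C x = x"

lemma vector_space_scaleC: "vector_space (scaleC :: complex \<Rightarrow> 'a \<Rightarrow> 'a::complex_vector)"
  by unfold_locales
    (simp_all add: scaleC_add_right scaleC_add_left scaleC_scaleC scaleC_one)

instantiation complex :: complex_vector
begin

definition scaleC_complex_def: "c *\<^sub>C (x::complex) = c * x"

instance
  by standard (simp_all add: scaleC_complex_def algebra_simps)

end

instantiation "fun" :: (type, complex_vector) complex_vector
begin

definition scaleC_fun_def: "c *\<^sub>C f = (\<lambda>x. c *\<^sub>C f x)"

instance
  by standard
    (simp_all add: scaleC_fun_def fun_eq_iff scaleC_add_right scaleC_add_left scaleC_scaleC scaleC_one)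

end

text \<open>Complex functions on \<open>'v\<close> modulo constant functions.\<close>

quotient_type 'v fun_mod_const =
  "'v \<Rightarrow> complex" / "\<lambda>f g. \<exists>c. \<forall>x. f x = g x + c"
  morphisms rep_mod_const mod_const
proof (rule equivpI)
  show "reflp (\<lambda>(f::'v \<Rightarrow> complex) g. \<exists>c. \<forall>x. f x = g x + c)"
    by (rule reflpI) (metis add.right_neutral)
  show "symp (\<lambda>(f::'v \<Rightarrow> complex) g. \<exists>c. \<forall>x. f x = g x + c)"
    by (rule sympI) (metis add_diff_cancel diff_conv_add_uminus)
  show "transp (\<lambda>(f::'v \<Rightarrow> complex) g. \<exists>c. \<forall>x. f x = g x + c)"
    by (rule transpI) (metis add.assoc)
qed

instantiation fun_mod_const :: (type) complex_vector
begin

lift_definition zero_fun_mod_const :: "'a fun_mod_const" is "0" .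

lift_definition plus_fun_mod_const ::
    "'a fun_mod_const \<Rightarrow> 'a fun_mod_const \<Rightarrow> 'a fun_mod_const" is "(+)"
proof -
  fix f f' g g' :: "'a \<Rightarrow> complex"
  assume "\<exists>c. \<forall>x. f x = f' x + c" "\<exists>c. \<forall>x. g x = g' x + c"
  then obtain c d where "\<forall>x. f x = f' x + c" "\<forall>x. g x = g' x + d" by blast
  then have "\<forall>x. (f + g) x = (f' + g') x + (c + d)" by simp
  then show "\<exists>c. \<forall>x. (f + g) x = (f' + g') x + c" by blast
qed

lift_definition uminus_fun_mod_const :: "'a fun_mod_const \<Rightarrow> 'a fun_mod_const" is "uminus"
proof -
  fix f f' :: "'a \<Rightarrow> complex"
  assume "\<exists>c. \<forall>x. f x = f' x + c"
  then obtain c where "\<forall>x. f x = f' x + c" by blast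
  then have "\<forall>x. (- f) x = (- f') x + (- c)" by simp
  then show "\<exists>c. \<forall>x. (- f) x = (- f') x + c" by blast
qed

definition minus_fun_mod_const ::
    "'a fun_mod_const \<Rightarrow> 'a fun_mod_const \<Rightarrow> 'a fun_mod_const" where
  "minus_fun_mod_const u v = u + (- v)"

lift_definition scaleC_fun_mod_const :: "complex \<Rightarrow> 'a fun_mod_const \<Rightarrow> 'a fun_mod_const"
  is "scaleC"
proof -
  fix a and f f' :: "'a \<Rightarrow> complex"
  assume "\<exists>c. \<forall>x. f x = f' x + c"
  then obtain c where "\<forall>x. f x = f' x + c" by blast
  then have "\<forall>x. (a *\<^sub>C f) x = (a *\<^sub>C f') x + a * c"
    by (simp add: scaleC_fun_def scaleC_complex_def distrib_left)
  then show "\<exists>c. \<forall>x. (a *\<^sub>C f) x = (a *\<^sub>C f') x + c" by blast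
qed

instance
proof
  fix u v w :: "'a fun_mod_const" and c d :: complex
  show "u + v + w = u + (v + w)"
    by transfer (rule exI[of _ 0], simp add: add.assoc)
  show "u + v = v + u"
    by transfer (rule exI[of _ 0], simp add: add.commute)
  show "0 + u = u"
    by transfer (rule exI[of _ 0], simp)
  show "- u + u = 0"
    by transfer (rule exI[of _ 0], simp)
  show "u - v = u + - v"
    by (simp add: minus_fun_mod_const_def)
  show "c *\<^sub>C (u + v) = c *\<^sub>C u + c *\<^sub>C v"
    by transfer (rule exI[of _ 0], simp add: scaleC_add_right)
  show "(c + d) *\<^sub>C u = c *\<^sub>C u + d *\<^sub>C u"
    by transfer (rule exI[of _ 0], simp add: scaleC_add_left)
  show "c *\<^sub>C d *\<^sub>C u = (c * d) *\<^sub>C u"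
    by transfer (rule exI[of _ 0], simp add: scaleC_scaleC)
  show "1 *\<^sub>C u = u"
    by transfer (rule exI[of _ 0], simp add: scaleC_one)
qed

end


section \<open>Normed subspaces and complex interpolation\<close>

text \<open>
  A normed space is given by its carrier inside an ambient vector space together with its norm;
  a compatible couple consists of two such spaces in the same ambient space. The value of
  \<open>nnorm\<close> off the carrier is irrelevant.
\<close>

datatype 'a nspace = NSpace (carr: "'a set") (nnorm: "'a \<Rightarrow> real")

definition equal_spaces :: "'a nspace \<Rightarrow> 'a nspace \<Rightarrow> bool" (infix \<open>\<doteq>\<close> 50) where
  "X \<doteq> Y \<longleftrightarrow> carr X = carr Y \<and>
     (\<exists>C>0. \<forall>f\<in>carr X. nnorm X f \<le> C * nnorm Y f \<and> nnorm Y f \<le> C * nnorm X f)"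

definition sum_space :: "'a::complex_vector nspace \<Rightarrow> 'a nspace \<Rightarrow> 'a nspace" where
  "sum_space A0 A1 = NSpace {a + b | a b. a \<in> carr A0 \<and> b \<in> carr A1}
     (\<lambda>f. Inf {nnorm A0 a + nnorm A1 b | a b. a \<in> carr A0 \<and> b \<in> carr A1 \<and> f = a + b})"

definition dual :: "'a::complex_vector nspace \<Rightarrow> ('a \<Rightarrow> complex) set" where
  "dual X = {l. (\<forall>f\<in>carr X. \<forall>g\<in>carr X. l (f + g) = l f + l g) \<and>
     (\<forall>c. \<forall>f\<in>carr X. l (c *\<^sub>C f) = c * l f) \<and>
     (\<exists>C. \<forall>f\<in>carr X. norm (l f) \<le> C * nnorm X f)}"

definition strip :: "complex set" where
  "strip = {z. 0 < Re z \<and> Re z < 1}"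

definition calderon_class ::
    "'a::complex_vector nspace \<Rightarrow> 'a nspace \<Rightarrow> (complex \<Rightarrow> 'a) set" where
  "calderon_class A0 A1 = {F.
     (\<forall>z\<in>closure strip. F z \<in> carr (sum_space A0 A1)) \<and>
     (\<forall>l\<in>dual (sum_space A0 A1).
        continuous_on (closure strip) (\<lambda>z. l (F z)) \<and>
        bounded ((\<lambda>z. l (F z)) ` closure strip) \<and>
        (\<lambda>z. l (F z)) analytic_on strip) \<and>
     (\<forall>t::real. F (\<i> * of_real t) \<in> carr A0) \<and>
     bdd_above (range (\<lambda>t::real. nnorm A0 (F (\<i> * of_real t)))) \<and>
     (\<forall>t::real. F (1 + \<i> * of_real t) \<in> carr A1) \<and>
     bdd_above (range (\<lambda>t::real. nnorm A1 (F (1 + \<i> * of_real t))))}"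

definition calderon_norm ::
    "'a::complex_vector nspace \<Rightarrow> 'a nspace \<Rightarrow> (complex \<Rightarrow> 'a) \<Rightarrow> real" where
  "calderon_norm A0 A1 F = (SUP t::real.
     max (nnorm A0 (F (\<i> * of_real t))) (nnorm A1 (F (1 + \<i> * of_real t))))"

definition complex_interpolation ::
    "'a::complex_vector nspace \<Rightarrow> 'a nspace \<Rightarrow> real \<Rightarrow> 'a nspace" where
  "complex_interpolation A0 A1 \<theta> = NSpace
     {F (of_real \<theta>) | F. F \<in> calderon_class A0 A1}
     (\<lambda>f. Inf {calderon_norm A0 A1 F | F. F \<in> calderon_class A0 A1 \<and> F (of_real \<theta>) = f})"

text \<open>
  The image of a function space in the functions modulo constants, with the quotient norm.
  If the space contains no nonzero constant (as \<open>L\<^sup>p\<close> with \<open>p < \<infinity>\<close> over an infinite measure), the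
  infimum runs over a single function; for \<open>BMO\<close> the norm is the same for all representatives.
\<close>

definition modulo_constants :: "('v \<Rightarrow> complex) nspace \<Rightarrow> 'v fun_mod_const nspace" where
  "modulo_constants X = NSpace (mod_const ` carr X)
     (\<lambda>u. Inf {nnorm X f | f. f \<in> carr X \<and> mod_const f = u})"


section \<open>The function spaces\<close>

text \<open>Every function is measurable with respect to \<^const>\<open>vmeasure\<close>.\<close>

definition Lp :: "('v \<Rightarrow> real) \<Rightarrow> real \<Rightarrow> ('v \<Rightarrow> complex) nspace" where
  "Lp m p = NSpace {f. integrable (vmeasure m) (\<lambda>x. norm (f x) powr p)}
     (\<lambda>f. (LINT x|vmeasure m. norm (f x) powr p) powr (1 / p))"

text \<open>A flow charges every vertex, so the essential supremum is the supremum.\<close>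

definition Linf :: "('v \<Rightarrow> complex) nspace" where
  "Linf = NSpace {f. bounded (range f)} (\<lambda>f. SUP x. norm (f x))"

definition average :: "('v \<Rightarrow> real) \<Rightarrow> 'v set \<Rightarrow> ('v \<Rightarrow> complex) \<Rightarrow> complex" where
  "average m R f = (1 / measure (vmeasure m) R) *\<^sub>R (LINT x:R|vmeasure m. f x)"

definition oscillation :: "('v \<Rightarrow> real) \<Rightarrow> 'v set \<Rightarrow> ('v \<Rightarrow> complex) \<Rightarrow> real" where
  "oscillation m R f =
     1 / measure (vmeasure m) R * (LINT x:R|vmeasure m. norm (f x - average m R f))"

definition BMO ::
    "('v \<Rightarrow> 'v \<Rightarrow> bool) \<Rightarrow> (nat \<Rightarrow> 'v) \<Rightarrow> ('v \<Rightarrow> real) \<Rightarrow> real \<Rightarrow> ('v \<Rightarrow> complex) nspace" where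
  "BMO E \<gamma> m \<beta> = NSpace
     {f. bdd_above ((\<lambda>R. oscillation m R f) ` admissible E \<gamma> \<beta>)}
     (\<lambda>f. SUP R\<in>admissible E \<gamma> \<beta>. oscillation m R f)"

definition atom ::
    "('v \<Rightarrow> 'v \<Rightarrow> bool) \<Rightarrow> (nat \<Rightarrow> 'v) \<Rightarrow> ('v \<Rightarrow> real) \<Rightarrow> real \<Rightarrow> ('v \<Rightarrow> complex) \<Rightarrow> bool" where
  "atom E \<gamma> m \<beta> a \<longleftrightarrow> (\<exists>R\<in>admissible E \<gamma> \<beta>.
     (\<forall>x. x \<notin> R \<longrightarrow> a x = 0) \<and>
     (\<forall>x. norm (a x) \<le> 1 / measure (vmeasure m) R) \<and>
     (LINT x:R|vmeasure m. a x) = 0)"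

text \<open>
  The atomic series converges in the norm of \<open>L\<^sup>1\<close>. Finite sums are included, since the zero
  function is an atom.
\<close>

definition atomic_decomposition ::
    "('v \<Rightarrow> 'v \<Rightarrow> bool) \<Rightarrow> (nat \<Rightarrow> 'v) \<Rightarrow> ('v \<Rightarrow> real) \<Rightarrow> real \<Rightarrow>
     (nat \<Rightarrow> complex) \<Rightarrow> (nat \<Rightarrow> 'v \<Rightarrow> complex) \<Rightarrow> ('v \<Rightarrow> complex) \<Rightarrow> bool" where
  "atomic_decomposition E \<gamma> m \<beta> c a g \<longleftrightarrow>
     (\<forall>j. atom E \<gamma> m \<beta> (a j)) \<and> summable (\<lambda>j. norm (c j)) \<and>
     (\<lambda>n. nnorm (Lp m 1) (\<lambda>x. g x - (\<Sum>j<n. c j * a j x))) \<longlonglongrightarrow> 0"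

definition H1 ::
    "('v \<Rightarrow> 'v \<Rightarrow> bool) \<Rightarrow> (nat \<Rightarrow> 'v) \<Rightarrow> ('v \<Rightarrow> real) \<Rightarrow> real \<Rightarrow> ('v \<Rightarrow> complex) nspace" where
  "H1 E \<gamma> m \<beta> = NSpace
     {g \<in> carr (Lp m 1). \<exists>c a. atomic_decomposition E \<gamma> m \<beta> c a g}
     (\<lambda>g. Inf {(\<Sum>j. norm (c j)) | c a. atomic_decomposition E \<gamma> m \<beta> c a g})"

end

theory Submission
  imports Defs "HOL-Complex_Analysis.Conformal_Mappings"
begin

text \<open>
  Everything rests on one decomposition. A finitely supported function \<open>f\<close> of integral zero is
  written as \<open>\<Sum>\<^sub>i l\<^sub>i v\<^sub>i\<close>, where \<open>v\<^sub>i\<close> has integral zero and lives on an admissible set \<open>R\<^sub>i\<close>,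
  \<open>\<Sum>\<^sub>i \<bar>v\<^sub>i\<bar>\<close> is bounded and \<open>\<Sum>\<^sub>i l\<^sub>i\<^sup>q m(R\<^sub>i)\<close> is controlled by the \<open>q\<close>-th power of the \<open>L\<^sup>q\<close> norm
  of \<open>f\<close>. Hence \<open>F(z) = \<Sum>\<^sub>i l\<^sub>i powr (q (1 - z)) v\<^sub>i\<close> is bounded in \<open>H\<^sup>1\<close> on \<open>Re z = 0\<close> and in
  \<open>L\<^sup>\<infinity>\<close> on \<open>Re z = 1\<close>, and it equals \<open>f\<close> at \<open>\<theta>\<close>. Conversely, pairing an element of the
  Calderon class of \<open>(L\<^sup>1, BMO)\<close> with such an analytic family for the dual exponent and using the
  three lines theorem bounds its value at \<open>\<theta>\<close> as a functional on the functions of integral zero in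
  the dual of \<open>L\<^sup>q\<close>. All remaining inclusions follow from \<open>H\<^sup>1 \<subseteq> L\<^sup>1\<close> and \<open>L\<^sup>\<infinity> \<subseteq> BMO\<close>.
\<close>

section \<open>Geometry of the rooted tree\<close>

text \<open>Integral zero costs nothing in L^q because the whole tree has infinite mass: an integral
  can be spread over a set so large that the correction is small in L^q, as q > 1. In the dual
  argument it does cost uniqueness: tests of integral zero determine a function only up to a
  constant. This is harmless in the couples with BMO, which are taken modulo constants, but not in
  (H^1, L^infinity). There the bound by the L^q norm is proved separately, by the Riesz-Thorin
  argument with point evaluations and arbitrary finitely supported tests. The obstacle in the
  decomposition is that its constant must not depend on the support. Every finite set lies in a
  trapezoid hanging from a distant vertex of the ray, and trapezoids of bounded aspect ratio can be
  cut into pieces of the same kind with uniformly bounded mass ratios. Since elements of the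
  Calderon class are regular only when tested by functionals of the sum space, the three lines
  argument is run on finite sums of such functionals, and the finite decomposition supplies
  them.\<close>

lemma gdist_relpowp:
  assumes "E\<^sup>*\<^sup>* x y"
  shows "(E ^^ gdist E x y) x y"
  unfolding gdist_def using assms by (metis (mono_tags) LeastI_ex rtranclp_power)

lemma gdist_le: "(E ^^ n) x y \<Longrightarrow> gdist E x y \<le> n"
  unfolding gdist_def by (rule Least_le)

lemma relpowp_symp:
  assumes "symp E" "(E ^^ n) x y"
  shows "(E ^^ n) y x"
  using assms(2)
proof (induction n arbitrary: y)
  case (Suc n)
  then obtain z where "(E ^^ n) x z" "E z y" by auto
  then show ?case
    using Suc.IH[of z] assms(1) relpowp_Suc_I2[of E y z n x] by (auto dest: sympD)
qed simp

context
  fixes E :: "'v \<Rightarrow> 'v \<Rightarrow> bool"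
  assumes tree: "tree E"
begin

lemma tree_sym: "E x y \<Longrightarrow> E y x"
  using tree by (auto simp: tree_def dest: sympD)

lemma tree_irrefl: "\<not> E x x"
  using tree by (auto simp: tree_def dest: irreflpD)

lemma tree_path: "(E ^^ gdist E x y) x y"
  using tree by (intro gdist_relpowp) (auto simp: tree_def)

lemma gdist_sym: "gdist E x y = gdist E y x"
proof -
  have "symp E" using tree by (simp add: tree_def)
  then show ?thesis using relpowp_symp[OF _ tree_path] gdist_le by (metis order_antisym)
qed

lemma gdist_self [simp]: "gdist E x x = 0"
  using gdist_le[of 0 E x x] by simp

lemma gdist_eq_0 [simp]: "gdist E x y = 0 \<longleftrightarrow> x = y"
  using tree_path[of x y] by auto

lemma gdist_triangle: "gdist E x z \<le> gdist E x y + gdist E y z"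
  using tree_path[of x y] tree_path[of y z] by (intro gdist_le) (auto simp: relpowp_add)

lemma gdist_edge: "E x y \<Longrightarrow> gdist E x y = 1"
  using gdist_le[of 1 E x y] gdist_eq_0[of x y] tree_irrefl[of x] by (cases "gdist E x y") auto

lemma gdist_edge_le: "E x y \<Longrightarrow> gdist E x w \<le> Suc (gdist E y w)"
  using gdist_triangle[of x w y] gdist_edge[of x y] by simp

lemma nearer_neighbour:
  assumes "gdist E x w = Suc n"
  obtains y where "E x y" "gdist E y w = n"
proof -
  have "(E ^^ Suc n) x w" using tree_path[of x w] assms by simp
  then obtain y where y: "E x y" "(E ^^ n) y w" by (meson relpowp_Suc_D2)
  then have "gdist E y w \<le> n" "gdist E x w \<le> Suc (gdist E y w)"
    using gdist_le gdist_edge_le by metis+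
  then show ?thesis using that y assms by simp
qed

text \<open>Walk from both ends towards \<open>w\<close> until the two walks merge. Keeping the path
  inside the ball of radius \<open>n\<close> makes it simple: the ends added at the next stage are
  at distance \<open>n + 1\<close> and so are new.\<close>

lemma equidistant_path:
  assumes "gdist E y w = n" "gdist E y' w = n" "y \<noteq> y'"
  shows "\<exists>p. 3 \<le> length p \<and> distinct p \<and> successively E p \<and> hd p = y \<and> last p = y' \<and>
    (\<forall>z\<in>set p. gdist E z w \<le> n)"
  using assms
proof (induction n arbitrary: y y')
  case 0
  then show ?case by auto
next
  case (Suc n)
  obtain z where z: "E y z" "gdist E z w = n" using nearer_neighbour Suc.prems(1) by blast
  obtain z' where z': "E y' z'" "gdist E z' w = n" using nearer_neighbour Suc.prems(2) by blast
  show ?case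
  proof (cases "z = z'")
    case True
    have ne: "y \<noteq> z" "z \<noteq> y'" using Suc.prems(1,2) z(2) by (metis n_not_Suc_n)+
    show ?thesis
    proof (intro exI[of _ "[y, z, y']"] conjI)
      show "successively E [y, z, y']" using z(1) tree_sym[OF z'(1)] True by simp
      show "\<forall>x\<in>set [y, z, y']. gdist E x w \<le> Suc n" using Suc.prems(1,2) z(2) by simp
    qed (use ne Suc.prems(3) in simp_all)
  next
    case False
    obtain p where p: "3 \<le> length p" "distinct p" "successively E p" "hd p = z" "last p = z'"
      "\<forall>z\<in>set p. gdist E z w \<le> n"
      using Suc.IH[OF z(2) z'(2) False] by auto
    then have "p \<noteq> []" by auto
    have "gdist E x w < Suc n" if "x \<in> set p" for x using p(6) that by (simp add: less_Suc_eq_le)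
    then have new: "y \<notin> set p" "y' \<notin> set p" using Suc.prems(1,2) by force+
    show ?thesis
    proof (intro exI[of _ "y # p @ [y']"] conjI)
      show "successively E (y # p @ [y'])"
        using p(3-5) \<open>p \<noteq> []\<close> z(1) tree_sym[OF z'(1)]
        by (simp add: successively_Cons successively_append_iff)
      show "\<forall>x\<in>set (y # p @ [y']). gdist E x w \<le> Suc n" using Suc.prems(1,2) p(6) by force
      show "distinct (y # p @ [y'])" using new p(2) Suc.prems(3) by simp
    qed (use p(1) in simp_all)
  qed
qed

text \<open>The edge would close the path between two equidistant vertices to a cycle; trees are
  bipartite.\<close>

lemma gdist_edge_neq:
  assumes "E x y"
  shows "gdist E x w \<noteq> gdist E y w"
proof
  assume "gdist E x w = gdist E y w"
  moreover have "x \<noteq> y" using assms tree_irrefl by auto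
  ultimately obtain p where "3 \<le> length p" "distinct p" "successively E p" "hd p = x" "last p = y"
    using equidistant_path by metis
  then have "cycle E p" using assms tree_sym by (simp add: cycle_def)
  then show False using tree by (simp add: tree_def)
qed

text \<open>Here \<open>x\<close> itself closes the path to a cycle: it is farther from
  \<open>w\<close> than every vertex of the path and hence not on it.\<close>

lemma nearer_neighbour_unique:
  assumes "E x y" "E x y'" "gdist E x w = Suc n" "gdist E y w = n" "gdist E y' w = n"
  shows "y = y'"
proof (rule ccontr)
  assume "y \<noteq> y'"
  then obtain p where p: "3 \<le> length p" "distinct p" "successively E p" "hd p = y" "last p = y'"
    "\<forall>z\<in>set p. gdist E z w \<le> n"
    using equidistant_path assms by metis
  then have "cycle E (x # p)"
    using assms tree_sym by (auto simp: cycle_def successively_Cons)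
  then show False using tree by (simp add: tree_def)
qed

end

section \<open>Levels and generations in a tree with root at infinity\<close>

locale rooted_tree =
  fixes E :: "'v \<Rightarrow> 'v \<Rightarrow> bool" and \<gamma> :: "nat \<Rightarrow> 'v"
  assumes tree: "tree E" and ray: "geodesic_ray E \<gamma>"
begin

lemma ray_edge: "E (\<gamma> k) (\<gamma> (Suc k))"
proof -
  have "gdist E (\<gamma> k) (\<gamma> (Suc k)) = 1" using ray by (simp add: geodesic_ray_def)
  then show ?thesis using tree_path[OF tree, of "\<gamma> k" "\<gamma> (Suc k)"] by auto
qed

text \<open>The only neighbour of \<open>\<gamma> (Suc k)\<close> nearer to \<open>x\<close> is
  \<open>\<gamma> k\<close>, and a geodesic ray does not turn back to it. Having begun to move away
  from \<open>x\<close>, the ray never stops.\<close>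

lemma ray_increases:
  assumes "gdist E x (\<gamma> (Suc k)) = Suc (gdist E x (\<gamma> k))"
  shows "gdist E x (\<gamma> (Suc (Suc k))) = Suc (gdist E x (\<gamma> (Suc k)))"
proof -
  have e: "E (\<gamma> (Suc k)) (\<gamma> (Suc (Suc k)))" "E (\<gamma> (Suc k)) (\<gamma> k)"
    using ray_edge tree_sym[OF tree] by blast+
  note n = gdist_edge_neq[OF tree e(1), of x] gdist_edge_le[OF tree e(1), of x]
    gdist_edge_le[OF tree tree_sym[OF tree e(1)], of x]
  have "gdist E (\<gamma> (Suc (Suc k))) x \<noteq> gdist E (\<gamma> k) x"
  proof
    assume *: "gdist E (\<gamma> (Suc (Suc k))) x = gdist E (\<gamma> k) x"
    have "\<gamma> (Suc (Suc k)) = \<gamma> k"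
      using nearer_neighbour_unique[OF tree e, of x] * assms by (simp add: gdist_sym[OF tree])
    moreover have "gdist E (\<gamma> k) (\<gamma> (Suc (Suc k))) = 2"
      using ray by (simp add: geodesic_ray_def)
    ultimately show False by (simp add: gdist_self[OF tree])
  qed
  then show ?thesis using n assms by (simp add: gdist_sym[OF tree])
qed

text \<open>The level is the Busemann function of the ray, and thus inherits the local behaviour
  of the distance to a fixed vertex.\<close>

lemma level_eventually: "\<exists>i. \<forall>N\<ge>i. level E \<gamma> x = int N - int (gdist E x (\<gamma> N))"
proof -
  have "ray_proj E \<gamma> x \<in> range \<gamma> \<and> (\<forall>y\<in>range \<gamma>. gdist E x (ray_proj E \<gamma> x) \<le> gdist E x y)"
    unfolding ray_proj_def arg_min_on_def
    using arg_min_nat_lemma[of "\<lambda>y. y \<in> range \<gamma>" "\<gamma> 0" "gdist E x"] by auto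
  then obtain i where i: "ray_proj E \<gamma> x = \<gamma> i" "\<And>k. gdist E x (\<gamma> i) \<le> gdist E x (\<gamma> k)"
    by auto
  \<comment> \<open>Past the closest point of the ray the distance to \<open>x\<close> grows by one
    at each vertex: at first by minimality, then by \<open>ray_increases\<close>.\<close>
  have step: "gdist E x (\<gamma> (Suc (i + k))) = Suc (gdist E x (\<gamma> (i + k)))" for k
  proof (induction k)
    case 0
    have e: "E (\<gamma> (Suc i)) (\<gamma> i)" using ray_edge tree_sym[OF tree] by blast
    show ?case
      using gdist_edge_neq[OF tree e, of x] gdist_edge_le[OF tree e, of x] i(2)[of "Suc i"]
      by (simp add: gdist_sym[OF tree])
  next
    case (Suc k)
    then show ?case using ray_increases by simp
  qed
  have sum: "gdist E x (\<gamma> (i + k)) = gdist E x (\<gamma> i) + k" for k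
    by (induction k) (auto simp: step)
  have "gdist E (\<gamma> 0) (\<gamma> i) = i" using ray by (simp add: geodesic_ray_def)
  then have "level E \<gamma> x = int i - int (gdist E x (\<gamma> i))"
    by (simp add: level_def i(1) gdist_sym[OF tree])
  then show ?thesis
    using sum by (metis (no_types, lifting) add_diff_cancel_right le_Suc_ex of_nat_add)
qed

lemma level_Lipschitz: "level E \<gamma> x - level E \<gamma> y \<le> int (gdist E x y)"
proof -
  obtain i where i: "\<forall>N\<ge>i. level E \<gamma> x = int N - int (gdist E x (\<gamma> N))"
    using level_eventually by blast
  obtain j where j: "\<forall>N\<ge>j. level E \<gamma> y = int N - int (gdist E y (\<gamma> N))"
    using level_eventually by blast
  have "gdist E y (\<gamma> (max i j)) \<le> gdist E x y + gdist E x (\<gamma> (max i j))"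
    using gdist_triangle[OF tree, of y "\<gamma> (max i j)" x] gdist_sym[OF tree, of x y] by simp
  then show ?thesis using i[rule_format, of "max i j"] j[rule_format, of "max i j"] by simp
qed

text \<open>For \<open>N\<close> large, both candidates are the neighbour of \<open>z\<close> that
  is one step nearer to \<open>\<gamma> N\<close>.\<close>

lemma father_unique:
  assumes "z \<in> sons E \<gamma> x" "z \<in> sons E \<gamma> y"
  shows "x = y"
proof -
  obtain i j k where
    i: "\<forall>N\<ge>i. level E \<gamma> x = int N - int (gdist E x (\<gamma> N))" and
    j: "\<forall>N\<ge>j. level E \<gamma> y = int N - int (gdist E y (\<gamma> N))" and
    k: "\<forall>N\<ge>k. level E \<gamma> z = int N - int (gdist E z (\<gamma> N))"
    using level_eventually by meson
  define N where "N = max i (max j k)"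
  have N: "N \<ge> i" "N \<ge> j" "N \<ge> k" by (auto simp: N_def)
  have "E z x" "E z y" using assms tree_sym[OF tree] by (auto simp: sons_def)
  moreover have "gdist E z (\<gamma> N) = Suc (gdist E x (\<gamma> N))" "gdist E y (\<gamma> N) = gdist E x (\<gamma> N)"
    using assms i[rule_format, OF N(1)] j[rule_format, OF N(2)] k[rule_format, OF N(3)]
    by (simp_all add: sons_def)
  ultimately show ?thesis using nearer_neighbour_unique[OF tree] by metis
qed

text \<open>The generations below \<open>x\<close>. The recursion through sons matches the flow
  identity, so that masses can be computed by induction; \<open>desc_iff\<close> supplies the
  description by distance and level.\<close>

primrec desc :: "nat \<Rightarrow> 'v \<Rightarrow> 'v set" where
  "desc 0 x = {x}"
| "desc (Suc k) x = (\<Union>y\<in>sons E \<gamma> x. desc k y)"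

lemma desc_Suc_right: "desc (Suc k) x = (\<Union>y\<in>desc k x. sons E \<gamma> y)"
proof (induction k arbitrary: x)
  case (Suc k)
  have "desc (Suc (Suc k)) x = (\<Union>y\<in>sons E \<gamma> x. \<Union>z\<in>desc k y. sons E \<gamma> z)"
    using Suc by simp
  then show ?case by auto
qed simp

lemma desc_iff: "y \<in> desc k x \<longleftrightarrow> gdist E x y = k \<and> level E \<gamma> y = level E \<gamma> x - int k"
proof (induction k arbitrary: x)
  case 0
  then show ?case by (auto simp: gdist_eq_0[OF tree])
next
  case (Suc k)
  show ?case
  proof
    assume "y \<in> desc (Suc k) x"
    then obtain z where z: "E x z" "level E \<gamma> z = level E \<gamma> x - 1" "gdist E z y = k"
      "level E \<gamma> y = level E \<gamma> z - int k"
      using Suc by (auto simp: sons_def)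
    then show "gdist E x y = Suc k \<and> level E \<gamma> y = level E \<gamma> x - int (Suc k)"
      using gdist_edge_le[OF tree z(1), of y] level_Lipschitz[of x y] by simp
  next
    assume *: "gdist E x y = Suc k \<and> level E \<gamma> y = level E \<gamma> x - int (Suc k)"
    then obtain z where z: "E x z" "gdist E z y = k" using nearer_neighbour[OF tree] by metis
    \<comment> \<open>The level falls by at most 1 from \<open>x\<close> to \<open>z\<close> and by
      at most \<open>k\<close> from \<open>z\<close> to \<open>y\<close>; the total fall is
      \<open>k + 1\<close>, so both bounds are attained.\<close>
    have "level E \<gamma> z = level E \<gamma> x - 1"
      using level_Lipschitz[of z y] level_Lipschitz[of x z] gdist_edge[OF tree z(1)] z(2) * by simp
    then show "y \<in> desc (Suc k) x" using z Suc[of z] * by (auto simp: sons_def)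
  qed
qed

lemma desc_disjoint: "z \<in> desc k x \<Longrightarrow> z \<in> desc k y \<Longrightarrow> x = y"
proof (induction k arbitrary: z)
  case (Suc k)
  then show ?case unfolding desc_Suc_right using father_unique by blast
qed simp

text \<open>The level falls as the generation grows, so the half-open range turns round: generation
  \<open>h'\<close> belongs to the trapezoid and generation \<open>h''\<close> does not.\<close>

lemma trapezoid_eq_desc:
  assumes "0 \<le> h'"
  shows "trapezoid E \<gamma> h' h'' x0 = (\<Union>k\<in>{nat h'..<nat h''}. desc k x0)"
proof safe
  fix x assume "x \<in> trapezoid E \<gamma> h' h'' x0"
  then have "x \<in> desc (gdist E x0 x) x0" "gdist E x0 x \<in> {nat h'..<nat h''}"
    using assms by (auto simp: desc_iff trapezoid_def below_def)
  then show "x \<in> (\<Union>k\<in>{nat h'..<nat h''}. desc k x0)" by blast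
next
  fix x k assume "x \<in> desc k x0" "k \<in> {nat h'..<nat h''}"
  then show "x \<in> trapezoid E \<gamma> h' h'' x0"
    using assms by (auto simp: desc_iff trapezoid_def below_def)
qed

end

text \<open>A set is recursively split into pieces of comparable mass, down to single points,
  in place of a system of dyadic cubes.\<close>

inductive splits :: "('v \<Rightarrow> real) \<Rightarrow> real \<Rightarrow> 'v set set \<Rightarrow> 'v set \<Rightarrow> bool"
  for m :: "'v \<Rightarrow> real" and K :: real and \<R> :: "'v set set" where
  single: "{x} \<in> \<R> \<Longrightarrow> splits m K \<R> {x}"
| split: "Q \<in> \<R> \<Longrightarrow> finite P \<Longrightarrow> P \<noteq> {} \<Longrightarrow> disjoint P \<Longrightarrow> \<Union>P = Q \<Longrightarrow>
    (\<And>Q'. Q' \<in> P \<Longrightarrow> splits m K \<R> Q') \<Longrightarrow>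
    (\<And>Q'. Q' \<in> P \<Longrightarrow> sum m Q \<le> K * sum m Q') \<Longrightarrow> splits m K \<R> Q"

section \<open>Local finiteness, masses of trapezoids and their recursive splitting\<close>

locale flow_tree = rooted_tree E \<gamma> for E :: "'v \<Rightarrow> 'v \<Rightarrow> bool" and \<gamma> :: "nat \<Rightarrow> 'v" +
  fixes m :: "'v \<Rightarrow> real"
  assumes flow: "flow E \<gamma> m" and doubling: "locally_doubling E m"
begin

lemma m_pos: "0 < m x"
  using flow by (simp add: flow_def)

lemma emeasure_singleton: "emeasure (vmeasure m) {x} = ennreal (m x)"
  unfolding vmeasure_def by (subst emeasure_point_measure_finite2) auto

text \<open>Doubling at radius 1/2: the ball of radius 1/2 is a single vertex, the ball of radius 1
  contains its neighbours. As \<open>E\<close> is symmetric, the estimate holds from father to son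
  and back.\<close>

lemma edge_mass: "\<exists>C>1. \<forall>x y. E y x \<longrightarrow> m x \<le> C * m y"
proof -
  obtain C where C: "C > 1" "\<And>x. emeasure (vmeasure m) (gball E (2 * (1 / 2)) x)
      \<le> ennreal C * emeasure (vmeasure m) (gball E (1 / 2) x)"
    using doubling unfolding locally_doubling_def by (metis half_gt_zero_iff zero_less_one)
  have "m x \<le> C * m y" if "E y x" for x y
  proof -
    have "gball E (1 / 2) y = {y}" proof -
      have "real n \<le> 1 / 2 \<longleftrightarrow> n = 0" for n by (cases n) auto
      then show ?thesis by (auto simp: gball_def gdist_eq_0[OF tree])
    qed
    moreover have "{x} \<subseteq> gball E (2 * (1 / 2)) y"
      using gdist_edge[OF tree that] by (auto simp: gball_def)
    then have "emeasure (vmeasure m) {x} \<le> emeasure (vmeasure m) (gball E (2 * (1 / 2)) y)"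
      by (intro emeasure_mono) (auto simp: vmeasure_def sets_point_measure)
    ultimately have "ennreal (m x) \<le> ennreal C * ennreal (m y)"
      using C(2)[of y] by (simp add: emeasure_singleton)
    then have "ennreal (m x) \<le> ennreal (C * m y)"
      using C(1) m_pos[of y] by (simp add: ennreal_mult)
    then show ?thesis using C(1) m_pos[of y] by (simp add: ennreal_le_iff)
  qed
  then show ?thesis using C(1) by blast
qed

text \<open>Each son carries at least the fraction \<open>1 / C\<close> of the mass of
  \<open>x\<close>, and the sons together carry exactly that mass, so there are at most
  \<open>C\<close> of them. Local finiteness is thus a consequence of doubling.\<close>

lemma finite_sons: "finite (sons E \<gamma> x)"
proof -
  obtain C where C: "C > 1" "\<And>x y. E y x \<Longrightarrow> m x \<le> C * m y" using edge_mass by blast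
  have fin: "card F \<le> nat \<lceil>C\<rceil>" if "finite F" "F \<subseteq> sons E \<gamma> x" for F
  proof -
    have "m x / C \<le> m y" if "y \<in> F" for y
      using C that \<open>F \<subseteq> sons E \<gamma> x\<close> tree_sym[OF tree] by (auto simp: sons_def field_simps)
    then have "real (card F) * (m x / C) \<le> sum m F" by (intro sum_bounded_below)
    also have "sum m F \<le> m x"
      using flow that m_pos has_sum_mono_neutral[of m F "sum m F" m "sons E \<gamma> x" "m x"]
        less_imp_le[OF m_pos]
      by (auto simp: flow_def has_sum_finite)
    finally have "real (card F) \<le> C" using m_pos[of x] C(1) by (simp add: field_simps)
    then show ?thesis by linarith
  qed
  show ?thesis
  proof (rule ccontr)
    assume "infinite (sons E \<gamma> x)"
    then obtain F where "F \<subseteq> sons E \<gamma> x" "card F = Suc (nat \<lceil>C\<rceil>)" "finite F"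
      using infinite_arbitrarily_large by metis
    then show False using fin[of F] by simp
  qed
qed

lemma sum_sons: "sum m (sons E \<gamma> x) = m x"
  using flow finite_sons[of x] has_sum_finite[OF finite_sons, of m x] has_sum_unique
  by (fastforce simp: flow_def)

lemma finite_desc: "finite (desc k x)"
  by (induction k arbitrary: x) (auto simp: finite_sons)

lemma sum_desc: "sum m (desc k x) = m x"
proof (induction k arbitrary: x)
  case (Suc k)
  have "sum m (desc (Suc k) x) = (\<Sum>y\<in>sons E \<gamma> x. sum m (desc k y))"
    unfolding desc.simps
    by (rule sum.UNION_disjoint) (use finite_sons finite_desc desc_disjoint in blast)+
  then show ?case using Suc sum_sons by simp
qed simp

definition trap :: "nat \<Rightarrow> nat \<Rightarrow> 'v \<Rightarrow> 'v set" where
  "trap a b x = (\<Union>k\<in>{a..<b}. desc k x)"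

lemma desc_disjoint_levels: "z \<in> desc k x \<Longrightarrow> z \<in> desc l x \<Longrightarrow> k = l"
  by (simp add: desc_iff)

lemma finite_trap: "finite (trap a b x)"
  by (simp add: trap_def finite_desc)

text \<open>Every generation below \<open>x\<close> carries the mass \<open>m x\<close>, and
  different generations are disjoint.\<close>

lemma sum_trap: "a \<le> b \<Longrightarrow> sum m (trap a b x) = (real b - real a) * m x"
proof -
  assume "a \<le> b"
  have "sum m (trap a b x) = (\<Sum>k\<in>{a..<b}. sum m (desc k x))"
    unfolding trap_def
    by (rule sum.UNION_disjoint) (use finite_desc desc_disjoint_levels in blast)+
  then show ?thesis using \<open>a \<le> b\<close> by (simp add: sum_desc of_nat_diff)
qed

lemma trap_Suc: "trap (Suc a) (Suc b) x = (\<Union>y\<in>sons E \<gamma> x. trap a b y)"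
proof -
  have "trap (Suc a) (Suc b) x = (\<Union>k\<in>{a..<b}. desc (Suc k) x)"
    unfolding trap_def by (simp only: image_Suc_atLeastLessThan[symmetric] image_image)
  then show ?thesis by (auto simp: trap_def)
qed

lemma trap_disjoint:
  assumes "y \<in> sons E \<gamma> x" "y' \<in> sons E \<gamma> x" "z \<in> trap a b y" "z \<in> trap a b y'"
  shows "y = y'"
proof -
  obtain k l where kl: "z \<in> desc k y" "z \<in> desc l y'" using assms by (auto simp: trap_def)
  moreover have "level E \<gamma> y = level E \<gamma> y'" using assms by (simp add: sons_def)
  ultimately have "k = l" by (simp add: desc_iff)
  then show ?thesis using kl desc_disjoint by blast
qed

lemma trap_admissible:
  assumes "1 \<le> a" "2 * a \<le> b" "real b \<le> \<beta> * real a"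
  shows "trap a b x \<in> admissible E \<gamma> \<beta>"
proof -
  have "trap a b x = trapezoid E \<gamma> (int a) (int b) x"
    by (simp add: trapezoid_eq_desc trap_def)
  moreover have "1 \<le> int a" "int a < int b" "2 \<le> real_of_int (int b) / real_of_int (int a)"
    "real_of_int (int b) / real_of_int (int a) \<le> \<beta>"
    using assms by (auto simp: field_simps)
  ultimately show ?thesis unfolding admissible_def by blast
qed

lemma admissible_finite_nonempty:
  assumes "R \<in> admissible E \<gamma> \<beta>"
  shows "finite R \<and> R \<noteq> {}"
proof (cases "\<exists>x. R = {x}")
  case False
  then obtain h' h'' :: int and x where R: "R = trapezoid E \<gamma> h' h'' x" "1 \<le> h'" "h' < h''"
    using assms unfolding admissible_def by blast
  then have "R = trap (nat h') (nat h'') x" by (simp add: trapezoid_eq_desc trap_def)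
  moreover from this have "sum m R > 0" using R m_pos[of x] by (simp add: sum_trap)
  ultimately show ?thesis using finite_trap by auto
qed auto

text \<open>The aspect ratio \<open>b / a\<close> is kept in [2, 6], inside the admissible range. A
  tall trapezoid (\<open>4 * a \<le> b\<close>) is cut horizontally at generation
  \<open>2 * a\<close> into pieces of ratios 2 and \<open>b / (2 * a) \<le> 3\<close>. A flat one is
  distributed over the sons of its top; the new ratio \<open>(b - 1) / (a - 1)\<close> can rise, but
  at most to 6, which is reached from \<open>a = 2\<close>, \<open>b = 7\<close>. For
  \<open>a = 1\<close> at most two generations are left, and these are cut into single
  vertices.\<close>

lemma splits_trap:
  assumes C: "C > 1" "\<And>x y. E y x \<Longrightarrow> m x \<le> C * m y" and "\<beta> \<ge> 12"
    and "1 \<le> a" "2 * a \<le> b" "b \<le> 6 * a"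
  shows "splits m (5 * C\<^sup>2) (admissible E \<gamma> \<beta>) (trap a b x)"
  using assms(4-6)
\<comment> \<open>This quantity falls when \<open>b\<close> is lowered to \<open>2 * a\<close>, when
  \<open>a\<close> is raised to \<open>2 * a\<close>, and when both drop by 1 on passing to a
  son.\<close>
proof (induction "2 * b - a" arbitrary: a b x rule: less_induct)
  case less
  \<comment> \<open>Mass ratios: at most 5 for a horizontal cut, since
    \<open>b - a \<le> 5 * a\<close> and each piece has height at least \<open>a\<close>; at most
    \<open>C\<close> for the passage to a son; at most \<open>2 * C\<^sup>2\<close> for two
    generations cut into vertices.\<close>
  let ?R = "admissible E \<gamma> \<beta>" and ?K = "5 * C\<^sup>2"
  have C2: "C\<^sup>2 \<ge> 1" "C\<^sup>2 \<ge> C" using C(1)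
    using mult_mono[of 1 C 1 C] mult_mono[of 1 C C C] by (simp_all add: power2_eq_square)
  have mx: "0 < m x" by (rule m_pos)
  have "real b \<le> 6 * real a" using less.prems
    by (metis of_nat_le_iff of_nat_mult of_nat_numeral)
  also have "6 * real a \<le> \<beta> * real a" using assms(3) by (intro mult_right_mono) auto
  finally have adm: "trap a b x \<in> ?R" using less.prems by (intro trap_admissible) auto
  have son: "m x \<le> C * m y" if "y \<in> sons E \<gamma> x" for x y
    using that C(2) tree_sym[OF tree] by (auto simp: sons_def)
  consider "4 * a \<le> b" | "b < 4 * a" "a \<ge> 2" | "b < 4 * a" "a = 1" using less.prems by linarith
  then show ?case
  proof cases
    case 1
    let ?P = "{trap a (2 * a) x, trap (2 * a) b x}"
    show ?thesis
    proof (rule split[of _ _ ?P])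
      have "trap a (2 * a) x \<inter> trap (2 * a) b x = {}"
        using desc_disjoint_levels by (fastforce simp: trap_def)
      then show "disjoint ?P" by (auto simp: disjoint_def)
      have "{a..<b} = {a..<2 * a} \<union> {2 * a..<b}" using 1 less.prems by auto
      then show "\<Union>?P = trap a b x" by (auto simp: trap_def)
      have "splits m ?K ?R (trap a (2 * a) x)" using less.prems 1 by (intro less.hyps) auto
      moreover have "splits m ?K ?R (trap (2 * a) b x)" using less.prems 1 by (intro less.hyps) auto
      ultimately show "splits m ?K ?R Q'" if "Q' \<in> ?P" for Q' using that by blast
      fix Q' assume Q': "Q' \<in> ?P"
      have b: "real b \<le> 6 * real a" "4 * real a \<le> real b" using less.prems 1
        by (metis of_nat_le_iff of_nat_mult of_nat_numeral)+
      have "sum m Q' \<ge> real a * m x" using Q' less.prems mx 1 b by (auto simp: sum_trap)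
      moreover have "5 * (real a * m x) \<le> ?K * (real a * m x)"
        using C2 mx by (intro mult_right_mono) auto
      ultimately have "5 * (real a * m x) \<le> ?K * sum m Q'"
        using C2 by (smt (verit, ccfv_SIG) mult_left_mono)
      moreover have "sum m (trap a b x) \<le> 5 * (real a * m x)"
        using b mx less.prems by (simp add: sum_trap flip: mult.assoc)
      ultimately show "sum m (trap a b x) \<le> ?K * sum m Q'" by simp
    qed (use adm in auto)
  next
    case 2
    define a' b' where "a' = a - 1" "b' = b - 1"
    then have ab: "a = Suc a'" "b = Suc b'" using 2 less.prems by auto
    let ?P = "trap a' b' ` sons E \<gamma> x"
    show ?thesis
    proof (rule split[of _ _ ?P])
      show "disjoint ?P"
        unfolding disjoint_def using trap_disjoint[of _ x] by blast
      show "\<Union>?P = trap a b x" by (simp add: ab trap_Suc)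
      have "sons E \<gamma> x \<noteq> {}" using sum_sons[of x] mx by auto
      then show "?P \<noteq> {}" by simp
      show "splits m ?K ?R Q'" if "Q' \<in> ?P" for Q'
      proof -
        obtain y where "Q' = trap a' b' y" using \<open>Q' \<in> ?P\<close> by blast
        moreover have "splits m ?K ?R (trap a' b' y)"
          using less.prems 2 ab by (intro less.hyps) auto
        ultimately show ?thesis by simp
      qed
      fix Q' assume "Q' \<in> ?P"
      then obtain y where y: "Q' = trap a' b' y" "y \<in> sons E \<gamma> x" by blast
      have "m x \<le> ?K * m y"
        using son[OF y(2)] mult_right_mono[OF _ less_imp_le[OF m_pos], of C ?K y] C2 by linarith
      then have "(real b - real a) * m x \<le> (real b - real a) * (?K * m y)"
        using less.prems by (intro mult_left_mono) auto
      then show "sum m (trap a b x) \<le> ?K * sum m Q'"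
        using less.prems ab y by (simp add: sum_trap algebra_simps)
    qed (use adm finite_sons in auto)
  next
    case 3
    let ?P = "(\<lambda>z. {z}) ` trap a b x"
    show ?thesis
    proof (rule split[of _ _ ?P])
      show "trap a b x \<in> ?R" "finite ?P" using adm finite_trap by auto
      show "disjoint ?P" "\<Union>?P = trap a b x" by (auto simp: disjoint_def)
      have "sum m (trap a b x) > 0" using less.prems mx by (simp add: sum_trap)
      then show "?P \<noteq> {}" by auto
      show "splits m ?K ?R Q'" if "Q' \<in> ?P" for Q'
        using that by (auto simp: admissible_def intro!: single)
      fix Q' assume "Q' \<in> ?P"
      then obtain z where z: "Q' = {z}" "z \<in> trap a b x" by blast
      have "b = 2 \<or> b = 3" using 3 less.prems by auto
      then have "z \<in> desc 1 x \<or> z \<in> desc 2 x"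
        using z(2) 3 by (auto simp: trap_def eval_nat_numeral less_Suc_eq)
      then have "m x \<le> C\<^sup>2 * m z"
      proof
        assume "z \<in> desc 1 x"
        then have "m x \<le> C * m z" using son by simp
        then show ?thesis
          using mult_right_mono[OF C2(2) less_imp_le[OF m_pos], of z] by linarith
      next
        assume "z \<in> desc 2 x"
        then obtain y where "y \<in> sons E \<gamma> x" "z \<in> sons E \<gamma> y" by (auto simp: eval_nat_numeral)
        then have "m x \<le> C * m y" "m y \<le> C * m z" using son by auto
        then have "m x \<le> C * (C * m z)" using C(1) by (smt (verit) mult_left_mono)
        then show ?thesis by (simp add: power2_eq_square)
      qed
      moreover have "sum m (trap a b x) \<le> 2 * m x"
        using 3 less.prems mx \<open>b = 2 \<or> b = 3\<close> by (auto simp: sum_trap)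
      ultimately show "sum m (trap a b x) \<le> ?K * sum m Q'"
        using z m_pos[of x] by simp
    qed
  qed
qed

text \<open>A trapezoid hanging from a distant vertex of the ray swallows any given finite set. The
  constant \<open>K\<close> comes from doubling, uniformly in the set.\<close>

lemma splits_exhaust:
  assumes "\<beta> \<ge> 12"
  shows "\<exists>K\<ge>1. \<forall>S. finite S \<longrightarrow> (\<exists>Q. S \<subseteq> Q \<and> splits m K (admissible E \<gamma> \<beta>) Q)"
proof -
  obtain C where C: "C > 1" "\<And>x y. E y x \<Longrightarrow> m x \<le> C * m y" using edge_mass by blast
  have "\<exists>Q. S \<subseteq> Q \<and> splits m (5 * C\<^sup>2) (admissible E \<gamma> \<beta>) Q" if S: "finite S" for S
  proof -
    obtain i where i: "\<And>x N. N \<ge> i x \<Longrightarrow> level E \<gamma> x = int N - int (gdist E x (\<gamma> N))"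
      using level_eventually by metis
    \<comment> \<open>\<open>L\<close> bounds the levels on \<open>S\<close> and the indices beyond
      which the distances to the ray determine them. A point of \<open>S\<close> is then in a
      generation between \<open>N - L\<close> and \<open>N + L\<close> below
      \<open>\<gamma> N\<close>, and \<open>N + L < 2 * (N - L)\<close> because
      \<open>N > 3 * L\<close>.\<close>
    define L where "L = (\<Sum>x\<in>S. i x) + (\<Sum>x\<in>S. nat \<bar>level E \<gamma> x\<bar>)"
    define N where "N = 3 * L + 1"
    have "x \<in> trap (N - L) (2 * (N - L)) (\<gamma> N)" if "x \<in> S" for x
    proof -
      have "i x \<le> (\<Sum>x\<in>S. i x)" "nat \<bar>level E \<gamma> x\<bar> \<le> (\<Sum>x\<in>S. nat \<bar>level E \<gamma> x\<bar>)"
        using S that by (auto intro: member_le_sum)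
      then have L: "i x \<le> L" "nat \<bar>level E \<gamma> x\<bar> \<le> L" by (auto simp: L_def)
      have "N \<ge> i x" using L by (simp add: N_def)
      then have x: "level E \<gamma> x = int N - int (gdist E x (\<gamma> N))" by (rule i)
      obtain j where "\<forall>M\<ge>j. level E \<gamma> (\<gamma> N) = int M - int (gdist E (\<gamma> N) (\<gamma> M))"
        using level_eventually by blast
      then have "level E \<gamma> (\<gamma> N) = int N"
        using ray[unfolded geodesic_ray_def, rule_format, of N "max N j"]
        by (auto simp: dest!: spec[of _ "max N j"])
      then have "x \<in> desc (gdist E (\<gamma> N) x) (\<gamma> N)"
        using x by (simp add: desc_iff gdist_sym[OF tree])
      moreover have "gdist E (\<gamma> N) x \<in> {N - L..<2 * (N - L)}"
        using x L by (auto simp: N_def gdist_sym[OF tree, of x])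
      ultimately show ?thesis unfolding trap_def by blast
    qed
    moreover have "splits m (5 * C\<^sup>2) (admissible E \<gamma> \<beta>) (trap (N - L) (2 * (N - L)) (\<gamma> N))"
      by (rule splits_trap[OF C assms]) (auto simp: N_def)
    ultimately show ?thesis by blast
  qed
  moreover have "5 * C\<^sup>2 \<ge> 1" using one_le_power[of C 2] C(1) by linarith
  ultimately show ?thesis by blast
qed

text \<open>The generations below a single vertex all have the same mass. Sets of arbitrarily large
  mass serve to absorb integrals in \<open>Lp_approximation\<close>.\<close>

lemma infinite_mass: "\<exists>T. finite T \<and> B < sum m T"
proof -
  have "m (\<gamma> 0) > 0" by (rule m_pos)
  then obtain n :: nat where n: "B < real n * m (\<gamma> 0)" using reals_Archimedean3 by blast
  have "sum m (trap 0 n (\<gamma> 0)) = real n * m (\<gamma> 0)" by (simp add: sum_trap)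
  then show ?thesis using n finite_trap by metis
qed

end

section \<open>Interpolation\<close>

lemma closure_strip: "closure strip = {z. 0 \<le> Re z \<and> Re z \<le> 1}"
proof
  have "closed {z. 0 \<le> Re z \<and> Re z \<le> 1}"
    by (intro closed_Collect_conj closed_Collect_le continuous_intros)
  then show "closure strip \<subseteq> {z. 0 \<le> Re z \<and> Re z \<le> 1}"
    by (intro closure_minimal) (auto simp: strip_def)
next
  show "{z. 0 \<le> Re z \<and> Re z \<le> 1} \<subseteq> closure strip"
  proof
    fix z assume z: "z \<in> {z. 0 \<le> Re z \<and> Re z \<le> 1}"
    define t :: "nat \<Rightarrow> real" where "t n = inverse (real (Suc n))" for n
    have t: "0 < t n" "t n \<le> 1" for n by (auto simp: t_def field_simps)
    have "z + of_real (t n) * of_real (1 / 2 - Re z) \<in> strip" for n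
    proof -
      have "Re z + t n * (1 / 2 - Re z) = (1 - t n) * Re z + t n * (1 / 2)"
        by (simp add: algebra_simps)
      moreover have "0 \<le> (1 - t n) * Re z" "(1 - t n) * Re z \<le> 1 - t n"
        using z t[of n] by (auto intro: mult_left_le)
      ultimately show ?thesis using t[of n] by (simp add: strip_def)
    qed
    moreover have "t \<longlonglongrightarrow> 0" unfolding t_def by (rule LIMSEQ_inverse_real_of_nat)
    then have "(\<lambda>n. z + of_real (t n) * of_real (1 / 2 - Re z)) \<longlonglongrightarrow> z + of_real 0 * of_real (1 / 2 - Re z)"
      by (intro tendsto_intros)
    ultimately show "z \<in> closure strip" unfolding closure_sequential
      by (intro exI[of _ "\<lambda>n. z + of_real (t n) * of_real (1 / 2 - Re z)"]) simp
  qed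
qed

lemma open_strip: "open strip"
  unfolding strip_def by (intro open_Collect_conj open_Collect_less continuous_intros)

text \<open>With the same bound on both lines there is nothing to interpolate: this is the maximum
  principle on an unbounded domain. Damping by \<open>exp (\<epsilon> (w^2 - 1))\<close>, of modulus
  at most \<open>exp (- \<epsilon> (Im w)^2)\<close> on the strip, reduces it to a rectangle; the
  slack \<open>\<delta>\<close> takes care of the horizontal sides, and \<open>\<epsilon>\<close>
  tends to 0 at fixed \<open>z\<close>.\<close>

lemma three_lines:
  assumes cont: "continuous_on (closure strip) \<Phi>" and hol: "\<Phi> holomorphic_on strip"
    and bnd: "bounded (\<Phi> ` closure strip)"
    and left: "\<And>t. norm (\<Phi> (\<i> * of_real t)) \<le> K"
    and right: "\<And>t. norm (\<Phi> (1 + \<i> * of_real t)) \<le> K"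
    and z: "z \<in> closure strip"
  shows "norm (\<Phi> z) \<le> K"
proof (rule field_le_epsilon)
  fix \<delta> :: real assume "\<delta> > 0"
  obtain B where B: "\<And>w. w \<in> closure strip \<Longrightarrow> norm (\<Phi> w) \<le> B"
    using bnd unfolding bounded_iff by blast
  have "0 \<le> B" using B[OF z] norm_ge_zero order_trans by blast
  have "0 \<le> K" using left[of 0] norm_ge_zero order_trans by blast
  have damped: "norm (\<Phi> z) \<le> (K + \<delta>) * exp (\<epsilon> * (1 + (Im z)\<^sup>2))" if "\<epsilon> > 0" for \<epsilon>
  proof -
    define \<Psi> where "\<Psi> w = \<Phi> w * exp (of_real \<epsilon> * (w\<^sup>2 - 1))" for w
    have norm_exp: "norm (exp (of_real \<epsilon> * (w\<^sup>2 - 1))) = exp (\<epsilon> * ((Re w)\<^sup>2 - (Im w)\<^sup>2 - 1))" for w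
      by (simp add: power2_eq_square)
    have small: "norm (exp (of_real \<epsilon> * (w\<^sup>2 - 1))) \<le> exp (- (\<epsilon> * (Im w)\<^sup>2))"
      if "w \<in> closure strip" for w
    proof -
      have "(Re w)\<^sup>2 \<le> 1" using that by (simp add: closure_strip abs_square_le_1)
      then have "\<epsilon> * ((Re w)\<^sup>2 - (Im w)\<^sup>2 - 1) \<le> \<epsilon> * (- (Im w)\<^sup>2)"
        using \<open>\<epsilon> > 0\<close> by (intro mult_left_mono) auto
      then show ?thesis unfolding norm_exp exp_le_cancel_iff by simp
    qed
    have "((\<lambda>Y. B * exp (- (\<epsilon> * Y))) \<longlongrightarrow> B * 0) at_top"
    proof (intro tendsto_mult tendsto_const)
      have "filterlim (\<lambda>Y. \<epsilon> * Y) at_top at_top"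
        using \<open>\<epsilon> > 0\<close> by (intro filterlim_tendsto_pos_mult_at_top[OF tendsto_const] filterlim_ident)
      then have "filterlim (\<lambda>Y. - (\<epsilon> * Y)) at_bot at_top"
        by (simp add: filterlim_uminus_at_bot)
      then show "((\<lambda>Y. exp (- (\<epsilon> * Y))) \<longlongrightarrow> 0) at_top"
        using filterlim_compose[OF exp_at_bot] by blast
    qed
    then have "\<forall>\<^sub>F Y in at_top. B * exp (- (\<epsilon> * Y)) < \<delta>"
      using \<open>\<delta> > 0\<close> by (auto dest!: order_tendstoD(2))
    then obtain Y0 where Y0: "\<And>Y. Y \<ge> Y0 \<Longrightarrow> B * exp (- (\<epsilon> * Y)) < \<delta>"
      unfolding eventually_at_top_linorder by blast
    \<comment> \<open>High enough for the horizontal sides to lie below \<open>\<delta>\<close> and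
      for \<open>z\<close> to be in the rectangle; \<open>Y \<ge> 1\<close> allows the passage from
      \<open>Y\<close> to its square.\<close>
    define Y where "Y = max (max 1 Y0) \<bar>Im z\<bar>"
    have Y: "Y \<ge> 1" "Y \<ge> Y0" "Y \<ge> \<bar>Im z\<bar>" by (auto simp: Y_def)
    have "Y \<le> Y\<^sup>2" using Y(1) by (simp add: power2_eq_square)
    then have BY: "B * exp (- (\<epsilon> * Y\<^sup>2)) < \<delta>" using Y by (intro Y0) simp
    define S where "S = cbox (Complex 0 (- Y)) (Complex 1 Y)"
    have S: "w \<in> S \<longleftrightarrow> 0 \<le> Re w \<and> Re w \<le> 1 \<and> - Y \<le> Im w \<and> Im w \<le> Y" for w
      by (auto simp: S_def in_cbox_complex_iff)
    have Sint: "w \<in> interior S \<longleftrightarrow> 0 < Re w \<and> Re w < 1 \<and> - Y < Im w \<and> Im w < Y" for w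
      by (simp add: S_def interior_cbox in_box_complex_iff)
    have "norm (\<Psi> z) \<le> K + \<delta>"
    proof (rule maximum_modulus_frontier[of \<Psi> S])
      show "\<Psi> holomorphic_on interior S"
        unfolding \<Psi>_def
        by (intro holomorphic_intros holomorphic_on_subset[OF hol]) (auto simp: Sint strip_def)
      show "continuous_on (closure S) \<Psi>"
        unfolding \<Psi>_def
        by (intro continuous_intros continuous_on_subset[OF cont])
          (auto simp: closure_strip S_def in_cbox_complex_iff)
      show "bounded S" by (simp add: S_def)
      show "z \<in> S" using z Y by (auto simp: S closure_strip)
      fix w assume "w \<in> frontier S"
      then have w: "w \<in> S" "w \<notin> interior S"
        by (auto simp: frontier_def S_def closure_closed closed_cbox)
      then have wc: "w \<in> closure strip" by (simp add: S closure_strip)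
      consider "Re w = 0" | "Re w = 1" | "\<bar>Im w\<bar> = Y" using w by (force simp: S Sint)
      then show "norm (\<Psi> w) \<le> K + \<delta>"
      proof cases
        case 3
        have "norm (\<Psi> w) \<le> B * exp (- (\<epsilon> * (Im w)\<^sup>2))"
          unfolding \<Psi>_def norm_mult using B[OF wc] small[OF wc] \<open>0 \<le> B\<close> by (intro mult_mono) auto
        also have "(Im w)\<^sup>2 = Y\<^sup>2" using 3 by (metis power2_abs)
        finally show ?thesis using BY \<open>0 \<le> K\<close> by linarith
      next
        case 1
        then have "norm (\<Phi> w) \<le> K" using left[of "Im w"] by (metis add.left_neutral complex_eq of_real_0)
        then have "norm (\<Psi> w) \<le> K * 1"
          unfolding \<Psi>_def norm_mult using small[OF wc] \<open>0 \<le> K\<close> \<open>\<epsilon> > 0\<close>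
          by (intro mult_mono) (auto elim!: order_trans)
        then show ?thesis using \<open>\<delta> > 0\<close> by simp
      next
        case 2
        then have "norm (\<Phi> w) \<le> K" using right[of "Im w"] by (metis complex_eq of_real_1)
        then have "norm (\<Psi> w) \<le> K * 1"
          unfolding \<Psi>_def norm_mult using small[OF wc] \<open>0 \<le> K\<close> \<open>\<epsilon> > 0\<close>
          by (intro mult_mono) (auto elim!: order_trans)
        then show ?thesis using \<open>\<delta> > 0\<close> by simp
      qed
    qed
    then have "norm (\<Phi> z) * exp (\<epsilon> * ((Re z)\<^sup>2 - (Im z)\<^sup>2 - 1)) \<le> K + \<delta>"
      by (simp only: \<Psi>_def norm_mult norm_exp)
    then have "norm (\<Phi> z) \<le> (K + \<delta>) * exp (- (\<epsilon> * ((Re z)\<^sup>2 - (Im z)\<^sup>2 - 1)))"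
      by (simp only: exp_minus divide_inverse[symmetric] pos_le_divide_eq[OF exp_gt_zero])
    also have "\<dots> \<le> (K + \<delta>) * exp (\<epsilon> * (1 + (Im z)\<^sup>2))"
      using \<open>\<epsilon> > 0\<close> \<open>\<delta> > 0\<close> \<open>0 \<le> K\<close> by (intro mult_left_mono) (auto simp: algebra_simps)
    finally show ?thesis .
  qed
  have "((\<lambda>\<epsilon>. (K + \<delta>) * exp (\<epsilon> * (1 + (Im z)\<^sup>2))) \<longlongrightarrow> (K + \<delta>) * exp (0 * (1 + (Im z)\<^sup>2))) (at_right 0)"
    by (intro tendsto_intros)
  then have "((\<lambda>\<epsilon>. (K + \<delta>) * exp (\<epsilon> * (1 + (Im z)\<^sup>2))) \<longlongrightarrow> K + \<delta>) (at_right 0)"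
    by simp
  then show "norm (\<Phi> z) \<le> K + \<delta>"
    by (rule tendsto_lowerbound) (auto simp: eventually_at_right_less damped
        intro: eventually_mono[OF eventually_at_right_less])
qed

text \<open>Saves the distinction between \<open>l\<close> below and above 1 when a power is bounded
  uniformly on the strip.\<close>

lemma powr_le_sum:
  fixes l :: real
  assumes "0 < l" "a \<le> x" "x \<le> b"
  shows "l powr x \<le> l powr a + l powr b"
proof (cases "l \<le> 1")
  case True
  then have "l powr x \<le> l powr a" using assms by (simp add: powr_mono')
  then show ?thesis by (simp add: add_increasing2)
next
  case False
  then have "l powr x \<le> l powr b" using assms by (simp add: powr_mono)
  then show ?thesis by (simp add: add_increasing)
qed

lemma norm_of_real_powr: "0 \<le> l \<Longrightarrow> norm (complex_of_real l powr w) = l powr Re w"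
  by (simp add: norm_powr_real_powr)

text \<open>In an \<open>nspace\<close> the norm is an arbitrary real function. Nonnegativity on the
  carrier is what bounds the infima in the sum, quotient and interpolation norms from below.\<close>

definition nonneg_norm :: "'a nspace \<Rightarrow> bool" where
  "nonneg_norm X \<longleftrightarrow> (\<forall>f\<in>carr X. 0 \<le> nnorm X f)"

lemma nonneg_normD: "nonneg_norm X \<Longrightarrow> f \<in> carr X \<Longrightarrow> 0 \<le> nnorm X f"
  by (simp add: nonneg_norm_def)

lemma carr_sum_space: "f \<in> carr (sum_space A0 A1) \<longleftrightarrow> (\<exists>a\<in>carr A0. \<exists>b\<in>carr A1. f = a + b)"
  by (auto simp: sum_space_def)

lemma sum_space_norm_le:
  assumes "nonneg_norm A0" "nonneg_norm A1" "a \<in> carr A0" "b \<in> carr A1"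
  shows "nnorm (sum_space A0 A1) (a + b) \<le> nnorm A0 a + nnorm A1 b"
  unfolding sum_space_def nspace.sel
proof (rule cInf_lower)
  show "nnorm A0 a + nnorm A1 b \<in> {nnorm A0 a' + nnorm A1 b' |a' b'.
      a' \<in> carr A0 \<and> b' \<in> carr A1 \<and> a + b = a' + b'}"
    using assms by blast
  show "bdd_below {nnorm A0 a' + nnorm A1 b' |a' b'.
      a' \<in> carr A0 \<and> b' \<in> carr A1 \<and> a + b = a' + b'}"
    using assms by (intro bdd_belowI[of _ 0]) (auto simp: nonneg_norm_def)
qed

lemma sum_space_norm_ge:
  assumes "f \<in> carr (sum_space A0 A1)" "0 < C"
    and "\<And>a b. a \<in> carr A0 \<Longrightarrow> b \<in> carr A1 \<Longrightarrow> f = a + b \<Longrightarrow> K \<le> C * (nnorm A0 a + nnorm A1 b)"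
  shows "K \<le> C * nnorm (sum_space A0 A1) f"
proof -
  have "K / C \<le> nnorm (sum_space A0 A1) f"
    unfolding sum_space_def nspace.sel
  proof (rule cInf_greatest)
    show "{nnorm A0 a + nnorm A1 b |a b. a \<in> carr A0 \<and> b \<in> carr A1 \<and> f = a + b} \<noteq> {}"
      using assms(1) by (auto simp: carr_sum_space)
  qed (use assms(2,3) in \<open>auto simp: field_simps\<close>)
  then show ?thesis using \<open>0 < C\<close> by (simp add: field_simps)
qed

lemma nonneg_norm_sum_space:
  assumes "nonneg_norm A0" "nonneg_norm A1"
  shows "nonneg_norm (sum_space A0 A1)"
  unfolding nonneg_norm_def
  using sum_space_norm_ge[of _ A0 A1 1 0] assms by (auto simp: nonneg_norm_def)

lemma dual_bound:
  assumes "l \<in> dual (sum_space A0 A1)" "nonneg_norm A0" "nonneg_norm A1"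
  obtains C where "0 < C"
    "\<And>a b. a \<in> carr A0 \<Longrightarrow> b \<in> carr A1 \<Longrightarrow> norm (l (a + b)) \<le> C * (nnorm A0 a + nnorm A1 b)"
proof -
  obtain C where C: "\<And>f. f \<in> carr (sum_space A0 A1) \<Longrightarrow> norm (l f) \<le> C * nnorm (sum_space A0 A1) f"
    using assms(1) unfolding dual_def by blast
  \<comment> \<open>The constant in \<open>dual\<close> may be any real number;
    \<open>\<bar>C\<bar> + 1\<close> is a positive substitute.\<close>
  have "norm (l (a + b)) \<le> (\<bar>C\<bar> + 1) * (nnorm A0 a + nnorm A1 b)"
    if "a \<in> carr A0" "b \<in> carr A1" for a b
  proof -
    have f: "a + b \<in> carr (sum_space A0 A1)" using that by (auto simp: carr_sum_space)
    have "norm (l (a + b)) \<le> C * nnorm (sum_space A0 A1) (a + b)" by (rule C[OF f])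
    also have "\<dots> \<le> (\<bar>C\<bar> + 1) * (nnorm A0 a + nnorm A1 b)"
      using nonneg_normD[OF nonneg_norm_sum_space f] sum_space_norm_le[of A0 A1 a b] assms that
      by (intro mult_mono) auto
    finally show ?thesis .
  qed
  then show ?thesis by (intro that[of "\<bar>C\<bar> + 1"]) auto
qed

lemma dual_sum_spaceI:
  assumes "\<And>f g. l (f + g) = l f + l g" "\<And>c f. l (c *\<^sub>C f) = c * l f" "0 < C"
    and "\<And>a. a \<in> carr A0 \<Longrightarrow> norm (l a) \<le> C * nnorm A0 a"
    and "\<And>b. b \<in> carr A1 \<Longrightarrow> norm (l b) \<le> C * nnorm A1 b"
  shows "l \<in> dual (sum_space A0 A1)"
proof -
  have "norm (l f) \<le> C * nnorm (sum_space A0 A1) f" if "f \<in> carr (sum_space A0 A1)" for f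
  proof (rule sum_space_norm_ge[OF that \<open>0 < C\<close>])
    fix a b assume "a \<in> carr A0" "b \<in> carr A1" "f = a + b"
    then show "norm (l f) \<le> C * (nnorm A0 a + nnorm A1 b)"
      using norm_triangle_ineq[of "l a" "l b"] assms(4)[of a] assms(5)[of b]
      by (simp add: assms(1) distrib_left)
  qed
  then show ?thesis using assms(1,2) unfolding dual_def by blast
qed

lemma calderon_norm_le:
  assumes "\<And>t. nnorm A0 (F (\<i> * of_real t)) \<le> K" "\<And>t. nnorm A1 (F (1 + \<i> * of_real t)) \<le> K"
  shows "calderon_norm A0 A1 F \<le> K"
  unfolding calderon_norm_def using assms by (intro cSUP_least) auto

lemma calderon_norm_ge:
  assumes "F \<in> calderon_class A0 A1"
  shows "nnorm A0 (F (\<i> * of_real t)) \<le> calderon_norm A0 A1 F"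
    and "nnorm A1 (F (1 + \<i> * of_real t)) \<le> calderon_norm A0 A1 F"
proof -
  have "bdd_above (range (\<lambda>t. max (nnorm A0 (F (\<i> * of_real t))) (nnorm A1 (F (1 + \<i> * of_real t)))))"
  proof -
    obtain K L where "\<And>t. nnorm A0 (F (\<i> * of_real t)) \<le> K" "\<And>t. nnorm A1 (F (1 + \<i> * of_real t)) \<le> L"
      using assms unfolding calderon_class_def bdd_above_def by blast
    then show ?thesis by (intro bdd_aboveI[of _ "max K L"]) (auto intro: max.mono)
  qed
  then have "max (nnorm A0 (F (\<i> * of_real t))) (nnorm A1 (F (1 + \<i> * of_real t)))
      \<le> calderon_norm A0 A1 F"
    unfolding calderon_norm_def by (intro cSUP_upper) auto
  then show "nnorm A0 (F (\<i> * of_real t)) \<le> calderon_norm A0 A1 F"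
    and "nnorm A1 (F (1 + \<i> * of_real t)) \<le> calderon_norm A0 A1 F" by auto
qed

lemma calderon_norm_nonneg:
  assumes "F \<in> calderon_class A0 A1" "nonneg_norm A0"
  shows "0 \<le> calderon_norm A0 A1 F"
proof -
  have "F (\<i> * of_real 0) \<in> carr A0" using assms(1) unfolding calderon_class_def by blast
  then show ?thesis using calderon_norm_ge(1)[OF assms(1), of 0] nonneg_normD[OF assms(2)] by force
qed

lemma interpolation_norm_le:
  assumes "F \<in> calderon_class A0 A1" "nonneg_norm A0" "f = F (of_real \<theta>)"
  shows "f \<in> carr (complex_interpolation A0 A1 \<theta>)"
    and "nnorm (complex_interpolation A0 A1 \<theta>) f \<le> calderon_norm A0 A1 F"
proof -
  show "f \<in> carr (complex_interpolation A0 A1 \<theta>)"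
    using assms by (auto simp: complex_interpolation_def)
  show "nnorm (complex_interpolation A0 A1 \<theta>) f \<le> calderon_norm A0 A1 F"
    unfolding complex_interpolation_def nspace.sel
  proof (rule cInf_lower)
    show "bdd_below {calderon_norm A0 A1 F |F. F \<in> calderon_class A0 A1 \<and> F (of_real \<theta>) = f}"
      using calderon_norm_nonneg assms(2) by (intro bdd_belowI[of _ 0]) auto
  qed (use assms in auto)
qed

lemma interpolation_norm_ge:
  assumes "f \<in> carr (complex_interpolation A0 A1 \<theta>)" "0 < C"
    and "\<And>F. F \<in> calderon_class A0 A1 \<Longrightarrow> F (of_real \<theta>) = f \<Longrightarrow> K \<le> C * calderon_norm A0 A1 F"
  shows "K \<le> C * nnorm (complex_interpolation A0 A1 \<theta>) f"
proof -
  have "K / C \<le> nnorm (complex_interpolation A0 A1 \<theta>) f"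
    unfolding complex_interpolation_def nspace.sel
    by (rule cInf_greatest) (use assms in \<open>auto simp: complex_interpolation_def field_simps\<close>)
  then show ?thesis using \<open>0 < C\<close> by (simp add: field_simps)
qed

section \<open>Bounded maps between couples and pairing with analytic weights\<close>

definition bounded_map :: "real \<Rightarrow> 'a nspace \<Rightarrow> 'b nspace \<Rightarrow> ('a \<Rightarrow> 'b) \<Rightarrow> bool" where
  "bounded_map C X Y T \<longleftrightarrow> (\<forall>f\<in>carr X. T f \<in> carr Y \<and> nnorm Y (T f) \<le> C * nnorm X f)"

lemma bounded_mapD:
  assumes "bounded_map C X Y T" "f \<in> carr X"
  shows "T f \<in> carr Y" "nnorm Y (T f) \<le> C * nnorm X f"
  using assms by (auto simp: bounded_map_def)

text \<open>\<open>T \<circ> F\<close> inherits the weak conditions because functionals of the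
  target sum pull back to functionals of the source sum. The ambient spaces may differ, as in the
  passage to functions modulo constants.\<close>

lemma interpolation_map:
  fixes T :: "'a::complex_vector \<Rightarrow> 'b::complex_vector"
  assumes add: "\<And>f g. T (f + g) = T f + T g" and scale: "\<And>c f. T (c *\<^sub>C f) = c *\<^sub>C T f"
    and T0: "bounded_map C A0 B0 T" and T1: "bounded_map C A1 B1 T" and "0 < C"
    and nn: "nonneg_norm A0" "nonneg_norm A1" "nonneg_norm B0" "nonneg_norm B1"
  shows "bounded_map C (complex_interpolation A0 A1 \<theta>) (complex_interpolation B0 B1 \<theta>) T"
proof -
  have TF: "T \<circ> F \<in> calderon_class B0 B1" "calderon_norm B0 B1 (T \<circ> F) \<le> C * calderon_norm A0 A1 F"
    if F: "F \<in> calderon_class A0 A1" for F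
  proof -
    have it: "F (\<i> * of_real t) \<in> carr A0" "F (1 + \<i> * of_real t) \<in> carr A1" for t
      using F unfolding calderon_class_def by blast+
    have bd: "nnorm B0 (T (F (\<i> * of_real t))) \<le> C * calderon_norm A0 A1 F"
      "nnorm B1 (T (F (1 + \<i> * of_real t))) \<le> C * calderon_norm A0 A1 F" for t
      using bounded_mapD(2)[OF T0 it(1)] bounded_mapD(2)[OF T1 it(2)]
        mult_left_mono[OF calderon_norm_ge(1)[OF F] less_imp_le[OF \<open>0 < C\<close>]]
        mult_left_mono[OF calderon_norm_ge(2)[OF F] less_imp_le[OF \<open>0 < C\<close>]]
      by (meson order_trans)+
    show "calderon_norm B0 B1 (T \<circ> F) \<le> C * calderon_norm A0 A1 F"
      using bd by (intro calderon_norm_le) auto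
    have dual: "l \<circ> T \<in> dual (sum_space A0 A1)" if l: "l \<in> dual (sum_space B0 B1)" for l
    proof -
      have lT: "T f \<in> carr (sum_space B0 B1)" if "f \<in> carr (sum_space A0 A1)" for f
        using that bounded_mapD(1)[OF T0] bounded_mapD(1)[OF T1] add
        by (fastforce simp: carr_sum_space)
      obtain D where D: "0 < D" "\<And>a b. a \<in> carr B0 \<Longrightarrow> b \<in> carr B1 \<Longrightarrow>
          norm (l (a + b)) \<le> D * (nnorm B0 a + nnorm B1 b)"
        using dual_bound[OF l nn(3,4)] by blast
      have "norm ((l \<circ> T) f) \<le> (D * C) * nnorm (sum_space A0 A1) f"
        if f: "f \<in> carr (sum_space A0 A1)" for f
      proof (rule sum_space_norm_ge[OF f])
        fix a b assume ab: "a \<in> carr A0" "b \<in> carr A1" "f = a + b"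
        have "norm (l (T a + T b)) \<le> D * (nnorm B0 (T a) + nnorm B1 (T b))"
          using bounded_mapD[OF T0 ab(1)] bounded_mapD[OF T1 ab(2)] by (intro D(2)) auto
        also have "\<dots> \<le> D * (C * nnorm A0 a + C * nnorm A1 b)"
          using bounded_mapD[OF T0 ab(1)] bounded_mapD[OF T1 ab(2)] D(1)
          by (intro mult_left_mono add_mono) auto
        finally show "norm ((l \<circ> T) f) \<le> (D * C) * (nnorm A0 a + nnorm A1 b)"
          by (simp add: ab(3) add algebra_simps)
      qed (use D \<open>0 < C\<close> in simp)
      moreover have "(l \<circ> T) (f + g) = (l \<circ> T) f + (l \<circ> T) g"
        if "f \<in> carr (sum_space A0 A1)" "g \<in> carr (sum_space A0 A1)" for f g
        using l lT[OF that(1)] lT[OF that(2)] by (simp add: dual_def add)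
      moreover have "(l \<circ> T) (c *\<^sub>C f) = c * (l \<circ> T) f" if "f \<in> carr (sum_space A0 A1)" for c f
        using l lT[OF that] by (simp add: dual_def scale)
      ultimately show ?thesis unfolding dual_def by blast
    qed
    have "(T \<circ> F) z \<in> carr (sum_space B0 B1)" if "z \<in> closure strip" for z
    proof -
      have "F z \<in> carr (sum_space A0 A1)" using F that unfolding calderon_class_def by blast
      then show ?thesis using bounded_mapD(1)[OF T0] bounded_mapD(1)[OF T1]
        by (fastforce simp: carr_sum_space add)
    qed
    moreover have "continuous_on (closure strip) (\<lambda>z. l ((T \<circ> F) z)) \<and>
        bounded ((\<lambda>z. l ((T \<circ> F) z)) ` closure strip) \<and> (\<lambda>z. l ((T \<circ> F) z)) analytic_on strip"
      if "l \<in> dual (sum_space B0 B1)" for l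
      using F dual[OF that] unfolding calderon_class_def by fastforce
    moreover have "bdd_above (range (\<lambda>t. nnorm B0 ((T \<circ> F) (\<i> * of_real t))))"
      "bdd_above (range (\<lambda>t. nnorm B1 ((T \<circ> F) (1 + \<i> * of_real t))))"
      using bd by (auto intro!: bdd_aboveI[of _ "C * calderon_norm A0 A1 F"])
    ultimately show "T \<circ> F \<in> calderon_class B0 B1"
      using bounded_mapD(1)[OF T0 it(1)] bounded_mapD(1)[OF T1 it(2)]
      unfolding calderon_class_def by simp
  qed
  show ?thesis
    unfolding bounded_map_def
  proof (intro ballI conjI)
    fix f assume f: "f \<in> carr (complex_interpolation A0 A1 \<theta>)"
    then obtain F where F: "F \<in> calderon_class A0 A1" "f = F (of_real \<theta>)"
      by (auto simp: complex_interpolation_def)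
    show "T f \<in> carr (complex_interpolation B0 B1 \<theta>)"
      using interpolation_norm_le(1)[OF TF(1)[OF F(1)] nn(3)] F(2) by simp
    show "nnorm (complex_interpolation B0 B1 \<theta>) (T f) \<le> C * nnorm (complex_interpolation A0 A1 \<theta>) f"
    proof (rule interpolation_norm_ge[OF f \<open>0 < C\<close>])
      fix G assume G: "G \<in> calderon_class A0 A1" "G (of_real \<theta>) = f"
      have "nnorm (complex_interpolation B0 B1 \<theta>) (T f) \<le> calderon_norm B0 B1 (T \<circ> G)"
        by (rule interpolation_norm_le(2)[OF TF(1)[OF G(1)] nn(3)]) (simp add: G)
      also have "\<dots> \<le> C * calderon_norm A0 A1 G" by (rule TF(2)[OF G(1)])
      finally show "nnorm (complex_interpolation B0 B1 \<theta>) (T f) \<le> C * calderon_norm A0 A1 G" .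
    qed
  qed
qed

text \<open>\<open>F\<close> is paired with a dual analytic family: the weight
  \<open>\<mu> i powr (z / \<theta> - 1)\<close> equals 1 at \<open>\<theta>\<close> and has modulus
  \<open>1 / \<mu> i\<close> on the left line and \<open>\<mu> i powr (1 / \<theta> - 1)\<close> on
  the right one. The functionals \<open>l i\<close> will be pairings with multiples of atoms in one
  application and point evaluations in the other; there \<open>1 / \<theta>\<close> is the exponent
  dual to \<open>q\<close>.\<close>

lemma calderon_pairing:
  assumes F: "F \<in> calderon_class A0 A1"
    and I: "finite I" "\<And>i. i \<in> I \<Longrightarrow> l i \<in> dual (sum_space A0 A1)" "\<And>i. i \<in> I \<Longrightarrow> 0 < \<mu> i"
    and \<theta>: "0 < \<theta>" "\<theta> < 1"
    and left: "\<And>t. norm (\<Sum>i\<in>I. complex_of_real (\<mu> i) powr (\<i> * of_real t / of_real \<theta> - 1)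
        * l i (F (\<i> * of_real t))) \<le> K"
    and right: "\<And>t. norm (\<Sum>i\<in>I. complex_of_real (\<mu> i) powr ((1 + \<i> * of_real t) / of_real \<theta> - 1)
        * l i (F (1 + \<i> * of_real t))) \<le> K"
  shows "norm (\<Sum>i\<in>I. l i (F (of_real \<theta>))) \<le> K"
proof -
  define \<Phi> where "\<Phi> z = (\<Sum>i\<in>I. complex_of_real (\<mu> i) powr (z / of_real \<theta> - 1) * l i (F z))" for z
  have l: "continuous_on (closure strip) (\<lambda>z. l i (F z))" "bounded ((\<lambda>z. l i (F z)) ` closure strip)"
    "(\<lambda>z. l i (F z)) holomorphic_on strip" if "i \<in> I" for i
    using F I(2)[OF that] unfolding calderon_class_def
    by (auto intro: analytic_imp_holomorphic)
  have nz: "complex_of_real (\<mu> i) \<notin> \<real>\<^sub>\<le>\<^sub>0" "\<mu> i \<noteq> 0" if "i \<in> I" for i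
    using I(3)[OF that] by (auto simp: complex_nonpos_Reals_iff)
  have "norm (\<Phi> (of_real \<theta>)) \<le> K"
  proof (rule three_lines[of \<Phi>])
    show "continuous_on (closure strip) \<Phi>"
      unfolding \<Phi>_def using l(1) less_imp_le[OF I(3)] nz \<theta> by (intro continuous_intros) auto
    show "\<Phi> holomorphic_on strip"
      unfolding \<Phi>_def using l(3) less_imp_le[OF I(3)] nz \<theta> by (intro holomorphic_intros) auto
    show "bounded (\<Phi> ` closure strip)"
    proof -
      obtain B where B: "\<And>i z. i \<in> I \<Longrightarrow> z \<in> closure strip \<Longrightarrow> norm (l i (F z)) \<le> B i"
        using l(2) unfolding bounded_iff by (metis imageI)
      have "norm (\<Phi> z) \<le> (\<Sum>i\<in>I. (\<mu> i powr (- 1) + \<mu> i powr (1 / \<theta> - 1)) * B i)"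
        if z: "z \<in> closure strip" for z
        unfolding \<Phi>_def
      proof (rule order_trans[OF norm_sum sum_mono])
        fix i assume i: "i \<in> I"
        have "Re (z / of_real \<theta> - 1) = Re z / \<theta> - 1" by simp
        moreover have "0 \<le> Re z / \<theta>" "Re z / \<theta> \<le> 1 / \<theta>"
          using z \<theta> by (auto simp: closure_strip divide_right_mono)
        ultimately have "\<mu> i powr Re (z / of_real \<theta> - 1) \<le> \<mu> i powr (- 1) + \<mu> i powr (1 / \<theta> - 1)"
          using I(3)[OF i] by (intro powr_le_sum) auto
        then show "norm (complex_of_real (\<mu> i) powr (z / of_real \<theta> - 1) * l i (F z))
            \<le> (\<mu> i powr (- 1) + \<mu> i powr (1 / \<theta> - 1)) * B i"
          unfolding norm_mult using I(3)[OF i] B[OF i z]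
          by (intro mult_mono) (auto simp: norm_of_real_powr)
      qed
      then show ?thesis unfolding bounded_iff by auto
    qed
    show "norm (\<Phi> (\<i> * of_real t)) \<le> K" "norm (\<Phi> (1 + \<i> * of_real t)) \<le> K" for t
      unfolding \<Phi>_def by (rule left, rule right)
    show "complex_of_real \<theta> \<in> closure strip" using \<theta> by (simp add: closure_strip)
  qed
  moreover have "\<Phi> (of_real \<theta>) = (\<Sum>i\<in>I. l i (F (of_real \<theta>)))"
    unfolding \<Phi>_def using \<theta> nz by (intro sum.cong) auto
  ultimately show ?thesis by simp
qed

section \<open>Calderon--Zygmund decomposition\<close>

lemma sum_list_concat_map:
  "(\<Sum>z\<leftarrow>concat (map g ss). h z) = (\<Sum>s\<leftarrow>ss. \<Sum>z\<leftarrow>g s. h z)"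
  by (induction ss) auto

text \<open>The induction step of the bound for \<open>\<Sum> l\<^sup>q m(R)\<close> below: either the part \<open>a\<close> of the
  mass \<open>a + b = l N\<close> that is not in the stopping sets is substantial, or the averages over these
  sets, being twice as large as \<open>l\<close>, give a gain of \<open>2\<^sup>q\<^sup>-\<^sup>1\<close>.\<close>

definition stopping_constants :: "real \<Rightarrow> real \<Rightarrow> real \<Rightarrow> bool" where
  "stopping_constants q A B \<longleftrightarrow> (\<forall>l N a b X Y. 0 < l \<longrightarrow> 0 < N \<longrightarrow> a + b = l * N \<longrightarrow> 0 \<le> X \<longrightarrow> 0 \<le> Y \<longrightarrow>
      (\<forall>s>0. s powr (q - 1) * (a - s * N) \<le> X) \<longrightarrow> (2 * l) powr (q - 1) * b \<le> Y \<longrightarrow>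
      (1 + B) * (l powr q * N) \<le> A * X + B * Y)"

lemma stopping_constants:
  fixes q :: real
  assumes "1 < q"
  obtains A B :: real where "0 < A" "0 < B" "stopping_constants q A B"
proof -
  define k where "k = (2::real) powr (q - 1)"
  have k: "k > 1" using assms by (simp add: k_def)
  \<comment> \<open>\<open>k > 1\<close> is the gain from doubled averages. With this
    \<open>e\<close> the factor \<open>k * (1 - e) = (k + 1) / 2\<close> still exceeds 1, and
    \<open>B\<close> solves \<open>B * k * (1 - e) = 1 + B\<close>; \<open>A\<close> is fitted to
    the other alternative.\<close>
  define e where "e = (k - 1) / (2 * k)"
  define B where "B = 2 / (k - 1)"
  define A where "A = (1 + B) / (e / 2) powr q"
  have e: "0 < e" "e < 1" using k by (auto simp: e_def field_simps)
  have B: "0 < B" "B * k * (1 - e) = 1 + B" using k by (auto simp: B_def e_def field_simps)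
  have A: "0 < A" "A * (e / 2) powr q = 1 + B" using B e by (auto simp: A_def)
  have "(1 + B) * (l powr q * N) \<le> A * X + B * Y"
    if l: "0 < l" and N: "0 < N" and ab: "a + b = l * N" and X: "0 \<le> X" and Y: "0 \<le> Y"
      and s: "\<And>s. 0 < s \<Longrightarrow> s powr (q - 1) * (a - s * N) \<le> X" and b: "(2 * l) powr (q - 1) * b \<le> Y"
    for l N a b X Y
  proof (cases "a \<ge> e * (l * N)")
    case True
    \<comment> \<open>Half of the threshold: \<open>a \<ge> e * (l * N) = 2 * t * N\<close>, so
      \<open>a - t * N\<close> is still at least \<open>t * N\<close>.\<close>
    define t where "t = e / 2 * l"
    have t: "0 < t" using e l by (simp add: t_def)
    have "t powr (q - 1) * t = t powr q" using t by (simp add: powr_diff)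
    also have "t powr q = (e / 2) powr q * l powr q"
      unfolding t_def by (rule powr_mult)
    finally have "(e / 2) powr q * (l powr q * N) = t powr (q - 1) * (t * N)"
      by (metis mult.assoc)
    also have "t * N \<le> a - t * N" using True by (simp add: t_def algebra_simps)
    then have "t powr (q - 1) * (t * N) \<le> t powr (q - 1) * (a - t * N)" by (intro mult_left_mono) auto
    also have "\<dots> \<le> X" using s t by blast
    finally have "A * ((e / 2) powr q * (l powr q * N)) \<le> A * X" using A(1) by simp
    then have "(1 + B) * (l powr q * N) \<le> A * X" using A(2) by (simp add: mult.assoc[symmetric])
    then show ?thesis using B(1) Y by (smt (verit) mult_nonneg_nonneg)
  next
    case False
    then have "(1 - e) * (l * N) \<le> b" using ab by (simp add: algebra_simps)
    then have "(2 * l) powr (q - 1) * ((1 - e) * (l * N)) \<le> (2 * l) powr (q - 1) * b"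
      by (intro mult_left_mono) auto
    also have "\<dots> \<le> Y" by (rule b)
    also have "(2 * l) powr (q - 1) * ((1 - e) * (l * N)) = k * (1 - e) * (l powr q * N)"
    proof -
      have "l powr (q - 1) * l = l powr q" using l by (simp add: powr_diff)
      then show ?thesis using l by (simp add: powr_mult k_def)
    qed
    finally have "B * (k * (1 - e) * (l powr q * N)) \<le> B * Y" using B(1) by simp
    then have "(1 + B) * (l powr q * N) \<le> B * Y" using B(2) by (simp add: mult.assoc[symmetric])
    then show ?thesis using A(1) X by (smt (verit) mult_nonneg_nonneg)
  qed
  then have "stopping_constants q A B" unfolding stopping_constants_def by blast
  then show ?thesis using that A(1) B(1) by blast
qed

text \<open>\<open>\<delta>\<close> stands for a bound on the L^q norm of \<open>f\<close>.
  \<open>C\<close> controls both endpoints: the sum of the \<open>\<bar>v i\<bar>\<close> is the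
  bound in L^infinity, and the sum of the \<open>l i powr q * sum m (R i)\<close> is the one in H^1,
  since \<open>v i\<close> divided by \<open>C * sum m (R i)\<close> is an atom.\<close>

definition atomic_sum :: "('v \<Rightarrow> real) \<Rightarrow> 'v set set \<Rightarrow> real \<Rightarrow> real \<Rightarrow> real \<Rightarrow> ('v \<Rightarrow> complex) \<Rightarrow>
    nat \<Rightarrow> (nat \<Rightarrow> real) \<Rightarrow> (nat \<Rightarrow> 'v set) \<Rightarrow> (nat \<Rightarrow> 'v \<Rightarrow> complex) \<Rightarrow> bool" where
  "atomic_sum m \<R> q C \<delta> f n l R v \<longleftrightarrow>
    (\<forall>i<n. 0 < l i \<and> R i \<in> \<R> \<and> (\<forall>x. x \<notin> R i \<longrightarrow> v i x = 0) \<and> (\<Sum>x\<in>R i. m x *\<^sub>R v i x) = 0) \<and>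
    (\<forall>x. f x = of_real \<delta> * (\<Sum>i<n. of_real (l i) * v i x)) \<and>
    (\<forall>x. (\<Sum>i<n. norm (v i x)) \<le> C) \<and> (\<Sum>i<n. l i powr q * sum m (R i)) \<le> C"

definition mean_norm :: "('v \<Rightarrow> real) \<Rightarrow> ('v \<Rightarrow> complex) \<Rightarrow> 'v set \<Rightarrow> real" where
  "mean_norm m f Q = (\<Sum>x\<in>Q. m x * norm (f x)) / sum m Q"

section \<open>Stopping sets and the decomposition over a split set\<close>

locale weight =
  fixes m :: "'v \<Rightarrow> real"
  assumes mass_pos: "0 < m x"
begin

lemma mass_nonneg [simp]: "0 \<le> m x"
  using mass_pos less_imp_le by blast

end

locale splitting = weight m for m :: "'v \<Rightarrow> real" +
  fixes K :: real and \<R> :: "'v set set"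
  assumes K: "1 \<le> K"
begin

lemma splits_finite: "splits m K \<R> Q \<Longrightarrow> finite Q \<and> Q \<noteq> {} \<and> Q \<in> \<R>"
  by (induction rule: splits.induct) auto

lemma splits_mass: "splits m K \<R> Q \<Longrightarrow> 0 < sum m Q"
  using splits_finite mass_pos by (intro sum_pos) auto

lemma mean_norm_nonneg: "0 \<le> mean_norm m f Q"
  unfolding mean_norm_def using mass_pos by (intro divide_nonneg_nonneg sum_nonneg) auto

lemma mean_norm_mult: "splits m K \<R> Q \<Longrightarrow> mean_norm m f Q * sum m Q = (\<Sum>x\<in>Q. m x * norm (f x))"
  using splits_mass[of Q] by (simp add: mean_norm_def)

text \<open>Descend through the splitting and stop at the first piece whose mean exceeds
  \<open>l\<close>. The mean over its parent is at most \<open>l\<close>, so comparability of masses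
  bounds the new mean by \<open>K * l\<close>. Points that escape all stopping sets end as single
  vertices of mean at most \<open>l\<close>; this takes the place of Lebesgue
  differentiation.\<close>

lemma splits_stopping:
  assumes "splits m K \<R> Q" "mean_norm m f Q \<le> l"
  shows "\<exists>S. finite S \<and> disjoint S \<and> (\<forall>Q'\<in>S. splits m K \<R> Q' \<and> Q' \<subseteq> Q \<and>
    l < mean_norm m f Q' \<and> mean_norm m f Q' \<le> K * l) \<and> (\<forall>x\<in>Q - \<Union>S. norm (f x) \<le> l)"
  using assms
proof (induction rule: splits.induct)
  case (single x)
  then have "norm (f x) \<le> l" using mass_pos[of x] by (simp add: mean_norm_def)
  then show ?case by (intro exI[of _ "{}"]) auto
next
  case (split Q P)
  have Q: "splits m K \<R> Q" using split.hyps by (intro splits.split[of Q \<R> P]) auto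
  have "\<exists>S. finite S \<and> disjoint S \<and> (\<forall>Q''\<in>S. splits m K \<R> Q'' \<and> Q'' \<subseteq> Q' \<and>
    l < mean_norm m f Q'' \<and> mean_norm m f Q'' \<le> K * l) \<and> (\<forall>x\<in>Q' - \<Union>S. norm (f x) \<le> l)"
    if Q': "Q' \<in> P" for Q'
  proof (cases "mean_norm m f Q' \<le> l")
    case True
    then show ?thesis using split.IH[OF Q'] by blast
  next
    case False
    have s: "splits m K \<R> Q'" using split.hyps(6) Q' by blast
    have "mean_norm m f Q' * sum m Q' \<le> mean_norm m f Q * sum m Q"
      unfolding mean_norm_mult[OF s] mean_norm_mult[OF Q]
      using splits_finite[OF Q] Q' split.hyps by (intro sum_mono2) auto
    also have "\<dots> \<le> l * (K * sum m Q')"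
      using split.prems split.hyps(7)[OF Q'] mean_norm_nonneg[of f Q] splits_mass[OF Q]
      by (intro mult_mono) auto
    finally have "mean_norm m f Q' \<le> K * l" using splits_mass[OF s] by (simp add: mult.commute)
    then show ?thesis using False s by (intro exI[of _ "{Q'}"]) auto
  qed
  then obtain s where s: "\<And>Q'. Q' \<in> P \<Longrightarrow> finite (s Q') \<and> disjoint (s Q') \<and>
    (\<forall>Q''\<in>s Q'. splits m K \<R> Q'' \<and> Q'' \<subseteq> Q' \<and> l < mean_norm m f Q'' \<and> mean_norm m f Q'' \<le> K * l) \<and>
    (\<forall>x\<in>Q' - \<Union>(s Q'). norm (f x) \<le> l)"
    by metis
  have "disjoint (\<Union>(s ` P))"
  proof (rule disjointI)
    fix a b assume "a \<in> \<Union>(s ` P)" "b \<in> \<Union>(s ` P)" and ab: "a \<noteq> b"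
    then obtain Q1 Q2 where Q12: "Q1 \<in> P" "Q2 \<in> P" "a \<in> s Q1" "b \<in> s Q2" by blast
    show "a \<inter> b = {}"
    proof (cases "Q1 = Q2")
      case True
      then show ?thesis using s[OF Q12(1)] Q12 ab by (auto dest: disjointD)
    next
      case False
      then have "Q1 \<inter> Q2 = {}" using split.hyps(4) Q12 by (auto dest: disjointD)
      then show ?thesis using s[OF Q12(1)] s[OF Q12(2)] Q12 by blast
    qed
  qed
  then show ?case
    using s split.hyps(2,5) by (intro exI[of _ "\<Union>(s ` P)"]) (safe; fastforce)
qed

text \<open>On \<open>Q\<close> the function is its integral spread evenly over \<open>F\<close>,
  plus functions \<open>u\<close> of integral zero at height \<open>l\<close>. The first part is
  there because \<open>f\<close> need not have integral zero on the pieces met in the induction. The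
  bound 4 on \<open>F\<close>, smaller than on the rest of \<open>Q\<close>, leaves room for one
  more function there, and the negative last term is a reserve that helps to pay for the next larger
  set.\<close>

definition decomposition ::
    "real \<Rightarrow> real \<Rightarrow> real \<Rightarrow> ('v \<Rightarrow> complex) \<Rightarrow> 'v set \<Rightarrow> 'v set \<Rightarrow>
      (('v \<Rightarrow> complex) \<times> real \<times> 'v set) list \<Rightarrow> bool" where
  "decomposition A B q f Q F xs \<longleftrightarrow> F \<subseteq> Q \<and> sum m Q \<le> 2 * sum m F \<and>
    (\<forall>(u, l, R)\<in>set xs. 0 < l \<and> R \<in> \<R> \<and> (\<forall>x. x \<notin> R \<longrightarrow> u x = 0) \<and> (\<Sum>x\<in>R. m x *\<^sub>R u x) = 0) \<and>
    (\<forall>x. (if x \<in> Q then f x else 0) =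
      (if x \<in> F then (\<Sum>y\<in>Q. m y *\<^sub>R f y) /\<^sub>R sum m F else 0) + (\<Sum>(u, l, R)\<leftarrow>xs. u x)) \<and>
    (\<forall>x. (\<Sum>(u, l, R)\<leftarrow>xs. norm (u x) / l) \<le> (if x \<in> F then 4 else if x \<in> Q then 4 + 4 * K else 0)) \<and>
    (\<Sum>(u, l, R)\<leftarrow>xs. l powr q * sum m R) \<le>
      A * (\<Sum>x\<in>Q. m x * norm (f x) powr q) - B * (mean_norm m f Q powr q * sum m Q)"

text \<open>
  The stopping sets \<open>Q'\<close> of \<open>Q\<close> are the maximal pieces with mean larger than \<open>2 l\<close>, where \<open>l\<close> is
  the mean over \<open>Q\<close>. They cover at most half of \<open>Q\<close>, and \<open>F\<close> is what they leave. The usual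
  Calderon--Zygmund differences would overlap without bound; here the integral over each \<open>Q'\<close> is
  instead spread over the corresponding \<open>F'\<close>, and these sets are disjoint. So at most two of the
  functions \<open>u\<close> are nonzero at any point.
\<close>

lemma splits_decomposition_aux:
  assumes AB: "stopping_constants q A B"
    and "1 < q"
    and "splits m K \<R> Q" "0 < mean_norm m f Q"
  shows "\<exists>F xs. decomposition A B q f Q F xs"
  using assms(3,4)
proof (induction "card Q" arbitrary: Q rule: less_induct)
  case less
  note Q = less.prems(1)
  define l where "l = mean_norm m f Q"
  have l: "0 < l" using less.prems by (simp add: l_def)
  have finQ: "finite Q" "Q \<in> \<R>" using splits_finite[OF Q] by auto
  have "mean_norm m f Q \<le> 2 * l" using l by (simp add: l_def)
  from splits_stopping[OF Q this] obtain S where Sx: "finite S" "disjoint S"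
    "\<forall>Q'\<in>S. splits m K \<R> Q' \<and> Q' \<subseteq> Q \<and> 2 * l < mean_norm m f Q' \<and> mean_norm m f Q' \<le> K * (2 * l)"
    "\<forall>x\<in>Q - \<Union>S. norm (f x) \<le> 2 * l"
    by blast
  have S: "finite S" "disjoint S" "\<And>Q'. Q' \<in> S \<Longrightarrow> splits m K \<R> Q'"
    "\<And>Q'. Q' \<in> S \<Longrightarrow> Q' \<subseteq> Q" "\<And>Q'. Q' \<in> S \<Longrightarrow> 2 * l < mean_norm m f Q'"
    "\<And>Q'. Q' \<in> S \<Longrightarrow> mean_norm m f Q' \<le> K * (2 * l)"
    "\<And>x. x \<in> Q - \<Union>S \<Longrightarrow> norm (f x) \<le> 2 * l"
    using Sx by auto
  have finS: "finite Q'" if "Q' \<in> S" for Q' using splits_finite[OF S(3)[OF that]] by simp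
  define F where "F = Q - \<Union>S"
  define a where "a = (\<Sum>x\<in>F. m x * norm (f x))"
  define b where "b = (\<Sum>Q'\<in>S. \<Sum>x\<in>Q'. m x * norm (f x))"
  have USQ: "\<Union>S \<subseteq> Q" using S(4) by blast
  have split_sum: "sum h Q = sum h F + (\<Sum>Q'\<in>S. sum h Q')" for h :: "'v \<Rightarrow> 'c::comm_monoid_add"
  proof -
    have "sum h (\<Union>S) = (\<Sum>Q'\<in>S. sum h Q')"
      using finS S(2) by (subst sum.Union_disjoint) (auto dest: disjointD)
    moreover have "sum h Q = sum h F + sum h (\<Union>S)"
      unfolding F_def by (rule sum.subset_diff[OF USQ finQ(1)])
    ultimately show ?thesis by simp
  qed
  have lQ: "l * sum m Q = (\<Sum>x\<in>Q. m x * norm (f x))" unfolding l_def by (rule mean_norm_mult[OF Q])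
  have ab: "a + b = l * sum m Q" unfolding lQ a_def b_def by (simp add: split_sum)
  have "0 \<le> a" unfolding a_def using mass_pos by (intro sum_nonneg) auto
  \<comment> \<open>Chebyshev's inequality: the means over the stopping sets exceed
    \<open>2 * l\<close>, while the mean over \<open>Q\<close> is \<open>l\<close>.\<close>
  have "2 * l * (\<Sum>Q'\<in>S. sum m Q') \<le> b"
    unfolding b_def
  proof (subst sum_distrib_left, rule sum_mono)
    fix Q' assume Q': "Q' \<in> S"
    show "2 * l * sum m Q' \<le> (\<Sum>x\<in>Q'. m x * norm (f x))"
      unfolding mean_norm_mult[OF S(3)[OF Q'], symmetric]
      using S(5)[OF Q'] splits_mass[OF S(3)[OF Q']] by (intro mult_right_mono) auto
  qed
  then have "2 * l * (\<Sum>Q'\<in>S. sum m Q') \<le> l * sum m Q" using ab \<open>0 \<le> a\<close> by simp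
  then have "2 * (\<Sum>Q'\<in>S. sum m Q') \<le> sum m Q" using l by simp
  then have MF: "sum m Q \<le> 2 * sum m F" using split_sum[of m] by simp
  have MQ: "0 < sum m Q" by (rule splits_mass[OF Q])
  have avg_bound: "norm ((\<Sum>y\<in>Q'. m y *\<^sub>R f y) /\<^sub>R sum m F') \<le> 2 * mean_norm m f Q'"
    if "splits m K \<R> Q'" "sum m Q' \<le> 2 * sum m F'" for Q' F'
  proof -
    have M: "0 < sum m Q'" by (rule splits_mass[OF that(1)])
    have "norm (\<Sum>y\<in>Q'. m y *\<^sub>R f y) \<le> (\<Sum>y\<in>Q'. m y * norm (f y))"
      by (intro order_trans[OF norm_sum]) (simp add: abs_of_nonneg)
    also have "\<dots> = mean_norm m f Q' * sum m Q'" by (rule mean_norm_mult[OF that(1), symmetric])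
    also have "\<dots> \<le> mean_norm m f Q' * (2 * sum m F')"
      using that(2) mean_norm_nonneg by (intro mult_left_mono) auto
    finally show ?thesis using M that(2) by (simp add: field_simps)
  qed
  \<comment> \<open>A stopping set is a proper subset, since its mean exceeds that of
    \<open>Q\<close>.\<close>
  have "card Q' < card Q" if "Q' \<in> S" for Q'
  proof -
    have "Q' \<noteq> Q" using S(5)[OF that] l by (auto simp: l_def)
    then show ?thesis using S(4)[OF that] finQ by (intro psubset_card_mono) auto
  qed
  moreover have "0 < mean_norm m f Q'" if "Q' \<in> S" for Q' using S(5)[OF that] l by linarith
  ultimately have "\<forall>Q'\<in>S. \<exists>F xs. decomposition A B q f Q' F xs"
    using less.hyps S(3) by blast
  then obtain e ys where p: "\<And>Q'. Q' \<in> S \<Longrightarrow> decomposition A B q f Q' (e Q') (ys Q')"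
    by metis
  have e: "e Q' \<subseteq> Q'" "sum m Q' \<le> 2 * sum m (e Q')" if "Q' \<in> S" for Q'
    using p[OF that] by (auto simp: decomposition_def)
  have ys1: "\<forall>(u, l, R)\<in>set (ys Q'). 0 < l \<and> R \<in> \<R> \<and> (\<forall>x. x \<notin> R \<longrightarrow> u x = 0) \<and>
      (\<Sum>x\<in>R. m x *\<^sub>R u x) = 0" if "Q' \<in> S" for Q'
    using p[OF that] unfolding decomposition_def by blast
  define c where "c Q' = (\<Sum>y\<in>Q'. m y *\<^sub>R f y) /\<^sub>R sum m (e Q')" for Q'
  have ys2: "(\<Sum>(u, l, R)\<leftarrow>ys Q'. u x) = (if x \<in> Q' then f x else 0) - (if x \<in> e Q' then c Q' else 0)"
    if "Q' \<in> S" for Q' x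
  proof -
    have "(if x \<in> Q' then f x else 0) = (if x \<in> e Q' then c Q' else 0) + (\<Sum>(u, l, R)\<leftarrow>ys Q'. u x)"
      using p[OF that] unfolding decomposition_def c_def by blast
    then show ?thesis by simp
  qed
  have ys3: "(\<Sum>(u, l, R)\<leftarrow>ys Q'. norm (u x) / l) \<le>
      (if x \<in> e Q' then 4 else if x \<in> Q' then 4 + 4 * K else 0)" if "Q' \<in> S" for Q' x
    using p[OF that] unfolding decomposition_def by blast
  have ys4: "(\<Sum>(u, l, R)\<leftarrow>ys Q'. l powr q * sum m R) \<le>
      A * (\<Sum>x\<in>Q'. m x * norm (f x) powr q) - B * (mean_norm m f Q' powr q * sum m Q')"
    if "Q' \<in> S" for Q'
    using p[OF that] unfolding decomposition_def by blast
  obtain ss where ss: "set ss = S" "distinct ss" using finite_distinct_list[OF S(1)] by blast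
  define c0 where "c0 = (\<Sum>y\<in>Q. m y *\<^sub>R f y) /\<^sub>R sum m F"
  \<comment> \<open>On \<open>F\<close> this is \<open>f\<close> minus the constant that carries the
    integral over \<open>Q\<close>; on each \<open>e Q'\<close> it is the constant left there by the
    decomposition of \<open>Q'\<close>. Its integral is that of \<open>f\<close> over
    \<open>F\<close>, minus that over \<open>Q\<close>, plus those over the stopping sets, hence
    zero.\<close>
  define u where "u x = (if x \<in> F then f x - c0 else 0) + (\<Sum>Q'\<in>S. if x \<in> e Q' then c Q' else 0)" for x
  define xs where "xs = (u, l, Q) # concat (map ys ss)"
  have sum_xs: "(\<Sum>z\<leftarrow>xs. h z) = h (u, l, Q) + (\<Sum>Q'\<in>S. \<Sum>z\<leftarrow>ys Q'. h z)"
    for h :: "('v \<Rightarrow> complex) \<times> real \<times> 'v set \<Rightarrow> 'c::comm_monoid_add"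
    unfolding xs_def using ss by (simp add: sum_list_concat_map sum_list_distinct_conv_sum_set)
  have MF0: "0 < sum m F" using MF MQ by simp
  have Me0: "0 < sum m (e Q')" if "Q' \<in> S" for Q'
    using e(2)[OF that] splits_mass[OF S(3)[OF that]] by simp
  have u_outside: "u x = 0" if "x \<notin> Q" for x
  proof -
    have "x \<notin> e Q'" if "Q' \<in> S" for Q' using e(1)[OF that] S(4)[OF that] \<open>x \<notin> Q\<close> by blast
    then show ?thesis using that by (simp add: u_def F_def)
  qed
  have u_zero: "(\<Sum>x\<in>Q. m x *\<^sub>R u x) = 0"
  proof -
    have "(\<Sum>x\<in>Q. m x *\<^sub>R u x) = (\<Sum>x\<in>Q. if x \<in> F then m x *\<^sub>R (f x - c0) else 0)
        + (\<Sum>x\<in>Q. \<Sum>Q'\<in>S. if x \<in> e Q' then m x *\<^sub>R c Q' else 0)"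
      by (simp add: u_def scaleR_add_right sum.distrib scaleR_sum_right if_distrib[of "scaleR _"] cong: if_cong)
    also have "(\<Sum>x\<in>Q. if x \<in> F then m x *\<^sub>R (f x - c0) else 0) = (\<Sum>x\<in>F. m x *\<^sub>R (f x - c0))"
      using finQ by (subst sum.inter_restrict[symmetric]) (auto simp: F_def intro!: sum.cong)
    also have "\<dots> = (\<Sum>x\<in>F. m x *\<^sub>R f x) - (\<Sum>y\<in>Q. m y *\<^sub>R f y)"
    proof -
      have "(\<Sum>x\<in>F. m x *\<^sub>R c0) = sum m F *\<^sub>R c0" by (simp add: scaleR_sum_left)
      also have "\<dots> = (\<Sum>y\<in>Q. m y *\<^sub>R f y)" using MF0 by (simp add: c0_def)
      finally show ?thesis by (simp add: scaleR_diff_right sum_subtractf)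
    qed
    also have "(\<Sum>x\<in>Q. \<Sum>Q'\<in>S. if x \<in> e Q' then m x *\<^sub>R c Q' else 0)
        = (\<Sum>Q'\<in>S. \<Sum>x\<in>Q. if x \<in> e Q' then m x *\<^sub>R c Q' else 0)"
      by (rule sum.swap)
    also have "\<dots> = (\<Sum>Q'\<in>S. \<Sum>y\<in>Q'. m y *\<^sub>R f y)"
    proof (rule sum.cong[OF refl])
      fix Q' assume Q': "Q' \<in> S"
      have "(\<Sum>x\<in>Q. if x \<in> e Q' then m x *\<^sub>R c Q' else 0) = (\<Sum>x\<in>e Q'. m x *\<^sub>R c Q')"
        using finQ e(1)[OF Q'] S(4)[OF Q']
        by (subst sum.inter_restrict[symmetric]) (auto intro!: sum.cong)
      also have "\<dots> = (\<Sum>y\<in>Q'. m y *\<^sub>R f y)"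
      proof -
        have "(\<Sum>x\<in>e Q'. m x *\<^sub>R c Q') = sum m (e Q') *\<^sub>R c Q'" by (simp add: scaleR_sum_left)
        then show ?thesis using Me0[OF Q'] by (simp add: c_def)
      qed
      finally show "(\<Sum>x\<in>Q. if x \<in> e Q' then m x *\<^sub>R c Q' else 0) = (\<Sum>y\<in>Q'. m y *\<^sub>R f y)" .
    qed
    finally show ?thesis using split_sum[of "\<lambda>y. m y *\<^sub>R f y"] by simp
  qed
  \<comment> \<open>The stopping sets are disjoint, so at a point of one of them the others
    contribute nothing.\<close>
  have only: "(\<Sum>Q'\<in>S. h Q') = h Q1"
    if "Q1 \<in> S" "x \<in> Q1" "\<And>Q'. Q' \<in> S \<Longrightarrow> x \<notin> Q' \<Longrightarrow> h Q' = 0" for Q1 x and h :: "'v set \<Rightarrow> 'c::comm_monoid_add"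
  proof -
    have "h Q' = 0" if "Q' \<in> S - {Q1}" for Q'
    proof -
      have "Q' \<inter> Q1 = {}" using that \<open>Q1 \<in> S\<close> S(2) by (auto dest: disjointD)
      then show ?thesis using that \<open>x \<in> Q1\<close> \<open>\<And>Q'. Q' \<in> S \<Longrightarrow> x \<notin> Q' \<Longrightarrow> h Q' = 0\<close> by blast
    qed
    then have "sum h (S - {Q1}) = 0" by (intro sum.neutral) blast
    then show ?thesis using sum.remove[OF S(1) that(1), of h] by simp
  qed
  have ysnn: "0 \<le> (\<Sum>(u, l, R)\<leftarrow>ys Q'. norm (u x) / l)" if "Q' \<in> S" for Q' x
    using ys1[OF that] by (intro sum_list_nonneg) (fastforce intro!: divide_nonneg_pos)
  have ys0: "(\<Sum>(u, l, R)\<leftarrow>ys Q'. norm (u x) / l) = 0" if "Q' \<in> S" "x \<notin> Q'" for Q' x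
    using ys3[OF that(1), of x] ysnn[OF that(1), of x] that e(1)[OF that(1)] by (auto split: if_splits)
  have fourth: "(\<Sum>(u, l, R)\<leftarrow>xs. l powr q * sum m R) \<le>
      A * (\<Sum>x\<in>Q. m x * norm (f x) powr q) - B * (mean_norm m f Q powr q * sum m Q)"
  proof -
    define X where "X = (\<Sum>x\<in>F. m x * norm (f x) powr q)"
    define Y where "Y = (\<Sum>Q'\<in>S. mean_norm m f Q' powr q * sum m Q')"
    \<comment> \<open>On the left, one unit is the cost of the new triple \<open>(u, l, Q)\<close>
      and \<open>B\<close> units are the reserve for \<open>Q\<close>; on the right,
      \<open>B * Y\<close> is the sum of the reserves of the stopping sets.\<close>
    have "(1 + B) * (l powr q * sum m Q) \<le> A * X + B * Y"
    proof (rule AB[unfolded stopping_constants_def, rule_format, OF l MQ ab])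
      show "0 \<le> X" unfolding X_def using mass_pos by (intro sum_nonneg) auto
      show "0 \<le> Y" unfolding Y_def using splits_mass[OF S(3)] by (intro sum_nonneg) (simp add: less_imp_le)
      show "s powr (q - 1) * (a - s * sum m Q) \<le> X" if s: "0 < s" for s
      proof -
        have "s powr (q - 1) * (t - s) \<le> t powr q" if "0 \<le> t" for t
        proof (cases "s \<le> t")
          case True
          then have "s powr (q - 1) * (t - s) \<le> t powr (q - 1) * t"
            using s \<open>1 < q\<close> by (intro mult_mono powr_mono2) auto
          also have "\<dots> = t powr q" using True s by (simp add: powr_diff)
          finally show ?thesis .
        next
          case False
          then have "s powr (q - 1) * (t - s) \<le> 0" by (simp add: mult_nonneg_nonpos)
          then show ?thesis using powr_ge_zero order_trans by blast
        qed
        then have "(\<Sum>x\<in>F. m x * (s powr (q - 1) * (norm (f x) - s))) \<le> X"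
          unfolding X_def by (intro sum_mono mult_left_mono) auto
        also have "(\<Sum>x\<in>F. m x * (s powr (q - 1) * (norm (f x) - s))) = s powr (q - 1) * (a - s * sum m F)"
          by (simp add: a_def sum_distrib_left sum_subtractf algebra_simps)
        finally have "s powr (q - 1) * (a - s * sum m F) \<le> X" .
        moreover have "sum m F \<le> sum m Q"
          using finQ by (intro sum_mono2) (auto simp: F_def)
        then have "s powr (q - 1) * (a - s * sum m Q) \<le> s powr (q - 1) * (a - s * sum m F)"
          using s by (intro mult_left_mono) auto
        ultimately show ?thesis by linarith
      qed
      show "(2 * l) powr (q - 1) * b \<le> Y"
        unfolding b_def Y_def
      proof (subst sum_distrib_left, rule sum_mono)
        fix Q' assume Q': "Q' \<in> S"
        define t where "t = mean_norm m f Q'"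
        have t: "2 * l \<le> t" "0 < t" using S(5)[OF Q'] l by (auto simp: t_def)
        have "(2 * l) powr (q - 1) * (t * sum m Q') \<le> t powr (q - 1) * (t * sum m Q')"
          using t l \<open>1 < q\<close> splits_mass[OF S(3)[OF Q']] by (intro mult_right_mono powr_mono2) auto
        also have "\<dots> = t powr q * sum m Q'" using t by (simp add: powr_diff)
        finally show "(2 * l) powr (q - 1) * (\<Sum>x\<in>Q'. m x * norm (f x)) \<le> mean_norm m f Q' powr q * sum m Q'"
          unfolding t_def mean_norm_mult[OF S(3)[OF Q']] .
      qed
    qed
    moreover have "(\<Sum>Q'\<in>S. \<Sum>(u, l, R)\<leftarrow>ys Q'. l powr q * sum m R) \<le>
        (\<Sum>Q'\<in>S. A * (\<Sum>x\<in>Q'. m x * norm (f x) powr q) - B * (mean_norm m f Q' powr q * sum m Q'))"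
      by (intro sum_mono ys4)
    moreover have "A * (\<Sum>x\<in>Q. m x * norm (f x) powr q) =
        A * X + (\<Sum>Q'\<in>S. A * (\<Sum>x\<in>Q'. m x * norm (f x) powr q))"
      unfolding X_def split_sum by (simp add: distrib_left sum_distrib_left)
    ultimately show ?thesis
      unfolding sum_xs by (simp add: l_def Y_def sum_subtractf sum_distrib_left algebra_simps)
  qed
  show ?case
    unfolding decomposition_def
  proof (intro exI[of _ F] exI[of _ xs] conjI)
    show "F \<subseteq> Q" by (auto simp: F_def)
    show "\<forall>(u, l, R)\<in>set xs. 0 < l \<and> R \<in> \<R> \<and> (\<forall>x. x \<notin> R \<longrightarrow> u x = 0) \<and> (\<Sum>x\<in>R. m x *\<^sub>R u x) = 0"
      using ys1 u_zero u_outside l finQ ss by (auto simp: xs_def)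
    show "\<forall>x. (if x \<in> Q then f x else 0) =
        (if x \<in> F then (\<Sum>y\<in>Q. m y *\<^sub>R f y) /\<^sub>R sum m F else 0) + (\<Sum>(u, l, R)\<leftarrow>xs. u x)"
    proof
      fix x
      have "(\<Sum>Q'\<in>S. \<Sum>(u, l, R)\<leftarrow>ys Q'. u x) =
          (\<Sum>Q'\<in>S. if x \<in> Q' then f x else 0) - (\<Sum>Q'\<in>S. if x \<in> e Q' then c Q' else 0)"
        by (simp add: ys2 sum_subtractf)
      moreover have "(\<Sum>Q'\<in>S. if x \<in> Q' then f x else 0) = (if x \<in> \<Union>S then f x else 0)"
      proof (cases "x \<in> \<Union>S")
        case True
        then obtain Q1 where "Q1 \<in> S" "x \<in> Q1" by blast
        then show ?thesis using True only[of Q1 x "\<lambda>Q'. if x \<in> Q' then f x else 0"] by simp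
      qed (auto intro: sum.neutral)
      ultimately show "(if x \<in> Q then f x else 0) =
        (if x \<in> F then (\<Sum>y\<in>Q. m y *\<^sub>R f y) /\<^sub>R sum m F else 0) + (\<Sum>(u, l, R)\<leftarrow>xs. u x)"
        unfolding sum_xs using USQ by (auto simp: u_def F_def c0_def)
    qed
    \<comment> \<open>The bound does not grow with the depth of the recursion. On \<open>F\<close>
      only the new \<open>u\<close> is present, and \<open>\<bar>f\<bar>\<close> and the subtracted
      constant are at most \<open>2 * l\<close> each. On \<open>e Q1\<close> the recursive bound is
      4 and \<open>u\<close> adds at most \<open>4 * K\<close>, as the mean over \<open>Q1\<close>
      is at most \<open>2 * K * l\<close>. On the rest of \<open>Q1\<close> the new \<open>u\<close>
      vanishes.\<close>
    show "\<forall>x. (\<Sum>(u, l, R)\<leftarrow>xs. norm (u x) / l) \<le> (if x \<in> F then 4 else if x \<in> Q then 4 + 4 * K else 0)"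
    proof
      fix x
      consider "x \<in> F" | Q1 where "Q1 \<in> S" "x \<in> Q1" | "x \<notin> Q" by (auto simp: F_def)
      then show "(\<Sum>(u, l, R)\<leftarrow>xs. norm (u x) / l) \<le> (if x \<in> F then 4 else if x \<in> Q then 4 + 4 * K else 0)"
      proof cases
        case 1
        then have "x \<notin> Q'" if "Q' \<in> S" for Q' using that by (auto simp: F_def)
        then have "x \<notin> e Q'" "x \<notin> Q'" if "Q' \<in> S" for Q' using e(1)[OF that] that by blast+
        then have ux: "u x = f x - c0" and "(\<Sum>Q'\<in>S. \<Sum>(u, l, R)\<leftarrow>ys Q'. norm (u x) / l) = 0"
          using 1 ys0 by (simp_all add: u_def)
        moreover have "norm (f x - c0) \<le> 2 * l + 2 * l"
          using S(7)[of x] 1 avg_bound[OF Q MF] norm_triangle_ineq4[of "f x" c0]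
          by (simp add: F_def c0_def l_def)
        then have "norm (u x) / l \<le> 4" using l by (simp add: ux pos_divide_le_eq)
        ultimately show ?thesis unfolding sum_xs using 1 by simp
      next
        case 2
        then have x: "x \<notin> F" "x \<in> Q" using S(4) by (auto simp: F_def)
        have "(\<Sum>Q'\<in>S. if x \<in> e Q' then c Q' else 0) = (if x \<in> e Q1 then c Q1 else 0)"
          using e(1) by (intro only[OF 2]) auto
        then have ux: "u x = (if x \<in> e Q1 then c Q1 else 0)" using x by (simp add: u_def)
        have "norm (c Q1) \<le> 2 * mean_norm m f Q1"
          unfolding c_def by (rule avg_bound[OF S(3)[OF 2(1)] e(2)[OF 2(1)]])
        also have "\<dots> \<le> 4 * K * l" using S(6)[OF 2(1)] by simp
        finally have c: "norm (c Q1) / l \<le> 4 * K" using l by (simp add: field_simps)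
        have "(\<Sum>Q'\<in>S. \<Sum>(u, l, R)\<leftarrow>ys Q'. norm (u x) / l) = (\<Sum>(u, l, R)\<leftarrow>ys Q1. norm (u x) / l)"
          using ys0 by (intro only[OF 2]) auto
        then show ?thesis unfolding sum_xs using x ux c ys3[OF 2(1), of x] K
          by (auto split: if_splits)
      next
        case 3
        then have "(\<Sum>Q'\<in>S. \<Sum>(u, l, R)\<leftarrow>ys Q'. norm (u x) / l) = 0"
          using S(4) ys0 by (intro sum.neutral) blast
        then show ?thesis unfolding sum_xs using 3 u_outside[OF 3] by (auto simp: F_def)
      qed
    qed
  qed (use MF fourth in auto)
qed

text \<open>For \<open>f\<close> of integral zero the constant left on \<open>F\<close> vanishes, so
  the list alone reproduces \<open>f\<close>. Scaling by \<open>\<delta>\<close> makes the L^q norm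
  at most 1, dividing each \<open>u\<close> by its height gives \<open>v\<close>, and the reserve is
  dropped.\<close>

lemma splits_decomposition:
  assumes q: "1 < q"
  obtains C where "0 < C"
    "\<And>Q f \<delta>. splits m K \<R> Q \<Longrightarrow> (\<And>x. x \<notin> Q \<Longrightarrow> f x = 0) \<Longrightarrow> (\<Sum>x\<in>Q. m x *\<^sub>R f x) = 0 \<Longrightarrow> 0 < \<delta> \<Longrightarrow>
      (\<Sum>x\<in>Q. m x * norm (f x) powr q) \<le> \<delta> powr q \<Longrightarrow> \<exists>n l R v. atomic_sum m \<R> q C \<delta> f n l R v"
proof -
  obtain A B where A: "0 < A" and B: "0 < B" and AB: "stopping_constants q A B"
    using stopping_constants[OF q] by blast
  define C where "C = max (4 + 4 * K) A"
  show ?thesis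
  proof (rule that[of C])
    show "0 < C" using A by (simp add: C_def)
    fix Q :: "'v set" and f :: "'v \<Rightarrow> complex" and \<delta> :: real
    assume Q: "splits m K \<R> Q" and f: "\<And>x. x \<notin> Q \<Longrightarrow> f x = 0" "(\<Sum>x\<in>Q. m x *\<^sub>R f x) = 0"
      and \<delta>: "0 < \<delta>" and bound: "(\<Sum>x\<in>Q. m x * norm (f x) powr q) \<le> \<delta> powr q"
    define g where "g x = f x / of_real \<delta>" for x
    have fg: "f x = of_real \<delta> * g x" for x using \<delta> by (simp add: g_def)
    show "\<exists>n l R v. atomic_sum m \<R> q C \<delta> f n l R v"
    \<comment> \<open>The recursion starts from a positive mean; otherwise \<open>f\<close> is zero
      and the empty sum serves.\<close>
    proof (cases "mean_norm m g Q = 0")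
      case True
      then have "(\<Sum>x\<in>Q. m x * norm (g x)) = 0" using splits_mass[OF Q] by (simp add: mean_norm_def)
      then have "\<forall>x\<in>Q. m x * norm (g x) = 0"
        using splits_finite[OF Q] by (subst (asm) sum_nonneg_eq_0_iff) auto
      then have "g x = 0" for x using f(1) mass_pos[of x] by (cases "x \<in> Q") (auto simp: g_def)
      then show ?thesis using K A by (intro exI[of _ 0]) (simp add: atomic_sum_def fg C_def)
    next
      case False
      then have "0 < mean_norm m g Q" using mean_norm_nonneg[of g Q] by simp
      from splits_decomposition_aux[OF AB q Q this] obtain F xs where
        "decomposition A B q g Q F xs" by blast
      note xs = this[unfolded decomposition_def, THEN conjunct2, THEN conjunct2]
      define n where "n = length xs"
      define u where "u i = fst (xs ! i)" for i
      define l where "l i = fst (snd (xs ! i))" for i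
      define R where "R i = snd (snd (xs ! i))" for i
      define v where "v i x = u i x / of_real (l i)" for i x
      have nth: "xs ! i = (u i, l i, R i)" for i by (simp add: u_def l_def R_def)
      have sum_xs: "(\<Sum>z\<leftarrow>xs. h z) = (\<Sum>i<n. h (u i, l i, R i))"
        for h :: "('v \<Rightarrow> complex) \<times> real \<times> 'v set \<Rightarrow> 'c::comm_monoid_add"
        by (simp add: sum_list_sum_nth n_def nth atLeast0LessThan)
      have el: "0 < l i \<and> R i \<in> \<R> \<and> (\<forall>x. x \<notin> R i \<longrightarrow> u i x = 0) \<and> (\<Sum>x\<in>R i. m x *\<^sub>R u i x) = 0"
        if "i < n" for i
      proof -
        have "(u i, l i, R i) \<in> set xs" using that nth_mem[of i xs] by (simp add: n_def nth)
        then show ?thesis using xs[THEN conjunct1] by fast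
      qed
      have uv: "u i x = of_real (l i) * v i x" if "i < n" for i x
        using el[OF that] by (auto simp: v_def)
      have nv: "norm (v i x) = norm (u i x) / l i" if "i < n" for i x
        using el[OF that] by (auto simp: v_def norm_divide)
      have "(\<Sum>x\<in>Q. m x *\<^sub>R g x) = (\<Sum>x\<in>Q. m x *\<^sub>R f x) / of_real \<delta>"
        by (simp add: g_def sum_divide_distrib scaleR_conv_of_real)
      then have "g x = (\<Sum>i<n. u i x)" for x
        using xs[THEN conjunct2, THEN conjunct1, rule_format, of x] f
        by (simp add: sum_xs g_def split: if_splits)
      then have "f x = of_real \<delta> * (\<Sum>i<n. of_real (l i) * v i x)" for x
        using uv by (simp add: fg)
      moreover have "(\<Sum>i<n. norm (v i x)) \<le> C" for x
        using xs[THEN conjunct2, THEN conjunct2, THEN conjunct1, rule_format, of x] K nv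
        by (simp add: sum_xs C_def split: if_splits)
      moreover have "0 < l i \<and> R i \<in> \<R> \<and> (\<forall>x. x \<notin> R i \<longrightarrow> v i x = 0) \<and> (\<Sum>x\<in>R i. m x *\<^sub>R v i x) = 0"
        if "i < n" for i
      proof -
        have "(\<Sum>x\<in>R i. m x *\<^sub>R v i x) = (\<Sum>x\<in>R i. m x *\<^sub>R u i x) / of_real (l i)"
          by (simp add: v_def sum_divide_distrib scaleR_conv_of_real)
        then show ?thesis using el[OF that] by (auto simp: v_def)
      qed
      moreover have "(\<Sum>i<n. l i powr q * sum m (R i)) \<le> C"
      proof -
        have "(\<Sum>x\<in>Q. m x * norm (g x) powr q) = (\<Sum>x\<in>Q. m x * norm (f x) powr q) / \<delta> powr q"
          using \<delta> by (simp add: g_def norm_divide powr_divide sum_divide_distrib)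
        also have "\<dots> \<le> 1" using bound \<delta> by simp
        finally have "A * (\<Sum>x\<in>Q. m x * norm (g x) powr q) \<le> A" using A by simp
        moreover have "0 \<le> B * (mean_norm m g Q powr q * sum m Q)" using B splits_mass[OF Q] by simp
        moreover have "(\<Sum>i<n. l i powr q * sum m (R i)) \<le> A * (\<Sum>x\<in>Q. m x * norm (g x) powr q) -
            B * (mean_norm m g Q powr q * sum m Q)"
          using xs[THEN conjunct2, THEN conjunct2, THEN conjunct2] by (simp add: sum_xs)
        ultimately show ?thesis by (simp add: C_def)
      qed
      ultimately show ?thesis
        unfolding atomic_sum_def by (intro exI[of _ n] exI[of _ l] exI[of _ R] exI[of _ v]) simp
    qed
  qed
qed

end

section \<open>Sums over a weighted vertex set\<close>

lemma integrable_count_space_iff: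
  fixes f :: "'a \<Rightarrow> real"
  shows "integrable (count_space UNIV) f \<longleftrightarrow> (\<lambda>x. norm (f x)) summable_on UNIV"
  using Infinite_Set_Sum.abs_summable_on_def[of f UNIV] abs_summable_equivalent[of f UNIV] by simp

lemma norm_powr_le:
  fixes a b :: complex
  assumes "0 < p"
  shows "norm (a + b) powr p \<le> 2 powr p * (norm a powr p + norm b powr p)"
proof -
  define M where "M = max (norm a) (norm b)"
  have "norm (a + b) \<le> 2 * M" using norm_triangle_ineq[of a b] by (simp add: M_def)
  then have "norm (a + b) powr p \<le> (2 * M) powr p" using assms by (intro powr_mono2) auto
  also have "\<dots> = 2 powr p * M powr p" by (rule powr_mult)
  also have "M powr p \<le> norm a powr p + norm b powr p"
    by (cases "norm a \<le> norm b") (auto simp: M_def max_def)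
  finally show ?thesis by simp
qed

context weight
begin

lemma vmeasure_density: "vmeasure m = density (count_space UNIV) (\<lambda>x. ennreal (m x))"
  by (simp add: vmeasure_def point_measure_def)

lemma measure_vmeasure: "finite R \<Longrightarrow> measure (vmeasure m) R = sum m R"
  unfolding vmeasure_def measure_def
  by (subst emeasure_point_measure_finite2) (auto simp: sum_ennreal sum_nonneg)

lemma set_integral_vmeasure:
  fixes f :: "'v \<Rightarrow> 'b::{banach, second_countable_topology}"
  assumes "finite R"
  shows "(LINT x:R|vmeasure m. f x) = (\<Sum>x\<in>R. m x *\<^sub>R f x)"
proof -
  have fin: "finite {a \<in> UNIV. m a *\<^sub>R (indicator R a *\<^sub>R f a) \<noteq> 0}"
    by (rule finite_subset[OF _ assms]) (auto simp: indicator_def)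
  have "(LINT x:R|vmeasure m. f x) = (\<integral>x. m x *\<^sub>R (indicator R x *\<^sub>R f x) \<partial>count_space UNIV)"
    unfolding set_lebesgue_integral_def vmeasure_density by (subst integral_density) auto
  also have "\<dots> = (\<Sum>x\<in>R. m x *\<^sub>R f x)"
    unfolding lebesgue_integral_count_space_finite_support[OF fin]
    using assms by (intro sum.mono_neutral_cong_left) (auto simp: indicator_def)
  finally show ?thesis .
qed

text \<open>Reduces integrals of nonnegative functions to bounds on finite sums, the form in which
  the later L^p estimates are made.\<close>

lemma integrable_vmeasure_iff:
  assumes "\<And>x. 0 \<le> g x"
  shows "integrable (vmeasure m) g \<longleftrightarrow> (\<exists>B. \<forall>S. finite S \<longrightarrow> (\<Sum>x\<in>S. m x * g x) \<le> B)"
proof -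
  have "integrable (vmeasure m) g \<longleftrightarrow> (\<lambda>x. m x * g x) summable_on UNIV"
    unfolding vmeasure_density using assms
    by (subst integrable_density) (auto simp: integrable_count_space_iff)
  also have "\<dots> \<longleftrightarrow> (\<exists>B. \<forall>S. finite S \<longrightarrow> (\<Sum>x\<in>S. m x * g x) \<le> B)"
  proof
    assume "(\<lambda>x. m x * g x) summable_on UNIV"
    then have "(\<Sum>x\<in>S. m x * g x) \<le> infsum (\<lambda>x. m x * g x) UNIV" if "finite S" for S
      using that assms by (intro finite_sum_le_infsum) auto
    then show "\<exists>B. \<forall>S. finite S \<longrightarrow> (\<Sum>x\<in>S. m x * g x) \<le> B" by blast
  next
    assume "\<exists>B. \<forall>S. finite S \<longrightarrow> (\<Sum>x\<in>S. m x * g x) \<le> B"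
    then show "(\<lambda>x. m x * g x) summable_on UNIV"
      using assms by (intro nonneg_bdd_above_summable_on) (auto simp: bdd_above_def)
  qed
  finally show ?thesis .
qed

lemma integral_vmeasure:
  assumes "\<And>x. 0 \<le> g x" "integrable (vmeasure m) g"
  shows "finite S \<Longrightarrow> (\<Sum>x\<in>S. m x * g x) \<le> integral\<^sup>L (vmeasure m) g"
    and "(\<And>S. finite S \<Longrightarrow> (\<Sum>x\<in>S. m x * g x) \<le> B) \<Longrightarrow> integral\<^sup>L (vmeasure m) g \<le> B"
proof -
  have "integrable (count_space UNIV) (\<lambda>x. m x * g x)"
    using assms(2) unfolding vmeasure_density by (subst (asm) integrable_density) auto
  then have s: "Infinite_Set_Sum.abs_summable_on (\<lambda>x. m x * g x) UNIV" "(\<lambda>x. m x * g x) summable_on UNIV"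
    using assms(1) Infinite_Set_Sum.abs_summable_on_def[of "\<lambda>x. m x * g x" UNIV]
    by (auto simp: integrable_count_space_iff)
  have "integral\<^sup>L (vmeasure m) g = integral\<^sup>L (count_space UNIV) (\<lambda>x. m x * g x)"
    unfolding vmeasure_density by (subst integral_density) auto
  also have "\<dots> = infsum (\<lambda>x. m x * g x) UNIV"
    using infsetsum_infsum[of "\<lambda>x. m x * g x" UNIV] s(1)
    by (simp add: infsetsum_def abs_summable_equivalent)
  finally have eq: "integral\<^sup>L (vmeasure m) g = infsum (\<lambda>x. m x * g x) UNIV" .
  show "finite S \<Longrightarrow> (\<Sum>x\<in>S. m x * g x) \<le> integral\<^sup>L (vmeasure m) g"
    unfolding eq using s(2) assms by (intro finite_sum_le_infsum) auto
  show "(\<And>S. finite S \<Longrightarrow> (\<Sum>x\<in>S. m x * g x) \<le> B) \<Longrightarrow> integral\<^sup>L (vmeasure m) g \<le> B"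
    unfolding eq using s(2) by (intro infsum_le_finite_sums) auto
qed

lemma LpI:
  assumes "0 < p" "0 \<le> K" "\<And>S. finite S \<Longrightarrow> (\<Sum>x\<in>S. m x * norm (f x) powr p) \<le> K powr p"
  shows "f \<in> carr (Lp m p)" "nnorm (Lp m p) f \<le> K"
proof -
  have i: "integrable (vmeasure m) (\<lambda>x. norm (f x) powr p)"
    using assms(3) by (subst integrable_vmeasure_iff) auto
  then show "f \<in> carr (Lp m p)" by (simp add: Lp_def)
  have I: "0 \<le> (LINT x|vmeasure m. norm (f x) powr p)" by (rule Bochner_Integration.integral_nonneg) simp
  have "(LINT x|vmeasure m. norm (f x) powr p) \<le> K powr p"
    by (rule integral_vmeasure(2)[OF _ i]) (use assms(3) in auto)
  then have "(LINT x|vmeasure m. norm (f x) powr p) powr (1 / p) \<le> (K powr p) powr (1 / p)"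
    using assms(1) I by (intro powr_mono2) auto
  then show "nnorm (Lp m p) f \<le> K" using assms(1,2) by (simp add: Lp_def powr_powr)
qed

lemma Lp_sum_le:
  assumes "f \<in> carr (Lp m p)" "0 < p" "finite S"
  shows "(\<Sum>x\<in>S. m x * norm (f x) powr p) \<le> nnorm (Lp m p) f powr p"
proof -
  have i: "integrable (vmeasure m) (\<lambda>x. norm (f x) powr p)" using assms by (simp add: Lp_def)
  have "0 \<le> (LINT x|vmeasure m. norm (f x) powr p)" by (rule Bochner_Integration.integral_nonneg) simp
  then show ?thesis
    using integral_vmeasure(1)[OF _ i assms(3)] assms(2) by (simp add: Lp_def powr_powr)
qed

lemma Lp_sum_le_powr:
  assumes "f \<in> carr (Lp m p)" "0 < p" "finite S" "nnorm (Lp m p) f \<le> K"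
  shows "(\<Sum>x\<in>S. m x * norm (f x) powr p) \<le> K powr p"
proof -
  have "nnorm (Lp m p) f powr p \<le> K powr p"
    using assms by (intro powr_mono2) (auto simp: Lp_def)
  then show ?thesis using Lp_sum_le[OF assms(1-3)] by linarith
qed

lemma nonneg_norm_Lp: "nonneg_norm (Lp m p)"
  by (simp add: nonneg_norm_def Lp_def)

lemma L1I:
  assumes "0 \<le> K" "\<And>S. finite S \<Longrightarrow> (\<Sum>x\<in>S. m x * norm (f x)) \<le> K"
  shows "f \<in> carr (Lp m 1)" "nnorm (Lp m 1) f \<le> K"
  using LpI[of 1 K f] assms by (auto simp: powr_one)

lemma L1_sum_le:
  assumes "f \<in> carr (Lp m 1)" "finite S"
  shows "(\<Sum>x\<in>S. m x * norm (f x)) \<le> nnorm (Lp m 1) f"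
proof -
  have "0 \<le> nnorm (Lp m 1) f" using nonneg_norm_Lp assms(1) by (rule nonneg_normD)
  then show ?thesis using Lp_sum_le[OF assms(1) _ assms(2)] by simp
qed

text \<open>Take any finite set whose partial sum comes within \<open>e\<close> of the supremum of
  all partial sums.\<close>

lemma Lp_tail:
  assumes "f \<in> carr (Lp m p)" "0 < p" "0 < e"
  obtains S where "finite S" "\<And>T. finite T \<Longrightarrow> T \<inter> S = {} \<Longrightarrow> (\<Sum>x\<in>T. m x * norm (f x) powr p) \<le> e"
proof -
  let ?s = "\<lambda>S. \<Sum>x\<in>S. m x * norm (f x) powr p"
  have bdd: "bdd_above (?s ` {S. finite S})"
    using Lp_sum_le[OF assms(1,2)] by (auto simp: bdd_above_def)
  obtain S where S: "finite S" "(SUP S\<in>{S. finite S}. ?s S) - e < ?s S"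
  proof -
    have "\<exists>y\<in>?s ` {S. finite S}. Sup (?s ` {S. finite S}) - e < y"
      using assms(3) by (intro less_cSupD) auto
    then show ?thesis using that by auto
  qed
  show ?thesis
  proof (rule that[OF S(1)])
    fix T assume T: "finite T" "T \<inter> S = {}"
    have "?s (T \<union> S) \<le> (SUP S\<in>{S. finite S}. ?s S)"
      using T S bdd by (intro cSUP_upper) auto
    then show "?s T \<le> e" using S T by (simp add: sum.union_disjoint)
  qed
qed

end

lemma Linf_norm_ge: "f \<in> carr Linf \<Longrightarrow> norm (f x) \<le> nnorm Linf f"
  unfolding Linf_def nspace.sel
  by (intro cSUP_upper) (auto simp: bounded_iff bdd_above_def)

lemma LinfI:
  assumes "\<And>x. norm (f x) \<le> K"
  shows "f \<in> carr Linf" "nnorm Linf f \<le> K"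
  using assms by (auto simp: Linf_def bounded_iff intro!: cSUP_least)

lemma nonneg_norm_Linf: "nonneg_norm Linf"
  unfolding nonneg_norm_def by (meson Linf_norm_ge norm_ge_zero order_trans)

section \<open>Functions modulo constants\<close>

lemma mod_const_add: "mod_const (f + g) = mod_const f + mod_const g"
  by (simp add: plus_fun_mod_const.abs_eq plus_fun_def)

lemma mod_const_scaleC: "mod_const (c *\<^sub>C f) = c *\<^sub>C mod_const f"
  by (simp add: scaleC_fun_mod_const.abs_eq)

lemma mod_const_eq_iff: "mod_const f = mod_const g \<longleftrightarrow> (\<exists>c. \<forall>x. f x = g x + c)"
  using fun_mod_const.abs_eq_iff by blast

lemma mod_const_rep: "mod_const (rep_mod_const w) = w"
  by (rule Quotient3_abs_rep[OF Quotient3_fun_mod_const])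

lemma rep_mod_const: "\<exists>c. \<forall>x. rep_mod_const (mod_const f) x = f x + c"
  using mod_const_rep[of "mod_const f"] unfolding mod_const_eq_iff .

lemma modulo_norm_le:
  assumes "f \<in> carr X" "nonneg_norm X"
  shows "mod_const f \<in> carr (modulo_constants X)" "nnorm (modulo_constants X) (mod_const f) \<le> nnorm X f"
proof -
  show "mod_const f \<in> carr (modulo_constants X)" using assms by (simp add: modulo_constants_def)
  show "nnorm (modulo_constants X) (mod_const f) \<le> nnorm X f"
    unfolding modulo_constants_def nspace.sel
    by (rule cInf_lower) (use assms in \<open>auto simp: nonneg_norm_def intro!: bdd_belowI[of _ 0]\<close>)
qed

lemma modulo_norm_ge:
  assumes "u \<in> carr (modulo_constants X)" "0 < C"
    and "\<And>f. f \<in> carr X \<Longrightarrow> mod_const f = u \<Longrightarrow> K \<le> C * nnorm X f"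
  shows "K \<le> C * nnorm (modulo_constants X) u"
proof -
  have "K / C \<le> nnorm (modulo_constants X) u"
    unfolding modulo_constants_def nspace.sel
    by (rule cInf_greatest) (use assms in \<open>auto simp: modulo_constants_def field_simps\<close>)
  then show ?thesis using \<open>0 < C\<close> by (simp add: field_simps)
qed

lemma carr_modulo: "u \<in> carr (modulo_constants X) \<longleftrightarrow> (\<exists>f\<in>carr X. u = mod_const f)"
  by (auto simp: modulo_constants_def)

lemma nonneg_norm_modulo: "nonneg_norm X \<Longrightarrow> nonneg_norm (modulo_constants X)"
  using modulo_norm_ge[of _ X 1 0] by (auto simp: nonneg_norm_def)

lemma bounded_map_mod_const:
  assumes "bounded_map C X Y id" "nonneg_norm Y"
  shows "bounded_map C X (modulo_constants Y) mod_const"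
  unfolding bounded_map_def
  using bounded_mapD[OF assms(1)] modulo_norm_le[OF _ assms(2)] by (fastforce intro: order_trans)

text \<open>The bound holds for every representative, hence for the infimum that defines the
  quotient norm.\<close>

lemma bounded_map_modulo:
  assumes "bounded_map C X Z mod_const" "0 < C"
  shows "bounded_map C (modulo_constants X) Z id"
  unfolding bounded_map_def
proof (intro ballI conjI)
  fix u assume u: "u \<in> carr (modulo_constants X)"
  then show "id u \<in> carr Z" using bounded_mapD(1)[OF assms(1)] by (auto simp: carr_modulo)
  show "nnorm Z (id u) \<le> C * nnorm (modulo_constants X) u"
    using u assms(2) by (rule modulo_norm_ge) (use bounded_mapD(2)[OF assms(1)] in auto)
qed

lemma bounded_map_comp:
  assumes "bounded_map C X Y T" "bounded_map D Y Z S" "0 \<le> D"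
  shows "bounded_map (D * C) X Z (S \<circ> T)"
  unfolding bounded_map_def
proof (intro ballI conjI)
  fix f assume f: "f \<in> carr X"
  note T = bounded_mapD[OF assms(1) f]
  note S = bounded_mapD[OF assms(2) T(1)]
  show "(S \<circ> T) f \<in> carr Z" using S by simp
  have "D * nnorm Y (T f) \<le> D * (C * nnorm X f)" using T assms(3) by (intro mult_left_mono)
  then show "nnorm Z ((S \<circ> T) f) \<le> D * C * nnorm X f" using S(2) by (simp add: mult.assoc)
qed

lemma bounded_map_weaken:
  assumes "bounded_map C X Y T" "C \<le> D" "nonneg_norm X"
  shows "bounded_map D X Y T"
  unfolding bounded_map_def
proof (intro ballI conjI)
  fix f assume f: "f \<in> carr X"
  show "T f \<in> carr Y" using bounded_mapD[OF assms(1) f] by simp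
  have "C * nnorm X f \<le> D * nnorm X f"
    using assms(2) nonneg_normD[OF assms(3) f] by (rule mult_right_mono)
  then show "nnorm Y (T f) \<le> D * nnorm X f" using bounded_mapD(2)[OF assms(1) f] by linarith
qed

lemma equal_spacesI:
  assumes "bounded_map C X Y id" "bounded_map D Y X id" "nonneg_norm X" "nonneg_norm Y"
  shows "X \<doteq> Y"
proof -
  \<comment> \<open>\<open>C\<close> and \<open>D\<close> may be negative or zero, while
    \<open>equal_spaces\<close> asks for one positive constant.\<close>
  define K where "K = max 1 (max C D)"
  have K: "bounded_map K X Y id" "bounded_map K Y X id"
    using assms bounded_map_weaken by (auto simp: K_def intro: bounded_map_weaken)
  have "carr X = carr Y" using bounded_mapD(1)[OF assms(1)] bounded_mapD(1)[OF assms(2)] by auto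
  moreover have "K > 0" by (simp add: K_def)
  ultimately show ?thesis
    unfolding equal_spaces_def using bounded_mapD(2)[OF K(1)] bounded_mapD(2)[OF K(2)] by auto
qed

lemma nonneg_norm_interpolation:
  assumes "nonneg_norm A0"
  shows "nonneg_norm (complex_interpolation A0 A1 \<theta>)"
  unfolding nonneg_norm_def
  using interpolation_norm_ge[of _ A0 A1 \<theta> 1 0] calderon_norm_nonneg[OF _ assms] by auto

section \<open>Atoms and mean oscillation\<close>

locale oscillation_space = weight m for m :: "'v \<Rightarrow> real" +
  fixes E :: "'v \<Rightarrow> 'v \<Rightarrow> bool" and \<gamma> :: "nat \<Rightarrow> 'v" and \<beta> :: real
  assumes admissible: "R \<in> admissible E \<gamma> \<beta> \<Longrightarrow> finite R \<and> R \<noteq> {}"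
begin

abbreviation "\<A> \<equiv> admissible E \<gamma> \<beta>"
abbreviation "\<B> \<equiv> BMO E \<gamma> m \<beta>"
abbreviation "\<H> \<equiv> H1 E \<gamma> m \<beta>"

lemma admissible_mass: "R \<in> \<A> \<Longrightarrow> 0 < sum m R"
  using admissible mass_pos by (intro sum_pos) auto

lemma oscillation_eq:
  assumes "R \<in> \<A>"
  shows "oscillation m R f = (\<Sum>x\<in>R. m x * norm (f x - average m R f)) / sum m R"
  using admissible[OF assms] by (simp add: oscillation_def set_integral_vmeasure measure_vmeasure)

lemma average_eq:
  assumes "R \<in> \<A>"
  shows "average m R f = (\<Sum>x\<in>R. m x *\<^sub>R f x) /\<^sub>R sum m R"
  using admissible[OF assms]
  by (simp add: average_def set_integral_vmeasure measure_vmeasure divide_inverse)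

lemma oscillation_nonneg: "R \<in> \<A> \<Longrightarrow> 0 \<le> oscillation m R f"
  by (simp add: oscillation_eq sum_nonneg)

lemma BMO_ge:
  assumes "f \<in> carr \<B>" "R \<in> \<A>"
  shows "oscillation m R f \<le> nnorm \<B> f"
  using assms unfolding BMO_def by (auto intro: cSUP_upper)

lemma nonneg_norm_BMO: "nonneg_norm \<B>"
proof -
  have "{undefined} \<in> \<A>" by (auto simp: admissible_def)
  then show ?thesis unfolding nonneg_norm_def using BMO_ge oscillation_nonneg order_trans by blast
qed

text \<open>Since \<open>u\<close> has integral zero, the average of \<open>f\<close> may be
  subtracted. This is the half of the H^1-BMO duality that pairs BMO with a multiple of a single
  atom.\<close>

lemma BMO_pairing:
  assumes f: "f \<in> carr \<B>" and R: "R \<in> \<A>"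
    and u: "\<And>x. norm (u x) \<le> U" "(\<Sum>x\<in>R. m x *\<^sub>R u x) = 0" and "0 \<le> U"
  shows "norm (\<Sum>x\<in>R. m x *\<^sub>R (u x * f x)) \<le> U * sum m R * nnorm \<B> f"
proof -
  let ?a = "average m R f"
  have "(\<Sum>x\<in>R. m x *\<^sub>R (u x * f x)) = (\<Sum>x\<in>R. m x *\<^sub>R (u x * (f x - ?a))) + (\<Sum>x\<in>R. m x *\<^sub>R u x) * ?a"
    unfolding sum_distrib_right sum.distrib[symmetric]
    by (intro sum.cong) (auto simp: algebra_simps)
  then have "norm (\<Sum>x\<in>R. m x *\<^sub>R (u x * f x)) \<le> (\<Sum>x\<in>R. norm (m x *\<^sub>R (u x * (f x - ?a))))"
    by (simp only: u(2) mult_zero_left add_0_right norm_sum)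
  also have "\<dots> \<le> (\<Sum>x\<in>R. U * (m x * norm (f x - ?a)))"
  proof (rule sum_mono)
    fix x
    have "norm (u x) * (m x * norm (f x - ?a)) \<le> U * (m x * norm (f x - ?a))"
      by (intro mult_right_mono u(1)) auto
    then show "norm (m x *\<^sub>R (u x * (f x - ?a))) \<le> U * (m x * norm (f x - ?a))"
      by (simp add: norm_mult mult.left_commute)
  qed
  also have "\<dots> = U * sum m R * oscillation m R f"
    using admissible_mass[OF R] by (simp add: oscillation_eq[OF R] flip: sum_distrib_left)
  also have "\<dots> \<le> U * sum m R * nnorm \<B> f"
    using BMO_ge[OF f R] admissible_mass[OF R] \<open>0 \<le> U\<close> by (intro mult_left_mono) auto
  finally show ?thesis .
qed

text \<open>A bound for the function is a bound for its averages, whence the factor 2.\<close>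

lemma bounded_map_Linf_BMO: "bounded_map 2 Linf \<B> id"
  unfolding bounded_map_def
proof (intro ballI)
  fix f :: "'v \<Rightarrow> complex" assume f: "f \<in> carr Linf"
  define K where "K = nnorm Linf f"
  have osc: "oscillation m R f \<le> 2 * K" if R: "R \<in> \<A>" for R
  proof -
    note M = admissible_mass[OF R]
    have fK: "norm (f x) \<le> K" for x unfolding K_def using f by (rule Linf_norm_ge)
    have "norm (\<Sum>x\<in>R. m x *\<^sub>R f x) \<le> (\<Sum>x\<in>R. m x * K)"
      using fK by (intro order_trans[OF norm_sum] sum_mono) (simp add: mult_left_mono)
    also have "\<dots> = K * sum m R" by (simp add: sum_distrib_left mult.commute)
    finally have "norm (average m R f) \<le> K"
      using M by (simp add: average_eq[OF R] divide_inverse[symmetric] pos_divide_le_eq mult.commute[of "inverse _"])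
    then have "norm (f x - average m R f) \<le> 2 * K" for x
      using fK[of x] norm_triangle_ineq4[of "f x" "average m R f"] by linarith
    then have "(\<Sum>x\<in>R. m x * norm (f x - average m R f)) \<le> (\<Sum>x\<in>R. m x * (2 * K))"
      by (intro sum_mono mult_left_mono) auto
    also have "\<dots> = 2 * K * sum m R" by (simp add: sum_distrib_left sum_distrib_right mult_ac)
    finally show ?thesis using M by (simp add: oscillation_eq[OF R] pos_divide_le_eq)
  qed
  have "\<A> \<noteq> {}" by (auto simp: admissible_def)
  then show "id f \<in> carr \<B> \<and> nnorm \<B> (id f) \<le> 2 * nnorm Linf f"
    using osc by (auto simp: BMO_def K_def bdd_above_def intro!: cSUP_least)
qed

lemma atom_iff:
  "atom E \<gamma> m \<beta> a \<longleftrightarrow> (\<exists>R\<in>\<A>. (\<forall>x. x \<notin> R \<longrightarrow> a x = 0) \<and>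
    (\<forall>x. norm (a x) \<le> 1 / sum m R) \<and> (\<Sum>x\<in>R. m x *\<^sub>R a x) = 0)"
  unfolding atom_def using admissible by (auto simp: measure_vmeasure set_integral_vmeasure)

lemma atom_zero: "atom E \<gamma> m \<beta> (\<lambda>x. 0)"
proof -
  have "{undefined} \<in> \<A>" by (auto simp: admissible_def)
  then show ?thesis unfolding atom_iff by (rule bexI[rotated]) auto
qed

lemma atom_sum_le:
  assumes "atom E \<gamma> m \<beta> a" "finite S"
  shows "(\<Sum>x\<in>S. m x * norm (a x)) \<le> 1"
proof -
  obtain R where R: "R \<in> \<A>" "\<And>x. x \<notin> R \<Longrightarrow> a x = 0" "\<And>x. norm (a x) \<le> 1 / sum m R"
    using assms(1) unfolding atom_iff by blast
  have "(\<Sum>x\<in>S. m x * norm (a x)) = (\<Sum>x\<in>S \<inter> R. m x * norm (a x))"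
    using assms(2) R(2) by (intro sum.mono_neutral_right) auto
  also have "\<dots> \<le> (\<Sum>x\<in>R. m x * norm (a x))"
    using admissible[OF R(1)] by (intro sum_mono2) auto
  also have "\<dots> \<le> (\<Sum>x\<in>R. m x * (1 / sum m R))"
    using R(3) by (intro sum_mono mult_left_mono) auto
  also have "\<dots> = 1" using admissible_mass[OF R(1)] by (simp flip: sum_divide_distrib)
  finally show ?thesis .
qed

lemma atoms_sum_le:
  assumes "\<And>j. atom E \<gamma> m \<beta> (a j)" "finite S"
  shows "(\<Sum>x\<in>S. m x * norm (\<Sum>j\<in>J. c j * a j x)) \<le> (\<Sum>j\<in>J. norm (c j))"
proof -
  have "(\<Sum>x\<in>S. m x * norm (\<Sum>j\<in>J. c j * a j x)) \<le> (\<Sum>x\<in>S. m x * (\<Sum>j\<in>J. norm (c j) * norm (a j x)))"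
    by (intro sum_mono mult_left_mono order_trans[OF norm_sum]) (auto simp: norm_mult)
  also have "\<dots> = (\<Sum>j\<in>J. norm (c j) * (\<Sum>x\<in>S. m x * norm (a j x)))"
    by (simp add: sum_distrib_left mult.left_commute) (rule sum.swap)
  also have "\<dots> \<le> (\<Sum>j\<in>J. norm (c j) * 1)"
    using atom_sum_le[OF assms] by (intro sum_mono mult_left_mono) auto
  finally show ?thesis by simp
qed

lemma carr_H1_iff: "g \<in> carr \<H> \<longleftrightarrow>
    g \<in> carr (Lp m 1) \<and> (\<exists>c a. atomic_decomposition E \<gamma> m \<beta> c a g)"
  by (simp add: H1_def)

lemma H1_norm_le:
  assumes "atomic_decomposition E \<gamma> m \<beta> c a g"
  shows "nnorm \<H> g \<le> (\<Sum>j. norm (c j))"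
  unfolding H1_def nspace.sel
proof (rule cInf_lower)
  show "bdd_below {\<Sum>j. norm (c j) |c a. atomic_decomposition E \<gamma> m \<beta> c a g}"
    by (rule bdd_belowI[of _ 0]) (auto simp: atomic_decomposition_def intro!: suminf_nonneg)
qed (use assms in auto)

lemma nonneg_norm_H1: "nonneg_norm \<H>"
  unfolding nonneg_norm_def H1_def nspace.sel
  by (intro ballI cInf_greatest) (auto simp: atomic_decomposition_def intro!: suminf_nonneg)

lemma bounded_map_H1_L1: "bounded_map 1 \<H> (Lp m 1) id"
  unfolding bounded_map_def
proof (intro ballI conjI)
  fix g assume g: "g \<in> carr \<H>"
  then have gL: "g \<in> carr (Lp m 1)" by (simp add: carr_H1_iff)
  then show "id g \<in> carr (Lp m 1)" by simp
  have "nnorm (Lp m 1) g \<le> nnorm \<H> g"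
    unfolding H1_def nspace.sel
  proof (rule cInf_greatest)
    show "{\<Sum>j. norm (c j) |c a. atomic_decomposition E \<gamma> m \<beta> c a g} \<noteq> {}"
      using g by (auto simp: carr_H1_iff)
    fix s assume "s \<in> {\<Sum>j. norm (c j) |c a. atomic_decomposition E \<gamma> m \<beta> c a g}"
    then obtain c a where s: "s = (\<Sum>j. norm (c j))" and a: "\<And>j. atom E \<gamma> m \<beta> (a j)"
      and c: "summable (\<lambda>j. norm (c j))"
      and lim: "(\<lambda>n. nnorm (Lp m 1) (\<lambda>x. g x - (\<Sum>j<n. c j * a j x))) \<longlonglongrightarrow> 0"
      by (auto simp: atomic_decomposition_def)
    have s0: "0 \<le> s" unfolding s using c by (intro suminf_nonneg) auto
    have part: "(\<Sum>j<n. norm (c j)) \<le> s" for n unfolding s using c by (intro sum_le_suminf) auto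
    have "(\<Sum>x\<in>S. m x * norm (g x)) \<le> s" if S: "finite S" for S
    proof -
      have "(\<Sum>x\<in>S. m x * norm (g x)) \<le> nnorm (Lp m 1) (\<lambda>x. g x - (\<Sum>j<n. c j * a j x)) + s" for n
      proof -
        let ?h = "\<lambda>x. g x - (\<Sum>j<n. c j * a j x)"
        \<comment> \<open>The remainder must lie in L^1 before its norm, which tends to 0, controls
          finite sums: off the carrier \<open>nnorm\<close> carries no information.\<close>
        have "(\<Sum>x\<in>T. m x * norm (?h x)) \<le> nnorm (Lp m 1) g + s" if T: "finite T" for T
        proof -
          have "(\<Sum>x\<in>T. m x * norm (?h x)) \<le>
              (\<Sum>x\<in>T. m x * norm (g x)) + (\<Sum>x\<in>T. m x * norm (\<Sum>j<n. c j * a j x))"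
            unfolding sum.distrib[symmetric] distrib_left[symmetric]
            by (intro sum_mono mult_left_mono norm_triangle_ineq4) auto
          also have "\<dots> \<le> nnorm (Lp m 1) g + s"
            using L1_sum_le[OF gL T] atoms_sum_le[where a = a and J = "{..<n}" and c = c, OF a T] part[of n]
            by (intro add_mono) auto
          finally show ?thesis .
        qed
        then have hL: "?h \<in> carr (Lp m 1)"
          using s0 nonneg_normD[OF nonneg_norm_Lp gL] by (intro L1I(1)[of "nnorm (Lp m 1) g + s"]) auto
        have "(\<Sum>x\<in>S. m x * norm (g x)) \<le>
            (\<Sum>x\<in>S. m x * norm (?h x)) + (\<Sum>x\<in>S. m x * norm (\<Sum>j<n. c j * a j x))"
          unfolding sum.distrib[symmetric] distrib_left[symmetric]
        proof (intro sum_mono mult_left_mono)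
          fix x show "norm (g x) \<le> norm (?h x) + norm (\<Sum>j<n. c j * a j x)"
            using norm_triangle_ineq[of "?h x" "\<Sum>j<n. c j * a j x"] by simp
        qed auto
        then show ?thesis
          using L1_sum_le[OF hL S] atoms_sum_le[where a = a and J = "{..<n}" and c = c, OF a S] part[of n] by linarith
      qed
      then show ?thesis
        using tendsto_add[OF lim tendsto_const[of s]]
        by (intro tendsto_lowerbound[of "\<lambda>n. nnorm (Lp m 1) (\<lambda>x. g x - (\<Sum>j<n. c j * a j x)) + s" s sequentially])
          auto
    qed
    then show "nnorm (Lp m 1) g \<le> s" using s0 by (intro L1I)
  qed
  then show "nnorm (Lp m 1) (id g) \<le> 1 * nnorm \<H> g" by simp
qed

text \<open>Pointwise convergence suffices. Passing to the limit in finite sums of atoms bounds the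
  remainder by the tail of the series of \<open>norm (c j)\<close> on every finite set, and so the
  series converges in L^1.\<close>

lemma H1_sums:
  assumes a: "\<And>j. atom E \<gamma> m \<beta> (a j)" and c: "summable (\<lambda>j. norm (c j))"
    and g: "\<And>x. (\<lambda>j. c j * a j x) sums g x" and K: "(\<Sum>j. norm (c j)) \<le> K"
  shows "g \<in> carr \<H>" "nnorm \<H> g \<le> K"
proof -
  define \<tau> where "\<tau> n = (\<Sum>j. norm (c j)) - (\<Sum>j<n. norm (c j))" for n
  have \<tau>0: "0 \<le> \<tau> n" for n unfolding \<tau>_def using c by (simp add: sum_le_suminf)
  have tail: "(\<Sum>x\<in>S. m x * norm (g x - (\<Sum>j<n. c j * a j x))) \<le> \<tau> n" if S: "finite S" for S n
  proof (rule tendsto_upperbound)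
    have "(\<lambda>N. \<Sum>j<N. c j * a j x) \<longlonglongrightarrow> g x" for x using g by (simp add: sums_def)
    then show "(\<lambda>N. \<Sum>x\<in>S. m x * norm ((\<Sum>j<N. c j * a j x) - (\<Sum>j<n. c j * a j x)))
        \<longlonglongrightarrow> (\<Sum>x\<in>S. m x * norm (g x - (\<Sum>j<n. c j * a j x)))"
      by (intro tendsto_intros)
    show "\<forall>\<^sub>F N in sequentially. (\<Sum>x\<in>S. m x * norm ((\<Sum>j<N. c j * a j x) - (\<Sum>j<n. c j * a j x))) \<le> \<tau> n"
    proof (rule eventually_sequentiallyI)
      fix N assume "n \<le> N"
      then have split: "(\<Sum>j<N. h j) - (\<Sum>j<n. h j) = sum h {n..<N}" for h :: "nat \<Rightarrow> 'c::ab_group_add"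
        by (simp add: sum_diff_nat_ivl[of 0 n N, symmetric] atLeast0LessThan)
      have "(\<Sum>x\<in>S. m x * norm ((\<Sum>j<N. c j * a j x) - (\<Sum>j<n. c j * a j x))) \<le> (\<Sum>j=n..<N. norm (c j))"
        unfolding split by (rule atoms_sum_le[where a = a, OF a S])
      also have "\<dots> = (\<Sum>j<N. norm (c j)) - (\<Sum>j<n. norm (c j))" by (simp add: split)
      also have "\<dots> \<le> \<tau> n" unfolding \<tau>_def using c by (simp add: sum_le_suminf)
      finally show "(\<Sum>x\<in>S. m x * norm ((\<Sum>j<N. c j * a j x) - (\<Sum>j<n. c j * a j x))) \<le> \<tau> n" .
    qed
  qed auto
  have "\<tau> \<longlonglongrightarrow> (\<Sum>j. norm (c j)) - (\<Sum>j. norm (c j))"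
    unfolding \<tau>_def using summable_LIMSEQ[OF c] by (intro tendsto_intros)
  then have \<tau>: "\<tau> \<longlonglongrightarrow> 0" by simp
  have L: "(\<lambda>x. g x - (\<Sum>j<n. c j * a j x)) \<in> carr (Lp m 1)"
    "nnorm (Lp m 1) (\<lambda>x. g x - (\<Sum>j<n. c j * a j x)) \<le> \<tau> n" for n
    using L1I[OF \<tau>0 tail] by auto
  have "(\<lambda>n. nnorm (Lp m 1) (\<lambda>x. g x - (\<Sum>j<n. c j * a j x))) \<longlonglongrightarrow> 0"
    by (rule tendsto_sandwich[OF _ _ tendsto_const \<tau>])
      (use L(2) nonneg_normD[OF nonneg_norm_Lp L(1)] in auto)
  then have dec: "atomic_decomposition E \<gamma> m \<beta> c a g"
    using a c by (simp add: atomic_decomposition_def)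
  then show "g \<in> carr \<H>" using L(1)[of 0] by (auto simp: carr_H1_iff)
  show "nnorm \<H> g \<le> K" using H1_norm_le[OF dec] K by linarith
qed

text \<open>In the application a pair consists of a stage of a telescoping series and a place in the
  decomposition of that stage. Zero coefficients and the zero atom fill the pairs outside
  \<open>J\<close>, so that \<open>prod_decode\<close> turns the family into a sequence.\<close>

lemma H1_family:
  fixes w :: "nat \<times> nat \<Rightarrow> complex"
  assumes v: "\<And>p. p \<in> J \<Longrightarrow> R p \<in> \<A>" "\<And>p x. p \<in> J \<Longrightarrow> x \<notin> R p \<Longrightarrow> v p x = 0"
      "\<And>p x. p \<in> J \<Longrightarrow> norm (v p x) \<le> C" "\<And>p. p \<in> J \<Longrightarrow> (\<Sum>x\<in>R p. m x *\<^sub>R v p x) = 0"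
    and C: "0 < C"
    and K: "\<And>P. finite P \<Longrightarrow> P \<subseteq> J \<Longrightarrow> (\<Sum>p\<in>P. norm (w p) * sum m (R p)) \<le> K"
  shows "(\<lambda>x. \<Sum>\<^sub>\<infinity>p\<in>J. w p * v p x) \<in> carr \<H>"
    and "nnorm \<H> (\<lambda>x. \<Sum>\<^sub>\<infinity>p\<in>J. w p * v p x) \<le> C * K"
    and "(\<lambda>p. w p * v p x) summable_on J"
proof -
  \<comment> \<open>Dividing \<open>v p\<close> by \<open>C * sum m (R p)\<close> makes it an
    atom.\<close>
  define k where "k p = C * sum m (R p)" for p
  define c where "c p = (if p \<in> J then w p * of_real (k p) else 0)" for p
  define a where "a p = (if p \<in> J then (\<lambda>x. v p x / of_real (k p)) else (\<lambda>x. 0))" for p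
  have k: "0 < k p" if "p \<in> J" for p using admissible_mass[OF v(1)[OF that]] C by (simp add: k_def)
  have atom: "atom E \<gamma> m \<beta> (a p)" for p
  proof (cases "p \<in> J")
    case True
    have "norm (a p x) \<le> 1 / sum m (R p)" for x
    proof -
      have "norm (a p x) = norm (v p x) / k p" using k[OF True] True by (simp add: a_def norm_divide)
      also have "\<dots> \<le> C / k p" using v(3)[OF True] k[OF True] by (intro divide_right_mono) auto
      finally show ?thesis using C by (simp add: k_def)
    qed
    moreover have "(\<Sum>x\<in>R p. m x *\<^sub>R a p x) = (\<Sum>x\<in>R p. m x *\<^sub>R v p x) / of_real (k p)"
      using True by (simp add: a_def sum_divide_distrib scaleR_conv_of_real)
    ultimately show ?thesis
      unfolding atom_iff using True v by (intro bexI[of _ "R p"]) (auto simp: a_def)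
  next
    case False
    then show ?thesis using atom_zero by (simp add: a_def)
  qed
  have ca: "c p * a p x = (if p \<in> J then w p * v p x else 0)" for p x
    using k[of p] by (auto simp: c_def a_def)
  have cle: "(\<Sum>p\<in>P. norm (c p)) \<le> C * K" if P: "finite P" for P
  proof -
    have "(\<Sum>p\<in>P. norm (c p)) = (\<Sum>p\<in>P \<inter> J. norm (c p))"
      using P by (intro sum.mono_neutral_right) (auto simp: c_def)
    also have "\<dots> = (\<Sum>p\<in>P \<inter> J. C * (norm (w p) * sum m (R p)))"
    proof (intro sum.cong refl)
      fix p assume "p \<in> P \<inter> J"
      then have "norm (c p) = norm (w p) * k p" using k[of p] by (simp add: c_def norm_mult)
      then show "norm (c p) = C * (norm (w p) * sum m (R p))" by (simp add: k_def)
    qed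
    also have "\<dots> = C * (\<Sum>p\<in>P \<inter> J. norm (w p) * sum m (R p))" by (rule sum_distrib_left[symmetric])
    also have "\<dots> \<le> C * K" using K[of "P \<inter> J"] P C by simp
    finally show ?thesis .
  qed
  have c_sum: "(\<lambda>p. norm (c p)) summable_on UNIV"
    using cle by (intro nonneg_bdd_above_summable_on) (auto simp: bdd_above_def)
  \<comment> \<open>The L^1 bound for atoms, tested on one vertex, gives pointwise absolute
    convergence of the series.\<close>
  have anorm: "norm (a p x) \<le> 1 / m x" for p x
    using atom_sum_le[OF atom, of "{x}"] mass_pos[of x] by (simp add: field_simps)
  have ca_sum: "(\<lambda>p. c p * a p x) summable_on UNIV" for x
  proof (rule abs_summable_summable, rule Infinite_Sum.abs_summable_on_comparison_test')
    show "(\<lambda>p. norm (c p) * (1 / m x)) summable_on UNIV"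
      by (rule summable_on_cmult_left[OF c_sum])
    show "norm (c p * a p x) \<le> norm (c p) * (1 / m x)" for p
      unfolding norm_mult by (intro mult_left_mono anorm) auto
  qed
  define g where "g x = (\<Sum>\<^sub>\<infinity>p\<in>J. w p * v p x)" for x
  have eq: "((\<lambda>p. c p * a p x) has_sum s) UNIV \<longleftrightarrow> ((\<lambda>p. w p * v p x) has_sum s) J" for s x
    by (rule has_sum_cong_neutral) (auto simp: ca)
  show "(\<lambda>p. w p * v p x) summable_on J" for x
    using ca_sum[of x] eq by (auto simp: summable_on_def)
  then have "((\<lambda>p. c p * a p x) has_sum g x) UNIV" for x
    unfolding eq g_def by (rule has_sum_infsum)
  then have "((\<lambda>j. c (prod_decode j) * a (prod_decode j) x) has_sum g x) UNIV" for x
    using has_sum_reindex_bij_betw[OF bij_prod_decode, of "\<lambda>p. c p * a p x"] by simp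
  then have sums: "(\<lambda>j. c (prod_decode j) * a (prod_decode j) x) sums g x" for x
    by (rule has_sum_imp_sums)
  have sumc: "summable (\<lambda>j. norm (c (prod_decode j)))"
    using summable_on_reindex_bij_betw[OF bij_prod_decode, of "\<lambda>p. norm (c p)"] c_sum
    by (simp add: summable_on_UNIV_nonneg_real_iff)
  have "(\<Sum>j<n. norm (c (prod_decode j))) \<le> C * K" for n
  proof -
    have "(\<Sum>j<n. norm (c (prod_decode j))) = (\<Sum>p\<in>prod_decode ` {..<n}. norm (c p))"
      by (subst sum.reindex[OF inj_prod_decode]) simp
    then show ?thesis using cle by simp
  qed
  then have "(\<Sum>j. norm (c (prod_decode j))) \<le> C * K" by (intro suminf_le_const[OF sumc])
  from H1_sums[OF atom sumc sums this]
  show "(\<lambda>x. \<Sum>\<^sub>\<infinity>p\<in>J. w p * v p x) \<in> carr \<H>"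
    "nnorm \<H> (\<lambda>x. \<Sum>\<^sub>\<infinity>p\<in>J. w p * v p x) \<le> C * K"
    by (simp_all add: g_def[abs_def])
qed

lemma Linf_family:
  fixes w :: "'i \<Rightarrow> complex"
  assumes K: "\<And>P x. finite P \<Longrightarrow> P \<subseteq> J \<Longrightarrow> (\<Sum>p\<in>P. norm (w p) * norm (v p x)) \<le> K"
  shows "(\<lambda>x. \<Sum>\<^sub>\<infinity>p\<in>J. w p * v p x) \<in> carr Linf"
    and "nnorm Linf (\<lambda>x. \<Sum>\<^sub>\<infinity>p\<in>J. w p * v p x) \<le> K"
    and "(\<lambda>p. w p * v p x) summable_on J"
proof -
  have s: "(\<lambda>p. norm (w p * v p x)) summable_on J" for x
    using K by (intro nonneg_bdd_above_summable_on) (auto simp: bdd_above_def norm_mult)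
  then show "(\<lambda>p. w p * v p x) summable_on J" for x by (rule abs_summable_summable)
  have "norm (\<Sum>\<^sub>\<infinity>p\<in>J. w p * v p x) \<le> K" for x
  proof -
    have "norm (\<Sum>\<^sub>\<infinity>p\<in>J. w p * v p x) \<le> (\<Sum>\<^sub>\<infinity>p\<in>J. norm (w p * v p x))"
      using s by (rule norm_infsum_bound)
    also have "\<dots> \<le> K" using s K by (intro infsum_le_finite_sums) (auto simp: norm_mult)
    finally show ?thesis .
  qed
  then show "(\<lambda>x. \<Sum>\<^sub>\<infinity>p\<in>J. w p * v p x) \<in> carr Linf"
    and "nnorm Linf (\<lambda>x. \<Sum>\<^sub>\<infinity>p\<in>J. w p * v p x) \<le> K"
    using LinfI[of "\<lambda>x. \<Sum>\<^sub>\<infinity>p\<in>J. w p * v p x" K] by auto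
qed

end

section \<open>Analytic families of atoms and the upper inclusion\<close>

locale bmo_tree = flow_tree E \<gamma> m for E :: "'v \<Rightarrow> 'v \<Rightarrow> bool" and \<gamma> :: "nat \<Rightarrow> 'v" and m :: "'v \<Rightarrow> real" +
  fixes \<beta> :: real
  assumes \<beta>: "12 \<le> \<beta>"

sublocale bmo_tree \<subseteq> oscillation_space m E \<gamma> \<beta>
  by unfold_locales (use m_pos admissible_finite_nonempty in auto)

context bmo_tree
begin

text \<open>The support is placed in a larger set that splits. The constant depends on
  \<open>K\<close> and \<open>q\<close> and is the same for all supports.\<close>

lemma atomic_splitting:
  assumes "1 < q"
  obtains C where "0 < C"
    "\<And>f S \<delta>. finite S \<Longrightarrow> (\<And>x. x \<notin> S \<Longrightarrow> f x = 0) \<Longrightarrow> (\<Sum>x\<in>S. m x *\<^sub>R f x) = 0 \<Longrightarrow> 0 < \<delta> \<Longrightarrow>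
      (\<Sum>x\<in>S. m x * norm (f x) powr q) \<le> \<delta> powr q \<Longrightarrow>
      \<exists>n l R v. atomic_sum m \<A> q C \<delta> f n l R v"
proof -
  obtain K where K1: "K \<ge> 1" and exhaust:
    "\<And>S. finite S \<Longrightarrow> \<exists>Q. S \<subseteq> Q \<and> splits m K \<A> Q"
    using splits_exhaust[OF \<beta>] by blast
  interpret splitting m K "\<A>"
    by unfold_locales (rule K1)
  show ?thesis
  proof (rule splits_decomposition[OF assms], rule that)
    fix C and f :: "'v \<Rightarrow> complex" and S and \<delta> :: real
    assume dec: "\<And>Q f \<delta>. splits m K \<A> Q \<Longrightarrow> (\<And>x. x \<notin> Q \<Longrightarrow> f x = 0) \<Longrightarrow>
        (\<Sum>x\<in>Q. m x *\<^sub>R f x) = 0 \<Longrightarrow> 0 < \<delta> \<Longrightarrow> (\<Sum>x\<in>Q. m x * norm (f x) powr q) \<le> \<delta> powr q \<Longrightarrow>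
        \<exists>n l R v. atomic_sum m \<A> q C \<delta> f n l R v"
      and S: "finite S" and f: "\<And>x. x \<notin> S \<Longrightarrow> f x = 0" "(\<Sum>x\<in>S. m x *\<^sub>R f x) = 0"
      and \<delta>: "0 < \<delta>" "(\<Sum>x\<in>S. m x * norm (f x) powr q) \<le> \<delta> powr q"
    obtain Q where Q: "S \<subseteq> Q" "splits m K \<A> Q" using exhaust[OF S] by blast
    have supp: "sum h Q = sum h S" if "\<And>x. x \<notin> S \<Longrightarrow> h x = 0" for h :: "'v \<Rightarrow> 'c::comm_monoid_add"
      using splits_finite[OF Q(2)] Q(1) that by (intro sum.mono_neutral_right) auto
    have "(\<Sum>x\<in>Q. m x *\<^sub>R f x) = (\<Sum>x\<in>S. m x *\<^sub>R f x)"
      "(\<Sum>x\<in>Q. m x * norm (f x) powr q) = (\<Sum>x\<in>S. m x * norm (f x) powr q)"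
      by (intro supp, simp add: f(1))+
    then show "\<exists>n l R v. atomic_sum m \<A> q C \<delta> f n l R v"
      using Q(1) f \<delta> by (intro dec[OF Q(2)]) auto
  qed
qed

text \<open>Truncation to a finite set \<open>S\<close> leaves an integral \<open>I\<close>.
  Subtracting the constant \<open>I / M\<close> on a set of mass \<open>M\<close> removes it at the
  cost \<open>\<bar>I\<bar>^q * M^(1 - q)\<close> in the q-th power of the norm, which is small for
  large \<open>M\<close> because \<open>q > 1\<close>.\<close>

lemma Lp_approximation:
  assumes q: "1 < q" and f: "f \<in> carr (Lp m q)" and "0 < e"
  obtains g S where "finite S" "\<And>x. x \<notin> S \<Longrightarrow> g x = 0" "(\<Sum>x\<in>S. m x *\<^sub>R g x) = 0"
    "\<And>P. finite P \<Longrightarrow> (\<Sum>x\<in>P. m x * norm (f x - g x) powr q) \<le> e powr q"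
proof -
  \<comment> \<open>There are two errors, the tail of \<open>f\<close> and the correction, and
    \<open>norm_powr_le\<close> multiplies the sum of their q-th powers by
    \<open>2 powr q\<close>.\<close>
  define d where "d = e powr q / (2 * 2 powr q)"
  have d: "0 < d" using \<open>0 < e\<close> by (simp add: d_def)
  obtain S where S: "finite S"
    "\<And>T. finite T \<Longrightarrow> T \<inter> S = {} \<Longrightarrow> (\<Sum>x\<in>T. m x * norm (f x) powr q) \<le> d"
    using Lp_tail[OF f _ d] q by auto
  define I where "I = (\<Sum>x\<in>S. m x *\<^sub>R f x)"
  \<comment> \<open>Large enough for \<open>norm I powr q / d \<le> M powr (q - 1)\<close>; the
    summand 1 keeps \<open>M\<close> positive when \<open>I = 0\<close>.\<close>
  obtain T where T: "finite T" "1 + (norm I powr q / d) powr (1 / (q - 1)) < sum m T"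
    using infinite_mass by blast
  define M where "M = sum m T"
  have M: "1 < M" "(norm I powr q / d) powr (1 / (q - 1)) \<le> M"
    using T(2) powr_ge_zero[of "norm I powr q / d" "1 / (q - 1)"] unfolding M_def by linarith+
  define c where "c = I /\<^sub>R M"
  define g where "g x = (if x \<in> S then f x else 0) - (if x \<in> T then c else 0)" for x
  have small: "norm c powr q * M \<le> d"
  proof -
    have "norm I powr q / d = ((norm I powr q / d) powr (1 / (q - 1))) powr (q - 1)"
      using q d by (simp add: powr_powr)
    also have "\<dots> \<le> M powr (q - 1)" using M q by (intro powr_mono2) auto
    finally have "norm I powr q \<le> d * M powr (q - 1)" using d by (simp add: field_simps)
    moreover have "norm c powr q * M = norm I powr q / M powr (q - 1)"
      using M(1) by (simp add: c_def norm_divide powr_divide powr_diff divide_inverse[symmetric] field_simps)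
    moreover have "0 < M powr (q - 1)" using M(1) by simp
    ultimately show ?thesis by (simp add: pos_divide_le_eq)
  qed
  show ?thesis
  proof (rule that[of "S \<union> T" g])
    show "finite (S \<union> T)" using S T by simp
    show "g x = 0" if "x \<notin> S \<union> T" for x using that by (simp add: g_def)
    have "(\<Sum>x\<in>S \<union> T. m x *\<^sub>R (if x \<in> S then f x else 0)) = I"
      unfolding I_def using S T by (intro sum.mono_neutral_cong_right) auto
    moreover have "(\<Sum>x\<in>S \<union> T. m x *\<^sub>R (if x \<in> T then c else 0)) = (\<Sum>x\<in>T. m x *\<^sub>R c)"
      using S T by (intro sum.mono_neutral_cong_right) auto
    moreover have "(\<Sum>x\<in>T. m x *\<^sub>R c) = M *\<^sub>R c" by (simp add: M_def scaleR_sum_left)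
    then have "(\<Sum>x\<in>T. m x *\<^sub>R c) = I" using M(1) by (simp add: c_def)
    ultimately show "(\<Sum>x\<in>S \<union> T. m x *\<^sub>R g x) = 0"
      by (simp add: g_def scaleR_diff_right sum_subtractf)
    fix P :: "'v set" assume P: "finite P"
    define r where "r x = (if x \<in> S then 0 else f x)" for x
    define s where "s x = (if x \<in> T then c else 0)" for x
    have "f x - g x = r x + s x" for x by (simp add: g_def r_def s_def)
    then have "(\<Sum>x\<in>P. m x * norm (f x - g x) powr q) \<le>
        (\<Sum>x\<in>P. m x * (2 powr q * (norm (r x) powr q + norm (s x) powr q)))"
      using norm_powr_le[of q] q by (intro sum_mono mult_left_mono) auto
    also have "\<dots> = 2 powr q * ((\<Sum>x\<in>P. m x * norm (r x) powr q) + (\<Sum>x\<in>P. m x * norm (s x) powr q))"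
      by (simp add: sum_distrib_left distrib_left sum.distrib mult_ac)
    also have "\<dots> \<le> 2 powr q * (d + d)"
    proof (intro mult_left_mono add_mono)
      have "(\<Sum>x\<in>P. m x * norm (r x) powr q) = (\<Sum>x\<in>P - S. m x * norm (f x) powr q)"
        using P by (intro sum.mono_neutral_cong_right) (auto simp: r_def)
      then show "(\<Sum>x\<in>P. m x * norm (r x) powr q) \<le> d" using S(2)[of "P - S"] P by auto
      have "(\<Sum>x\<in>P. m x * norm (s x) powr q) = (\<Sum>x\<in>P \<inter> T. m x * norm c powr q)"
        using P by (intro sum.mono_neutral_cong_right) (auto simp: s_def)
      also have "\<dots> \<le> (\<Sum>x\<in>T. m x * norm c powr q)" using T by (intro sum_mono2) auto
      also have "\<dots> = norm c powr q * M" by (simp add: M_def sum_distrib_right mult.commute)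
      finally show "(\<Sum>x\<in>P. m x * norm (s x) powr q) \<le> d" using small by simp
    qed auto
    also have "\<dots> = e powr q" by (simp add: d_def)
    finally show "(\<Sum>x\<in>P. m x * norm (f x - g x) powr q) \<le> e powr q" .
  qed
qed

end

lemma geometric_tail_sum:
  assumes "finite A" "A \<subseteq> {N..}"
  shows "(\<Sum>n\<in>A. (1 / 2) ^ n) \<le> 2 * (1 / 2 :: real) ^ N"
proof -
  obtain M where M: "A \<subseteq> {..<M}" using assms(1) finite_nat_iff_bounded by blast
  have "(\<Sum>n\<in>A. (1 / 2) ^ n) \<le> (\<Sum>n\<in>{N..<N + M}. (1 / 2 :: real) ^ n)"
    using assms M by (intro sum_mono2) fastforce+
  moreover have "(\<Sum>n\<in>{N..<N + M}. (1 / 2 :: real) ^ n) + 2 * (1 / 2) ^ (N + M) = 2 * (1 / 2) ^ N"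
    by (induction M) (simp_all add: add.assoc)
  ultimately show ?thesis
    using zero_le_power[of "1 / 2 :: real" "N + M"] by linarith
qed

text \<open>Elements of \<open>dual\<close> are linear only on the carrier, and for a general
  \<open>A0\<close> the carrier of the sum need not be closed under the operations.
  \<open>Linf\<close> is closed under them, which suffices for finite sums of bounded
  functions.\<close>

lemma dual_finite_sum:
  assumes l: "l \<in> dual (sum_space A0 Linf)" and 0: "(\<lambda>x. 0) \<in> carr A0"
    and P: "finite P" "\<And>p. p \<in> P \<Longrightarrow> v p \<in> carr Linf"
  shows "(\<lambda>x. \<Sum>p\<in>P. c p * v p x) \<in> carr (sum_space A0 Linf) \<and>
    l (\<lambda>x. \<Sum>p\<in>P. c p * v p x) = (\<Sum>p\<in>P. c p * l (v p))"
proof -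
  have Linf: "f \<in> carr (sum_space A0 Linf)" if "f \<in> carr Linf" for f :: "'a \<Rightarrow> complex"
    unfolding carr_sum_space using 0 that by (intro bexI[of _ "\<lambda>x. 0"] bexI[of _ f]) auto
  have add: "l (f + g) = l f + l g" if "f \<in> carr Linf" "g \<in> carr Linf" for f g
    using l Linf[OF that(1)] Linf[OF that(2)] by (simp add: dual_def)
  have scale: "l (a *\<^sub>C f) = a * l f" if "f \<in> carr Linf" for a f
    using l Linf[OF that] by (simp add: dual_def)
  have scaled: "a *\<^sub>C f \<in> carr Linf" if "f \<in> carr Linf" for a and f :: "'a \<Rightarrow> complex"
  proof (rule LinfI(1))
    show "norm ((a *\<^sub>C f) x) \<le> norm a * nnorm Linf f" for x
      using Linf_norm_ge[OF that] by (simp add: scaleC_fun_def scaleC_complex_def norm_mult mult_left_mono)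
  qed
  have added: "f + g \<in> carr Linf" if "f \<in> carr Linf" "g \<in> carr Linf" for f g :: "'a \<Rightarrow> complex"
  proof (rule LinfI(1))
    show "norm ((f + g) x) \<le> nnorm Linf f + nnorm Linf g" for x
      using Linf_norm_ge[OF that(1), of x] Linf_norm_ge[OF that(2), of x]
      by (auto intro: norm_triangle_le)
  qed
  have "(\<lambda>x. \<Sum>p\<in>P. c p * v p x) \<in> carr Linf \<and>
      l (\<lambda>x. \<Sum>p\<in>P. c p * v p x) = (\<Sum>p\<in>P. c p * l (v p))"
    using P
  proof (induction P rule: finite_induct)
    case empty
    have "(\<lambda>x. 0) \<in> carr (Linf :: ('a \<Rightarrow> complex) nspace)" by (rule LinfI(1)[of _ 0]) simp
    moreover from this have "l (0 *\<^sub>C (\<lambda>x. 0)) = 0" by (simp add: scale)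
    ultimately show ?case by (simp add: scaleC_fun_def scaleC_complex_def)
  next
    case (insert p P)
    have eq: "(\<lambda>x. \<Sum>q\<in>insert p P. c q * v q x) = c p *\<^sub>C v p + (\<lambda>x. \<Sum>q\<in>P. c q * v q x)"
      using insert.hyps by (simp add: fun_eq_iff scaleC_fun_def scaleC_complex_def)
    show ?case
      unfolding eq using insert scaled added by (simp add: add scale)
  qed
  then show ?thesis using Linf by blast
qed

context bmo_tree
begin

lemma H1_zero: "(\<lambda>x. 0) \<in> carr \<H>"
  using H1_sums(1)[of "\<lambda>_ _. 0" "\<lambda>_. 0" "\<lambda>_. 0" 0] atom_zero by simp

text \<open>
  The telescoping series \<open>f = \<Sum> h\<^sub>n\<close> of finitely supported functions makes \<open>z \<mapsto> \<Lambda> (F z)\<close> a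
  uniform limit of exponential sums for every functional \<open>\<Lambda>\<close>; applied directly to \<open>f\<close>, the
  construction would lose continuity on the line \<open>Re z = 1\<close>.
\<close>

lemma Lp_in_interpolation_of_H1_Linf:
  assumes \<theta>: "0 < \<theta>" "\<theta> < 1" "1 / q = 1 - \<theta>"
  obtains D where "0 < D" "bounded_map D (Lp m q) (complex_interpolation \<H> Linf \<theta>) id"
proof -
  have "0 < 1 / q" "1 / q < 1" using \<theta> by auto
  then have q: "1 < q" by (simp add: divide_less_eq split: if_splits)
  have q\<theta>: "q * (1 - \<theta>) = 1" using \<theta> q by (simp add: field_simps)
  obtain C where C: "0 < C" and split:
    "\<And>(f :: 'v \<Rightarrow> complex) S \<delta>. finite S \<Longrightarrow> (\<And>x. x \<notin> S \<Longrightarrow> f x = 0) \<Longrightarrow> (\<Sum>x\<in>S. m x *\<^sub>R f x) = 0 \<Longrightarrow> 0 < \<delta> \<Longrightarrow>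
      (\<Sum>x\<in>S. m x * norm (f x) powr q) \<le> \<delta> powr q \<Longrightarrow>
      \<exists>n l R v. atomic_sum m \<A> q C \<delta> f n l R v"
    using atomic_splitting[OF q] by blast
  \<comment> \<open>\<open>L\<close> is any positive bound for the norm rather than the norm itself,
    which may be 0; at the end \<open>L\<close> is let down to the norm.\<close>
  have main: "f \<in> carr (complex_interpolation \<H> Linf \<theta>) \<and>
      nnorm (complex_interpolation \<H> Linf \<theta>) f \<le> 8 * (C + C\<^sup>2) * L"
    if f: "f \<in> carr (Lp m q)" and L: "0 < L" "nnorm (Lp m q) f \<le> L" for f L
  proof -
    \<comment> \<open>\<open>h n\<close> is a difference of two errors of norm at most
      \<open>L / 2^n\<close>. The inequality \<open>norm_powr_le\<close> costs a factor 2 and the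
      sum of two q-th powers at most another, whence 4. \<open>e N\<close> is the sum of
      \<open>\<delta> n\<close> over \<open>n \<ge> N\<close>.\<close>
    define \<delta> where "\<delta> n = 4 * L * (1 / 2) ^ n" for n :: nat
    have \<delta>: "0 < \<delta> n" for n using L by (simp add: \<delta>_def)
    define e where "e N = 8 * L * (1 / 2) ^ N" for N :: nat
    \<comment> \<open>\<open>g 0 = 0\<close> starts the telescoping at zero, and \<open>f\<close> is
      indeed within \<open>L\<close> of it.\<close>
    define approx where "approx n g S \<longleftrightarrow> finite S \<and> (\<forall>x. x \<notin> S \<longrightarrow> g x = 0) \<and> (\<Sum>x\<in>S. m x *\<^sub>R g x) = 0 \<and>
        (\<forall>P. finite P \<longrightarrow> (\<Sum>x\<in>P. m x * norm (f x - g x) powr q) \<le> (L * (1 / 2) ^ n) powr q) \<and>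
        (n = 0 \<longrightarrow> g = (\<lambda>x. 0))" for n :: nat and g S
    have "\<exists>g S. approx n g S" for n
    proof (cases "n = 0")
      case True
      then show ?thesis
        unfolding approx_def using Lp_sum_le_powr[OF f _ _ L(2)] q
        by (intro exI[of _ "\<lambda>x. 0"] exI[of _ "{}"]) auto
    next
      case False
      have "0 < L * (1 / 2) ^ n" using L by simp
      show ?thesis
        unfolding approx_def
        by (rule Lp_approximation[OF q f \<open>0 < L * (1 / 2) ^ n\<close>]) (use False in blast)
    qed
    then obtain g S where gS: "\<And>n. approx n (g n) (S n)" by metis
    have gS: "\<And>n. finite (S n)" "\<And>n x. x \<notin> S n \<Longrightarrow> g n x = 0"
      "\<And>n. (\<Sum>x\<in>S n. m x *\<^sub>R g n x) = 0"
      "\<And>n P. finite P \<Longrightarrow> (\<Sum>x\<in>P. m x * norm (f x - g n x) powr q) \<le> (L * (1 / 2) ^ n) powr q"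
      "g 0 = (\<lambda>x. 0)"
      using gS unfolding approx_def by blast+
    define h where "h n x = g (Suc n) x - g n x" for n x
    have "\<exists>k l R v. atomic_sum m \<A> q C (\<delta> n) (h n) k l R v" for n
    proof (rule split)
      let ?T = "S (Suc n) \<union> S n"
      show fin: "finite ?T" using gS by simp
      show "h n x = 0" if "x \<notin> ?T" for x using that gS(2) by (simp add: h_def)
      have "(\<Sum>x\<in>?T. m x *\<^sub>R g (Suc n) x) = (\<Sum>x\<in>S (Suc n). m x *\<^sub>R g (Suc n) x)"
        "(\<Sum>x\<in>?T. m x *\<^sub>R g n x) = (\<Sum>x\<in>S n. m x *\<^sub>R g n x)"
        using fin gS(2) by (auto intro!: sum.mono_neutral_right)
      then show "(\<Sum>x\<in>?T. m x *\<^sub>R h n x) = 0"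
        by (simp add: h_def scaleR_diff_right sum_subtractf gS(3))
      show "0 < \<delta> n" by (rule \<delta>)
      have "(\<Sum>x\<in>?T. m x * norm (h n x) powr q) \<le>
          (\<Sum>x\<in>?T. m x * (2 powr q * (norm (f x - g n x) powr q + norm (f x - g (Suc n) x) powr q)))"
        using norm_powr_le[of q "f x - g n x" "- (f x - g (Suc n) x)" for x] q
        by (intro sum_mono mult_left_mono) (auto simp: h_def norm_minus_commute)
      also have "\<dots> = 2 powr q * ((\<Sum>x\<in>?T. m x * norm (f x - g n x) powr q) +
          (\<Sum>x\<in>?T. m x * norm (f x - g (Suc n) x) powr q))"
        by (simp add: sum_distrib_left distrib_left sum.distrib mult_ac)
      also have "\<dots> \<le> 2 powr q * ((L * (1 / 2) ^ n) powr q + (L * (1 / 2) ^ Suc n) powr q)"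
        by (intro mult_left_mono add_mono gS(4)[OF fin]) auto
      also have "\<dots> \<le> 2 powr q * (2 powr q * (L * (1 / 2) ^ n) powr q)"
      proof (intro mult_left_mono)
        have "(L * (1 / 2) ^ Suc n) powr q \<le> (L * (1 / 2) ^ n) powr q"
          using L q by (intro powr_mono2) auto
        moreover have "2 \<le> 2 powr q" using q powr_mono[of 1 q 2] by simp
        then have "2 * (L * (1 / 2) ^ n) powr q \<le> 2 powr q * (L * (1 / 2) ^ n) powr q"
          by (intro mult_right_mono) auto
        ultimately show "(L * (1 / 2) ^ n) powr q + (L * (1 / 2) ^ Suc n) powr q \<le>
            2 powr q * (L * (1 / 2) ^ n) powr q" by linarith
      qed auto
      also have "\<dots> = (2 * (2 * (L * (1 / 2) ^ n))) powr q" by (simp only: powr_mult)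
      also have "2 * (2 * (L * (1 / 2) ^ n)) = \<delta> n" by (simp add: \<delta>_def)
      finally show "(\<Sum>x\<in>?T. m x * norm (h n x) powr q) \<le> \<delta> n powr q" .
    qed
    then obtain k l0 R0 v0 where at: "\<And>n. atomic_sum m \<A> q C (\<delta> n) (h n) (k n) (l0 n) (R0 n) (v0 n)"
      by metis
    have klRv: "\<And>n i. i < k n \<Longrightarrow> 0 < l0 n i \<and> R0 n i \<in> \<A> \<and>
          (\<forall>x. x \<notin> R0 n i \<longrightarrow> v0 n i x = 0) \<and> (\<Sum>x\<in>R0 n i. m x *\<^sub>R v0 n i x) = 0"
      "\<And>n x. h n x = of_real (\<delta> n) * (\<Sum>i<k n. of_real (l0 n i) * v0 n i x)"
      "\<And>n x. (\<Sum>i<k n. norm (v0 n i x)) \<le> C" "\<And>n. (\<Sum>i<k n. l0 n i powr q * sum m (R0 n i)) \<le> C"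
      using at by (simp_all add: atomic_sum_def)
    define l where "l p = l0 (fst p) (snd p)" for p
    define R where "R p = R0 (fst p) (snd p)" for p
    define v where "v p = v0 (fst p) (snd p)" for p
    \<comment> \<open>\<open>J\<close> collects the terms of all stages \<open>n\<close>, and
      \<open>JN N\<close> those of the stages from \<open>N\<close> on.\<close>
    define J where "J = Sigma UNIV (\<lambda>n. {..<k n})"
    define JN where "JN N = {p \<in> J. N \<le> fst p}" for N
    have J: "0 < l p" "R p \<in> \<A>" "x \<notin> R p \<Longrightarrow> v p x = 0" "(\<Sum>x\<in>R p. m x *\<^sub>R v p x) = 0"
      if "p \<in> J" for p x
      using klRv(1)[of "snd p" "fst p"] that by (auto simp: J_def l_def R_def v_def)
    have vC: "norm (v p x) \<le> C" if "p \<in> J" for p x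
    proof -
      have "norm (v0 (fst p) (snd p) x) \<le> (\<Sum>i<k (fst p). norm (v0 (fst p) i x))"
        using that by (intro member_le_sum) (auto simp: J_def)
      then show ?thesis using klRv(3)[of "fst p" x] by (simp add: v_def)
    qed
    \<comment> \<open>Applied to \<open>H p = l p powr q * sum m (R p)\<close> for the bound in H^1
      and to \<open>H p = norm (v p x)\<close> for the one in L^infinity.\<close>
    have weighted: "(\<Sum>p\<in>P. \<delta> (fst p) * H p) \<le> C * e N"
      if P: "finite P" "P \<subseteq> JN N" and H: "\<And>p. p \<in> J \<Longrightarrow> 0 \<le> H p" "\<And>n. (\<Sum>i<k n. H (n, i)) \<le> C" for P N H
    proof -
      have "(\<Sum>p\<in>P. \<delta> (fst p) * H p) \<le> (\<Sum>p\<in>Sigma (fst ` P) (\<lambda>n. {..<k n}). \<delta> (fst p) * H p)"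
        using P H \<delta> by (intro sum_mono2) (auto simp: JN_def J_def less_imp_le intro!: mult_nonneg_nonneg rev_image_eqI)
      also have "\<dots> = (\<Sum>n\<in>fst ` P. \<Sum>i<k n. \<delta> n * H (n, i))"
        using P sum.Sigma[of "fst ` P" "\<lambda>n. {..<k n}" "\<lambda>n i. \<delta> n * H (n, i)"]
        by (simp add: split_beta)
      also have "\<dots> = (\<Sum>n\<in>fst ` P. \<delta> n * (\<Sum>i<k n. H (n, i)))"
        by (simp add: sum_distrib_left)
      also have "\<dots> \<le> (\<Sum>n\<in>fst ` P. \<delta> n * C)"
        using H \<delta> by (intro sum_mono mult_left_mono) (auto simp: less_imp_le)
      also have "\<dots> = C * (4 * L * (\<Sum>n\<in>fst ` P. (1 / 2) ^ n))"
        by (simp add: \<delta>_def sum_distrib_left mult_ac)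
      also have "\<dots> \<le> C * (4 * L * (2 * (1 / 2) ^ N))"
        using P C L by (intro mult_left_mono geometric_tail_sum) (auto simp: JN_def)
      finally show ?thesis by (simp add: e_def)
    qed
    \<comment> \<open>The modulus of the power is \<open>l p powr q\<close> on the left line and 1
      on the right one; at \<open>\<theta>\<close> the power is \<open>l p\<close> itself, as
      \<open>q * (1 - \<theta>) = 1\<close>.\<close>
    define w where "w z p = of_real (\<delta> (fst p)) * complex_of_real (l p) powr (of_real q * (1 - z))" for z p
    have norm_w: "norm (w z p) = \<delta> (fst p) * l p powr (q * (1 - Re z))" if "p \<in> J" for z p
      using J(1)[OF that] \<delta>[of "fst p"] by (simp add: w_def norm_mult norm_of_real_powr)
    define G where "G z N x = (\<Sum>\<^sub>\<infinity>p\<in>JN N. w z p * v p x)" for z N x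
    have sumMR: "(\<Sum>p\<in>P. \<delta> (fst p) * (l p powr q * sum m (R p))) \<le> C * e N"
      if "finite P" "P \<subseteq> JN N" for P N
      using that admissible_mass[OF J(2)] klRv(4)
      by (intro weighted) (auto simp: less_imp_le l_def R_def)
    have sumv: "(\<Sum>p\<in>P. \<delta> (fst p) * norm (v p x)) \<le> C * e N"
      if "finite P" "P \<subseteq> JN N" for P N x
      using that klRv(3) by (intro weighted) (auto simp: v_def)
    \<comment> \<open>On the closed strip the exponent \<open>q * (1 - Re z)\<close> lies between 0
      and \<open>q\<close>. Terms with \<open>l p > 1\<close> are dominated by their size on the
      left line and summed in H^1, the others by their size on the right line and summed in
      L^infinity.\<close>
    have strip_split: "\<exists>a b. a \<in> carr \<H> \<and> b \<in> carr Linf \<and> G z N = a + b \<and>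
        nnorm \<H> a + nnorm Linf b \<le> (C + C\<^sup>2) * e N \<and>
        (\<forall>x. (\<lambda>p. w z p * v p x) summable_on JN N)"
      if z: "z \<in> closure strip" for z N
    proof -
      define D1 where "D1 = {p \<in> JN N. 1 < l p}"
      define D2 where "D2 = {p \<in> JN N. l p \<le> 1}"
      have D: "JN N = D1 \<union> D2" "D1 \<inter> D2 = {}" "D1 \<subseteq> J" "D2 \<subseteq> J" by (auto simp: D1_def D2_def JN_def)
      have Re: "0 \<le> Re z" "Re z \<le> 1" using z by (auto simp: closure_strip)
      have 1: "(\<Sum>p\<in>P. norm (w z p) * sum m (R p)) \<le> C * e N" if P: "finite P" "P \<subseteq> D1" for P
      proof -
        have "(\<Sum>p\<in>P. norm (w z p) * sum m (R p)) \<le> (\<Sum>p\<in>P. \<delta> (fst p) * (l p powr q * sum m (R p)))"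
        proof (rule sum_mono)
          fix p assume "p \<in> P"
          then have p: "p \<in> J" "1 < l p" using P by (auto simp: D1_def JN_def)
          have "q * (1 - Re z) \<le> q" using Re q by (simp add: mult_left_le)
          then have "l p powr (q * (1 - Re z)) \<le> l p powr q" using p by (intro powr_mono) auto
          then show "norm (w z p) * sum m (R p) \<le> \<delta> (fst p) * (l p powr q * sum m (R p))"
            using admissible_mass[OF J(2)[OF p(1)]] \<delta>[of "fst p"]
            by (simp add: norm_w[OF p(1)] mult.assoc mult_left_mono mult_right_mono less_imp_le)
        qed
        also have "\<dots> \<le> C * e N" using P by (intro sumMR) (auto simp: D1_def)
        finally show ?thesis .
      qed
      have 2: "(\<Sum>p\<in>P. norm (w z p) * norm (v p x)) \<le> C * e N" if P: "finite P" "P \<subseteq> D2" for P x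
      proof -
        have "(\<Sum>p\<in>P. norm (w z p) * norm (v p x)) \<le> (\<Sum>p\<in>P. \<delta> (fst p) * norm (v p x))"
        proof (rule sum_mono)
          fix p assume "p \<in> P"
          then have p: "p \<in> J" "l p \<le> 1" using P by (auto simp: D2_def JN_def)
          have "0 \<le> q * (1 - Re z)" using Re q by simp
          then have "l p powr (q * (1 - Re z)) \<le> 1" using p J(1)[OF p(1)] by (intro powr_le1) auto
          then show "norm (w z p) * norm (v p x) \<le> \<delta> (fst p) * norm (v p x)"
            using \<delta>[of "fst p"] by (intro mult_right_mono) (auto simp: norm_w[OF p(1)] mult_left_le less_imp_le)
        qed
        also have "\<dots> \<le> C * e N" using P by (intro sumv) (auto simp: D2_def)
        finally show ?thesis .
      qed
      define a where "a x = (\<Sum>\<^sub>\<infinity>p\<in>D1. w z p * v p x)" for x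
      define b where "b x = (\<Sum>\<^sub>\<infinity>p\<in>D2. w z p * v p x)" for x
      have H: "a \<in> carr \<H>" "nnorm \<H> a \<le> C * (C * e N)"
        "\<And>x. (\<lambda>p. w z p * v p x) summable_on D1"
      proof -
        note H = H1_family[of D1 R v C "w z" "C * e N", OF J(2,3) vC J(4) C 1]
        show "a \<in> carr \<H>" "nnorm \<H> a \<le> C * (C * e N)"
          "\<And>x. (\<lambda>p. w z p * v p x) summable_on D1"
          using H D(3) by (auto simp: a_def[abs_def])
      qed
      have B: "b \<in> carr Linf" "nnorm Linf b \<le> C * e N" "\<And>x. (\<lambda>p. w z p * v p x) summable_on D2"
        using Linf_family[of D2 "w z" v "C * e N", OF 2] by (simp_all add: b_def[abs_def])
      have "G z N = a + b"
        unfolding fun_eq_iff G_def D(1) plus_fun_def a_def b_def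
        using H(3) B(3) D(2) by (auto intro: infsum_Un_disjoint)
      moreover have "(\<lambda>p. w z p * v p x) summable_on JN N" for x
        unfolding D(1) using H(3) B(3) D(2) by (intro summable_on_Un_disjoint)
      ultimately show ?thesis using H B
        by (intro exI[of _ a] exI[of _ b]) (auto simp: power2_eq_square algebra_simps)
    qed
    define F where "F z = G z 0" for z
    have JN0: "JN 0 = J" by (simp add: JN_def)
    have left: "F (\<i> * of_real t) \<in> carr \<H>"
      "nnorm \<H> (F (\<i> * of_real t)) \<le> C * (C * e 0)" for t
    proof -
      have "(\<Sum>p\<in>P. norm (w (\<i> * of_real t) p) * sum m (R p)) \<le> C * e 0" if P: "finite P" "P \<subseteq> J" for P
      proof -
        have "(\<Sum>p\<in>P. norm (w (\<i> * of_real t) p) * sum m (R p)) =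
            (\<Sum>p\<in>P. \<delta> (fst p) * (l p powr q * sum m (R p)))"
          using P by (intro sum.cong) (auto simp: norm_w)
        then show ?thesis using sumMR[of P 0] P by (simp add: JN0)
      qed
      then show "F (\<i> * of_real t) \<in> carr \<H>"
        "nnorm \<H> (F (\<i> * of_real t)) \<le> C * (C * e 0)"
        using H1_family[of J R v C "w (\<i> * of_real t)" "C * e 0", OF J(2,3) vC J(4) C]
        by (simp_all add: F_def G_def[abs_def] JN0)
    qed
    have right: "F (1 + \<i> * of_real t) \<in> carr Linf"
      "nnorm Linf (F (1 + \<i> * of_real t)) \<le> C * e 0" for t
    proof -
      have "(\<Sum>p\<in>P. norm (w (1 + \<i> * of_real t) p) * norm (v p x)) \<le> C * e 0"
        if P: "finite P" "P \<subseteq> J" for P x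
      proof -
        have "(\<Sum>p\<in>P. norm (w (1 + \<i> * of_real t) p) * norm (v p x)) = (\<Sum>p\<in>P. \<delta> (fst p) * norm (v p x))"
        proof (intro sum.cong refl)
          fix p assume "p \<in> P"
          then have "p \<in> J" "l p \<noteq> 0" using P J(1)[of p] by auto
          then show "norm (w (1 + \<i> * of_real t) p) * norm (v p x) = \<delta> (fst p) * norm (v p x)"
            by (simp add: norm_w)
        qed
        then show ?thesis using sumv[of P 0] P by (simp add: JN0)
      qed
      then show "F (1 + \<i> * of_real t) \<in> carr Linf"
        "nnorm Linf (F (1 + \<i> * of_real t)) \<le> C * e 0"
        using Linf_family[of J "w (1 + \<i> * of_real t)" v "C * e 0"]
        by (simp_all add: F_def G_def[abs_def] JN0)
    qed
    have F_sum: "F z \<in> carr (sum_space \<H> Linf)" if "z \<in> closure strip" for z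
      unfolding carr_sum_space F_def using strip_split[OF that, of 0] by blast
    have dual: "continuous_on (closure strip) (\<lambda>z. \<Lambda> (F z)) \<and> bounded ((\<lambda>z. \<Lambda> (F z)) ` closure strip) \<and>
        (\<lambda>z. \<Lambda> (F z)) analytic_on strip"
      if \<Lambda>: "\<Lambda> \<in> dual (sum_space \<H> Linf)" for \<Lambda>
    proof -
      obtain B where B: "0 < B" "\<And>a b. a \<in> carr \<H> \<Longrightarrow> b \<in> carr Linf \<Longrightarrow>
          norm (\<Lambda> (a + b)) \<le> B * (nnorm \<H> a + nnorm Linf b)"
        using dual_bound[OF \<Lambda> nonneg_norm_H1 nonneg_norm_Linf] by blast
      define I where "I N = Sigma {..<N} (\<lambda>n. {..<k n})" for N
      have I: "finite (I N)" "I N \<subseteq> J" for N by (auto simp: I_def J_def)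
      have vLinf: "v p \<in> carr Linf" if "p \<in> J" for p using vC[OF that] by (rule LinfI(1))
      \<comment> \<open>Finite exponential sums in \<open>z\<close>. The image of the remainder
        \<open>G z N\<close> under \<open>\<Lambda>\<close> is small uniformly on the closed strip,
        so continuity and analyticity pass to the limit.\<close>
      define \<phi> where "\<phi> N z = (\<Sum>p\<in>I N. w z p * \<Lambda> (v p))" for N z
      have tail: "norm (\<Lambda> (G z N)) \<le> B * ((C + C\<^sup>2) * e N)" if "z \<in> closure strip" for z N
      proof -
        obtain a b where ab: "a \<in> carr \<H>" "b \<in> carr Linf" "G z N = a + b"
          "nnorm \<H> a + nnorm Linf b \<le> (C + C\<^sup>2) * e N"
          using strip_split[OF \<open>z \<in> closure strip\<close>] by blast
        have "norm (\<Lambda> (G z N)) \<le> B * (nnorm \<H> a + nnorm Linf b)"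
          unfolding ab(3) by (rule B(2)[OF ab(1,2)])
        also have "\<dots> \<le> B * ((C + C\<^sup>2) * e N)" using ab(4) B(1) by (intro mult_left_mono) auto
        finally show ?thesis .
      qed
      have expand: "\<Lambda> (F z) = \<phi> N z + \<Lambda> (G z N)" if z: "z \<in> closure strip" for z N
      proof -
        have fin: "(\<lambda>x. \<Sum>p\<in>I N. w z p * v p x) \<in> carr (sum_space \<H> Linf) \<and>
            \<Lambda> (\<lambda>x. \<Sum>p\<in>I N. w z p * v p x) = (\<Sum>p\<in>I N. w z p * \<Lambda> (v p))"
          using I(2)[of N] vLinf by (intro dual_finite_sum[OF \<Lambda> H1_zero I(1)]) blast
        have "F z = (\<lambda>x. \<Sum>p\<in>I N. w z p * v p x) + G z N"
        proof
          fix x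
          have "J = I N \<union> JN N" "I N \<inter> JN N = {}" by (auto simp: I_def J_def JN_def)
          moreover have "(\<lambda>p. w z p * v p x) summable_on I N" using I by simp
          moreover have "(\<lambda>p. w z p * v p x) summable_on JN N" using strip_split[OF z] by blast
          ultimately show "F z x = ((\<lambda>x. \<Sum>p\<in>I N. w z p * v p x) + G z N) x"
            unfolding F_def G_def JN0 using I(1)[of N] by (simp add: infsum_Un_disjoint)
        qed
        moreover have "G z N \<in> carr (sum_space \<H> Linf)"
          unfolding carr_sum_space using strip_split[OF z] by blast
        moreover have "\<Lambda> (f + g) = \<Lambda> f + \<Lambda> g" if "f \<in> carr (sum_space \<H> Linf)"
          "g \<in> carr (sum_space \<H> Linf)" for f g
          using \<Lambda> that by (simp add: dual_def)
        ultimately show ?thesis using fin by (simp add: \<phi>_def)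
      qed
      have lnz: "complex_of_real (l p) \<notin> \<real>\<^sub>\<le>\<^sub>0" "l p \<noteq> 0" "0 \<le> l p" if "p \<in> I N" for p N
        using J(1)[of p] I(2)[of N] that by (auto simp: complex_nonpos_Reals_iff)
      have "(\<lambda>N. B * ((C + C\<^sup>2) * e N)) \<longlonglongrightarrow> B * ((C + C\<^sup>2) * (8 * L * 0))"
        unfolding e_def by (intro tendsto_intros LIMSEQ_realpow_zero) auto
      then have e0: "(\<lambda>N. B * ((C + C\<^sup>2) * e N)) \<longlonglongrightarrow> 0" by simp
      have unif: "uniform_limit (closure strip) \<phi> (\<lambda>z. \<Lambda> (F z)) sequentially"
      proof (rule uniform_limitI)
        fix \<epsilon> :: real assume "0 < \<epsilon>"
        then have "\<forall>\<^sub>F N in sequentially. B * ((C + C\<^sup>2) * e N) < \<epsilon>"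
          using order_tendstoD(2)[OF e0] by blast
        then show "\<forall>\<^sub>F N in sequentially. \<forall>z\<in>closure strip. dist (\<phi> N z) (\<Lambda> (F z)) < \<epsilon>"
        proof eventually_elim
          case (elim N)
          show ?case
          proof
            fix z assume z: "z \<in> closure strip"
            show "dist (\<phi> N z) (\<Lambda> (F z)) < \<epsilon>"
              unfolding expand[OF z, of N] using tail[OF z, of N] elim by (simp add: dist_norm)
          qed
        qed
      qed
      have cont: "continuous_on A (\<phi> N)" for A N
        unfolding \<phi>_def w_def using lnz by (intro continuous_intros) auto
      have hol: "\<phi> N holomorphic_on A" for A N
        unfolding \<phi>_def w_def using lnz by (intro holomorphic_intros)
      have "continuous_on (closure strip) (\<lambda>z. \<Lambda> (F z))"
        using unif cont by (intro uniform_limit_theorem[OF _ unif]) auto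
      moreover have "bounded ((\<lambda>z. \<Lambda> (F z)) ` closure strip)"
        unfolding bounded_iff using tail[of _ 0] by (auto simp: F_def)
      moreover have "(\<lambda>z. \<Lambda> (F z)) holomorphic_on strip"
      proof (rule holomorphic_uniform_sequence[OF open_strip, of \<phi>])
        show "\<phi> N holomorphic_on strip" for N by (rule hol)
        fix x assume "x \<in> strip"
        then obtain d where d: "0 < d" "cball x d \<subseteq> strip" using open_strip open_contains_cball by blast
        moreover have "uniform_limit (cball x d) \<phi> (\<lambda>z. \<Lambda> (F z)) sequentially"
          using d closure_subset by (intro uniform_limit_on_subset[OF unif]) blast
        ultimately show "\<exists>d>0. cball x d \<subseteq> strip \<and> uniform_limit (cball x d) \<phi> (\<lambda>z. \<Lambda> (F z)) sequentially"
          by blast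
      qed
      ultimately show ?thesis using open_strip by (simp add: analytic_on_open)
    qed
    have F_class: "F \<in> calderon_class \<H> Linf"
      unfolding calderon_class_def using F_sum dual left right
      by (auto simp: bdd_above_def)
    have e0: "0 \<le> C * e 0" "0 \<le> C * (C * e 0)" using C L by (auto simp: e_def)
    have cn: "calderon_norm \<H> Linf F \<le> 8 * (C + C\<^sup>2) * L"
    proof (rule calderon_norm_le)
      have eq: "8 * (C + C\<^sup>2) * L = C * e 0 + C * (C * e 0)"
        by (simp add: e_def power2_eq_square algebra_simps)
      show "nnorm \<H> (F (\<i> * of_real t)) \<le> 8 * (C + C\<^sup>2) * L" for t
        unfolding eq using left(2)[of t] e0 by linarith
      show "nnorm Linf (F (1 + \<i> * of_real t)) \<le> 8 * (C + C\<^sup>2) * L" for t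
        unfolding eq using right(2)[of t] e0 by linarith
    qed
    have "F (of_real \<theta>) = f"
    proof
      fix x
      have st: "complex_of_real \<theta> \<in> closure strip" using \<theta> by (simp add: closure_strip)
      have "(\<lambda>p. w (of_real \<theta>) p * v p x) summable_on J"
        using strip_split[OF st, of 0] unfolding JN0 by blast
      then have "((\<lambda>p. w (of_real \<theta>) p * v p x) has_sum F (of_real \<theta>) x) (Sigma UNIV (\<lambda>n. {..<k n}))"
        unfolding F_def G_def JN0 unfolding J_def by (rule has_sum_infsum)
      \<comment> \<open>At \<open>\<theta>\<close> the terms of stage \<open>n\<close> add up to
        \<open>h n\<close>, and the stages telescope to \<open>f\<close>.\<close>
      moreover have "((\<lambda>i. w (of_real \<theta>) (n, i) * v (n, i) x) has_sum h n x) {..<k n}" for n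
      proof -
        have "w (of_real \<theta>) (n, i) = of_real (\<delta> n) * of_real (l0 n i)" if "i < k n" for i
        proof -
          have "of_real q * (1 - complex_of_real \<theta>) = 1"
            using q\<theta> by (metis of_real_1 of_real_diff of_real_mult)
          then show ?thesis using klRv(1)[OF that] by (simp add: w_def l_def)
        qed
        then have "(\<Sum>i<k n. w (of_real \<theta>) (n, i) * v (n, i) x) = h n x"
          unfolding klRv(2) sum_distrib_left by (intro sum.cong) (auto simp: v_def)
        then show ?thesis using has_sum_finite[of "{..<k n}"] by (metis finite_lessThan)
      qed
      ultimately have "((\<lambda>n. h n x) has_sum F (of_real \<theta>) x) UNIV"
        by (rule has_sum_SigmaD)
      then have "(\<lambda>n. h n x) sums F (of_real \<theta>) x" by (rule has_sum_imp_sums)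
      \<comment> \<open>The L^q estimate on the one-point set \<open>{x}\<close> already gives
        pointwise convergence.\<close>
      moreover have "(\<lambda>n. g n x) \<longlonglongrightarrow> f x"
      proof (rule Lim_null_comparison[THEN Lim_null[THEN iffD2]])
        have "norm (g n x - f x) \<le> L * (1 / 2) ^ n * (1 / m x powr (1 / q))" for n
        proof -
          have "(m x powr (1 / q) * norm (f x - g n x)) powr q = m x * norm (f x - g n x) powr q"
            using q mass_pos[of x] by (simp add: powr_mult powr_powr)
          also have "\<dots> \<le> (L * (1 / 2) ^ n) powr q" using gS(4)[of "{x}" n] by simp
          finally have le: "(m x powr (1 / q) * norm (f x - g n x)) powr q \<le> (L * (1 / 2) ^ n) powr q" .
          have "m x powr (1 / q) * norm (f x - g n x) \<le> L * (1 / 2) ^ n"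
          proof (rule ccontr)
            assume "\<not> m x powr (1 / q) * norm (f x - g n x) \<le> L * (1 / 2) ^ n"
            then have "(L * (1 / 2) ^ n) powr q < (m x powr (1 / q) * norm (f x - g n x)) powr q"
              using q L by (intro powr_less_mono2) auto
            with le show False by simp
          qed
          moreover have "0 < m x powr (1 / q)" using mass_pos[of x] by simp
          ultimately show ?thesis by (simp add: field_simps norm_minus_commute)
        qed
        then show "\<forall>\<^sub>F n in sequentially. norm (g n x - f x) \<le> L * (1 / 2) ^ n * (1 / m x powr (1 / q))" by simp
        have "(\<lambda>n. L * (1 / 2) ^ n * (1 / m x powr (1 / q))) \<longlonglongrightarrow> L * 0 * (1 / m x powr (1 / q))"
          by (intro tendsto_intros LIMSEQ_realpow_zero) auto
        then show "(\<lambda>n. L * (1 / 2) ^ n * (1 / m x powr (1 / q))) \<longlonglongrightarrow> 0" by simp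
      qed
      then have "(\<lambda>n. h n x) sums (f x - g 0 x)" unfolding h_def by (rule telescope_sums)
      ultimately show "F (of_real \<theta>) x = f x" using gS(5) by (simp add: sums_unique2)
    qed
    then show ?thesis
      using interpolation_norm_le[OF F_class nonneg_norm_H1, of f \<theta>] cn by auto
  qed
  have "bounded_map (8 * (C + C\<^sup>2)) (Lp m q) (complex_interpolation \<H> Linf \<theta>) id"
    unfolding bounded_map_def
  proof (intro ballI)
    fix f assume f: "f \<in> carr (Lp m q)"
    define B where "B = 8 * (C + C\<^sup>2)"
    have B: "0 < B" using C by (simp add: B_def add_pos_pos)
    have N: "0 \<le> nnorm (Lp m q) f" using nonneg_norm_Lp f by (rule nonneg_normD)
    have "f \<in> carr (complex_interpolation \<H> Linf \<theta>)"
      using main[OF f, of "nnorm (Lp m q) f + 1"] N by simp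
    moreover have "nnorm (complex_interpolation \<H> Linf \<theta>) f \<le> B * nnorm (Lp m q) f"
    proof (rule field_le_epsilon)
      fix \<epsilon> :: real assume "0 < \<epsilon>"
      then have "0 < nnorm (Lp m q) f + \<epsilon> / B" "nnorm (Lp m q) f \<le> nnorm (Lp m q) f + \<epsilon> / B"
        using N B by (auto simp: add_nonneg_pos)
      from main[OF f this] have "nnorm (complex_interpolation \<H> Linf \<theta>) f \<le>
          B * (nnorm (Lp m q) f + \<epsilon> / B)"
        unfolding B_def by blast
      then show "nnorm (complex_interpolation \<H> Linf \<theta>) f \<le> B * nnorm (Lp m q) f + \<epsilon>"
        using B by (simp add: distrib_left)
    qed
    ultimately show "id f \<in> carr (complex_interpolation \<H> Linf \<theta>) \<and>
        nnorm (complex_interpolation \<H> Linf \<theta>) (id f) \<le> 8 * (C + C\<^sup>2) * nnorm (Lp m q) f"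
      by (simp add: B_def)
  qed
  moreover have "0 < 8 * (C + C\<^sup>2)" using C by (simp add: add_pos_pos)
  ultimately show ?thesis by (rule that[rotated])
qed

end

section \<open>Duality and the lower inclusions\<close>

text \<open>The converse of Hoelder's inequality on a finite set. The extremal test is the conjugate
  of \<open>h\<close> times \<open>\<bar>h\<bar>^(q - 2)\<close>, divided by
  \<open>T powr (1 / p)\<close>; it vanishes where \<open>h\<close> does.\<close>

lemma (in weight) norm_sum_powr_le:
  fixes h :: "'v \<Rightarrow> complex"
  assumes S: "finite S" and pq: "1 < q" "1 / p + 1 / q = 1"
    and bound: "\<And>g. (\<Sum>x\<in>S. m x * norm (g x) powr p) \<le> 1 \<Longrightarrow> norm (\<Sum>x\<in>S. m x *\<^sub>R (g x * h x)) \<le> D"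
  shows "(\<Sum>x\<in>S. m x * norm (h x) powr q) \<le> D powr q"
proof -
  define T where "T = (\<Sum>x\<in>S. m x * norm (h x) powr q)"
  have "0 \<le> T" unfolding T_def by (intro sum_nonneg) auto
  have "1 / p = 1 - 1 / q" using pq(2) by simp
  then have "0 < 1 / p" using pq(1) by simp
  then have p: "0 < p" by simp
  have pq': "(q - 1) * p = q" using pq p by (simp add: field_simps)
  show ?thesis
  proof (cases "T = 0")
    case True
    then show ?thesis by (simp add: T_def[symmetric])
  next
    case False
    then have T: "0 < T" using \<open>0 \<le> T\<close> by simp
    define g where "g x = cnj (h x) * of_real (norm (h x) powr (q - 2) / T powr (1 / p))" for x
    have norm_g: "norm (g x) = norm (h x) powr (q - 1) / T powr (1 / p)" for x
    proof (cases "h x = 0")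
      case False
      then have "norm (h x) * norm (h x) powr (q - 2) = norm (h x) powr (q - 1)"
        using powr_add[of "norm (h x)" 1 "q - 2"] by simp
      then show ?thesis by (simp add: g_def norm_mult norm_divide)
    qed (use pq in \<open>simp add: g_def\<close>)
    have "norm (g x) powr p = norm (h x) powr q / T" for x
      unfolding norm_g using p T by (simp add: powr_divide powr_powr pq')
    then have "(\<Sum>x\<in>S. m x * norm (g x) powr p) = (\<Sum>x\<in>S. m x * norm (h x) powr q / T)" by simp
    also have "\<dots> = T / T" by (simp only: sum_divide_distrib[symmetric] T_def[symmetric])
    finally have "norm (\<Sum>x\<in>S. m x *\<^sub>R (g x * h x)) \<le> D" using T by (intro bound) simp
    moreover have "g x * h x = of_real (norm (h x) powr q / T powr (1 / p))" for x
    proof (cases "h x = 0")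
      case False
      then have "norm (h x) powr 2 * norm (h x) powr (q - 2) = norm (h x) powr q"
        using powr_add[of "norm (h x)" 2 "q - 2"] by simp
      moreover have "norm (h x) powr 2 = (norm (h x))\<^sup>2" using False by simp
      moreover have "cnj (h x) * h x = of_real ((norm (h x))\<^sup>2)"
        by (metis complex_norm_square mult.commute)
      ultimately show ?thesis unfolding g_def
        by (metis (no_types, lifting) mult.assoc mult.commute of_real_mult times_divide_eq_right)
    qed (use pq in \<open>simp add: g_def\<close>)
    then have "(\<Sum>x\<in>S. m x *\<^sub>R (g x * h x)) = of_real (T / T powr (1 / p))"
      by (simp add: T_def sum_divide_distrib scaleR_conv_of_real)
    moreover have "T / T powr (1 / p) = T powr (1 / q)"
      using T pq(2) by (simp add: field_simps flip: powr_add)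
    ultimately have "T powr (1 / q) \<le> D" by simp
    then have "(T powr (1 / q)) powr q \<le> D powr q" using pq by (intro powr_mono2) auto
    then show ?thesis using T pq by (simp add: powr_powr T_def)
  qed
qed

text \<open>Values of \<open>\<bar>g\<bar>\<close> up to the threshold \<open>s\<close> are bounded
  by \<open>s\<close>, larger ones by \<open>\<bar>g\<bar>^p * s^(1 - p)\<close>; the choice
  \<open>s = M^(-1/p)\<close> makes the two bounds equal after summation. This elementary substitute
  for Hoelder's inequality loses a factor 2.\<close>

lemma (in weight) average_powr_le:
  fixes g :: "'v \<Rightarrow> complex"
  assumes S: "finite S" "S \<noteq> {}" and p: "1 < p" and g: "(\<Sum>x\<in>S. m x * norm (g x) powr p) \<le> 1"
  shows "norm ((\<Sum>x\<in>S. m x *\<^sub>R g x) /\<^sub>R sum m S) powr p * sum m S \<le> 2 powr p"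
proof -
  define M where "M = sum m S"
  have M: "0 < M" unfolding M_def using S mass_pos by (intro sum_pos) auto
  define s where "s = M powr (- (1 / p))"
  have s: "0 < s" using M by (simp add: s_def)
  have "s powr p = M powr (- 1)" using p by (simp add: s_def powr_powr)
  then have sp: "s powr p * M = 1" using M by (simp add: powr_minus)
  have t: "t \<le> s + t powr p * s powr (1 - p)" if "0 \<le> t" for t
  proof (cases "t \<le> s")
    case True
    then show ?thesis using s by (simp add: add_increasing2)
  next
    case False
    then have "1 \<le> t / s" using s by simp
    then have "t / s \<le> (t / s) powr p" using p powr_mono[of 1 p "t / s"] s False by simp
    also have "\<dots> = t powr p / s powr p" using s that by (simp add: powr_divide)
    finally have "t \<le> t powr p * s powr (1 - p)"
      using s by (simp add: powr_diff field_simps)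
    then show ?thesis using s by simp
  qed
  have "norm (\<Sum>x\<in>S. m x *\<^sub>R g x) \<le> (\<Sum>x\<in>S. m x * (s + norm (g x) powr p * s powr (1 - p)))"
    using t by (intro order_trans[OF norm_sum] sum_mono) (simp add: mult_left_mono)
  also have "\<dots> = s * M + s powr (1 - p) * (\<Sum>x\<in>S. m x * norm (g x) powr p)"
    by (simp add: M_def distrib_left sum.distrib sum_distrib_left mult_ac)
  also have "\<dots> \<le> s * M + s powr (1 - p) * 1" using g by (intro add_left_mono mult_left_mono) auto
  also have "s powr (1 - p) * 1 = s * M" using s sp by (simp add: powr_diff field_simps)
  finally have "norm ((\<Sum>x\<in>S. m x *\<^sub>R g x) /\<^sub>R M) \<le> 2 * s" using M by (simp add: field_simps)
  then have "norm ((\<Sum>x\<in>S. m x *\<^sub>R g x) /\<^sub>R M) powr p * M \<le> (2 * s) powr p * M"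
    using p M by (intro mult_right_mono powr_mono2) auto
  also have "\<dots> = 2 powr p" using sp by (simp add: powr_mult mult.assoc)
  finally show ?thesis by (simp add: M_def)
qed

text \<open>Tests of integral zero see \<open>h\<close> only modulo constants. On a nonempty finite
  set the mean of \<open>h\<close> is a suitable constant. A single constant for all finite sets is
  found by compactness: the sets of suitable constants are compact and shrink as the finite set
  grows.\<close>

lemma (in weight) Lp_modulo_constants:
  fixes h :: "'v \<Rightarrow> complex"
  assumes pq: "1 < p" "1 < q" "1 / p + 1 / q = 1" and D: "0 \<le> D"
    and bound: "\<And>g S. finite S \<Longrightarrow> (\<And>x. x \<notin> S \<Longrightarrow> g x = 0) \<Longrightarrow> (\<Sum>x\<in>S. m x *\<^sub>R g x) = 0 \<Longrightarrow>
      (\<Sum>x\<in>S. m x * norm (g x) powr p) \<le> 1 \<Longrightarrow> norm (\<Sum>x\<in>S. m x *\<^sub>R (g x * h x)) \<le> D"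
  shows "\<exists>c. (\<lambda>x. h x - c) \<in> carr (Lp m q) \<and> nnorm (Lp m q) (\<lambda>x. h x - c) \<le> 8 * D"
proof -
  define N where "N S c = (\<Sum>x\<in>S. m x * norm (h x - c) powr q)" for S c
  have ex: "\<exists>c. N S c \<le> (8 * D) powr q" if S: "finite S" "S \<noteq> {}" for S
  proof -
    define M where "M = sum m S"
    have M: "0 < M" unfolding M_def using S mass_pos by (intro sum_pos) auto
    define c where "c = (\<Sum>x\<in>S. m x *\<^sub>R h x) /\<^sub>R M"
    have "N S c \<le> (8 * D) powr q"
      unfolding N_def
    proof (rule norm_sum_powr_le[OF S(1) pq(2,3)])
      fix g :: "'v \<Rightarrow> complex" assume g: "(\<Sum>x\<in>S. m x * norm (g x) powr p) \<le> 1"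
      define a where "a = (\<Sum>x\<in>S. m x *\<^sub>R g x) /\<^sub>R M"
      \<comment> \<open>Removing the mean turns an arbitrary \<open>g\<close> into a test of
        integral zero; division by 8 restores the normalisation, since
        \<open>2 powr p * (1 + 2 powr p) \<le> 8 powr p\<close>.\<close>
      define g' where "g' x = (if x \<in> S then (g x - a) / 8 else 0)" for x
      have Ma: "(\<Sum>x\<in>S. m x *\<^sub>R g x) = M *\<^sub>R a" "(\<Sum>x\<in>S. m x *\<^sub>R h x) = M *\<^sub>R c"
        using M by (simp_all add: a_def c_def)
      have "norm (\<Sum>x\<in>S. m x *\<^sub>R (g' x * h x)) \<le> D"
      proof (rule bound[OF S(1)])
        show "g' x = 0" if "x \<notin> S" for x using that by (simp add: g'_def)
        have "(\<Sum>x\<in>S. m x *\<^sub>R g' x) = (\<Sum>x\<in>S. m x *\<^sub>R g x - m x *\<^sub>R a) / 8"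
          unfolding sum_divide_distrib by (intro sum.cong) (auto simp: g'_def scaleR_conv_of_real algebra_simps)
        also have "\<dots> = 0" by (simp add: sum_subtractf Ma(1) M_def scaleR_sum_left)
        finally show "(\<Sum>x\<in>S. m x *\<^sub>R g' x) = 0" .
        have "(\<Sum>x\<in>S. m x * norm (g' x) powr p) = (\<Sum>x\<in>S. m x * norm (g x + (- a)) powr p) / 8 powr p"
          unfolding sum_divide_distrib
          by (intro sum.cong) (auto simp: g'_def norm_divide powr_divide)
        also have "\<dots> \<le> (\<Sum>x\<in>S. m x * (2 powr p * (norm (g x) powr p + norm (- a) powr p))) / 8 powr p"
          using pq by (intro divide_right_mono sum_mono mult_left_mono norm_powr_le) auto
        also have "\<dots> = 2 powr p * ((\<Sum>x\<in>S. m x * norm (g x) powr p) + norm a powr p * M) / 8 powr p"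
          by (simp add: M_def sum_distrib_left sum_distrib_right distrib_left sum.distrib mult_ac)
        also have "\<dots> \<le> 2 powr p * (1 + 2 powr p) / 8 powr p"
          using g average_powr_le[OF S pq(1) g] unfolding a_def M_def
          by (intro divide_right_mono mult_left_mono add_mono) auto
        also have "\<dots> \<le> 1"
        proof -
          have "(2::real) \<le> 2 powr p" using pq powr_mono[of 1 p 2] by simp
          then have "1 + 2 powr p \<le> 2 powr p * (2 powr p :: real)"
            using mult_right_mono[of 2 "2 powr p" "2 powr p"] by linarith
          then have "2 powr p * (1 + 2 powr p) \<le> 2 powr p * (2 powr p * (2 powr p :: real))"
            by (intro mult_left_mono) auto
          also have "\<dots> = (2 * (2 * 2)) powr p" by (simp only: powr_mult)
          finally show ?thesis by (simp add: pos_divide_le_eq)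
        qed
        finally show "(\<Sum>x\<in>S. m x * norm (g' x) powr p) \<le> 1" .
      qed
      \<comment> \<open>Taking the mean out of \<open>h\<close> has the same effect as taking it out
        of \<open>g\<close>: either way \<open>M * a * c\<close> is subtracted.\<close>
      moreover have "(\<Sum>x\<in>S. m x *\<^sub>R (g x * (h x - c))) = 8 * (\<Sum>x\<in>S. m x *\<^sub>R (g' x * h x))"
      proof -
        have "(\<Sum>x\<in>S. m x *\<^sub>R (g x * (h x - c))) = (\<Sum>x\<in>S. m x *\<^sub>R (g x * h x)) - (\<Sum>x\<in>S. m x *\<^sub>R g x) * c"
          unfolding sum_distrib_right sum_subtractf[symmetric]
          by (intro sum.cong) (auto simp: algebra_simps)
        also have "\<dots> = (\<Sum>x\<in>S. m x *\<^sub>R (g x * h x)) - a * (\<Sum>x\<in>S. m x *\<^sub>R h x)"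
          unfolding Ma by simp
        also have "\<dots> = (\<Sum>x\<in>S. m x *\<^sub>R ((g x - a) * h x))"
          unfolding sum_distrib_left sum_subtractf[symmetric]
          by (intro sum.cong) (auto simp: algebra_simps)
        also have "\<dots> = 8 * (\<Sum>x\<in>S. m x *\<^sub>R (g' x * h x))"
          unfolding sum_distrib_left by (intro sum.cong) (auto simp: g'_def scaleR_conv_of_real)
        finally show ?thesis .
      qed
      ultimately show "norm (\<Sum>x\<in>S. m x *\<^sub>R (g x * (h x - c))) \<le> 8 * D"
        by (simp add: norm_mult)
    qed
    then show ?thesis by blast
  qed
  define \<C> where "\<C> S = {c. N S c \<le> (8 * D) powr q}" for S
  have closed: "closed (\<C> S)" for S
    unfolding \<C>_def N_def using pq
    by (intro closed_Collect_le continuous_on_sum continuous_on_mult_left continuous_on_powr' continuous_intros) auto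
  have mono: "\<C> T \<subseteq> \<C> S" if "S \<subseteq> T" "finite T" for S T
  proof -
    have "N S c \<le> N T c" for c unfolding N_def using that by (intro sum_mono2) auto
    then show ?thesis by (auto simp: \<C>_def intro: order_trans)
  qed
  have bounded: "bounded (\<C> S)" if S: "finite S" "S \<noteq> {}" for S
  proof -
    obtain x where x: "x \<in> S" using S by blast
    define B where "B = ((8 * D) powr q / m x) powr (1 / q)"
    have "norm (h x - c) \<le> B" if "c \<in> \<C> S" for c
    proof -
      have "m x * norm (h x - c) powr q \<le> (8 * D) powr q"
        using mono[of "{x}" S] S x that by (auto simp: \<C>_def N_def)
      then have "norm (h x - c) powr q \<le> (8 * D) powr q / m x"
        using mass_pos[of x] by (simp add: field_simps)
      then have "(norm (h x - c) powr q) powr (1 / q) \<le> B"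
        unfolding B_def using pq by (intro powr_mono2) auto
      then show ?thesis using pq by (simp add: powr_powr)
    qed
    then have "\<C> S \<subseteq> cball (h x) B" by (auto simp: dist_norm)
    then show ?thesis using bounded_cball bounded_subset by blast
  qed
  have "\<Inter>(\<C> ` {S. finite S \<and> S \<noteq> {}}) \<noteq> {}"
  proof (rule compact_fip_Heine_Borel)
    show "compact T" if "T \<in> \<C> ` {S. finite S \<and> S \<noteq> {}}" for T
      using that closed bounded by (auto simp: compact_eq_bounded_closed)
    fix \<F> assume \<F>: "finite \<F>" "\<F> \<subseteq> \<C> ` {S. finite S \<and> S \<noteq> {}}"
    then obtain \<S> where \<S>: "finite \<S>" "\<S> \<subseteq> {S. finite S \<and> S \<noteq> {}}" "\<F> = \<C> ` \<S>"
      by (meson finite_subset_image)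
    \<comment> \<open>The extra vertex keeps the union nonempty when the family is empty.\<close>
    let ?U = "insert undefined (\<Union>\<S>)"
    have U: "finite ?U" "?U \<noteq> {}" using \<S> by auto
    obtain c where "c \<in> \<C> ?U" using ex[OF U] unfolding \<C>_def by blast
    moreover have "\<C> ?U \<subseteq> \<C> S" if "S \<in> \<S>" for S using that U by (intro mono) auto
    ultimately show "\<Inter>\<F> \<noteq> {}" unfolding \<S>(3) by blast
  qed
  then obtain c where c: "\<And>S. finite S \<Longrightarrow> S \<noteq> {} \<Longrightarrow> c \<in> \<C> S" by blast
  have "(\<Sum>x\<in>S. m x * norm (h x - c) powr q) \<le> (8 * D) powr q" if "finite S" for S
    using c[OF that] by (cases "S = {}") (auto simp: \<C>_def N_def)
  then show ?thesis using LpI[of q "8 * D" "\<lambda>x. h x - c"] pq D by auto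
qed

text \<open>A representative is chosen arbitrarily; the value does not depend on it when
  \<open>u\<close> has integral zero on \<open>R\<close>, as in all applications.\<close>

definition pairing :: "('v \<Rightarrow> real) \<Rightarrow> 'v set \<Rightarrow> ('v \<Rightarrow> complex) \<Rightarrow> 'v fun_mod_const \<Rightarrow> complex" where
  "pairing m R u w = (\<Sum>x\<in>R. m x *\<^sub>R (u x * rep_mod_const w x))"

lemma pairing_mod_const:
  assumes "(\<Sum>x\<in>R. m x *\<^sub>R u x) = 0"
  shows "pairing m R u (mod_const f) = (\<Sum>x\<in>R. m x *\<^sub>R (u x * f x))"
proof -
  obtain c where c: "\<And>x. rep_mod_const (mod_const f) x = f x + c" using rep_mod_const by metis
  have "pairing m R u (mod_const f) = (\<Sum>x\<in>R. m x *\<^sub>R (u x * f x)) + (\<Sum>x\<in>R. m x *\<^sub>R u x) * c"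
    unfolding pairing_def c sum_distrib_right sum.distrib[symmetric]
    by (intro sum.cong) (auto simp: algebra_simps)
  then show ?thesis using assms by simp
qed

context bmo_tree
begin

text \<open>On L^1 the bound is \<open>U\<close>, by size; on BMO it is \<open>U * sum m R\<close>,
  by cancellation, \<open>u\<close> acting as a multiple of an atom.\<close>

lemma pairing_dual:
  assumes R: "R \<in> \<A>" and u: "\<And>x. norm (u x) \<le> U" "(\<Sum>x\<in>R. m x *\<^sub>R u x) = 0"
  shows "pairing m R u \<in> dual (sum_space (modulo_constants (Lp m 1)) (modulo_constants \<B>))"
proof (rule dual_sum_spaceI)
  have U: "0 \<le> U" using u(1)[of undefined] norm_ge_zero order_trans by blast
  have M: "0 < sum m R" by (rule admissible_mass[OF R])
  \<comment> \<open>The summand 1 keeps the constant positive when \<open>U = 0\<close>.\<close>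
  let ?C = "U * (1 + sum m R) + 1"
  have C: "U \<le> ?C" "U * sum m R \<le> ?C" "0 < ?C" using U M by (auto simp: algebra_simps add_pos_nonneg)
  show "0 < ?C" by (rule C)
  note pm = pairing_mod_const[OF u(2)]
  show "pairing m R u (f + g) = pairing m R u f + pairing m R u g" for f g
  proof -
    have "pairing m R u (mod_const (rep_mod_const f) + mod_const (rep_mod_const g)) =
        pairing m R u (mod_const (rep_mod_const f)) + pairing m R u (mod_const (rep_mod_const g))"
      unfolding mod_const_add[symmetric] pm by (simp add: algebra_simps sum.distrib)
    then show ?thesis by (simp add: mod_const_rep)
  qed
  show "pairing m R u (c *\<^sub>C f) = c * pairing m R u f" for c f
  proof -
    have "pairing m R u (c *\<^sub>C mod_const (rep_mod_const f)) = c * pairing m R u (mod_const (rep_mod_const f))"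
      unfolding mod_const_scaleC[symmetric] pm sum_distrib_left
      by (intro sum.cong) (auto simp: scaleC_fun_def scaleC_complex_def)
    then show ?thesis by (simp add: mod_const_rep)
  qed
  show "norm (pairing m R u a) \<le> ?C * nnorm (modulo_constants (Lp m 1)) a"
    if a: "a \<in> carr (modulo_constants (Lp m 1))" for a
  proof (rule modulo_norm_ge[OF a C(3)])
    fix f assume f: "f \<in> carr (Lp m 1)" "mod_const f = a"
    have "norm (pairing m R u a) \<le> (\<Sum>x\<in>R. U * (m x * norm (f x)))"
      unfolding f(2)[symmetric] pm
    proof (rule order_trans[OF norm_sum sum_mono])
      fix x
      have "norm (u x) * (m x * norm (f x)) \<le> U * (m x * norm (f x))"
        by (intro mult_right_mono u(1)) auto
      then show "norm (m x *\<^sub>R (u x * f x)) \<le> U * (m x * norm (f x))"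
        by (simp add: norm_mult mult.left_commute)
    qed
    also have "\<dots> = U * (\<Sum>x\<in>R. m x * norm (f x))" by (rule sum_distrib_left[symmetric])
    also have "\<dots> \<le> U * nnorm (Lp m 1) f"
      using L1_sum_le[OF f(1)] admissible[OF R] U by (intro mult_left_mono) auto
    also have "\<dots> \<le> ?C * nnorm (Lp m 1) f"
      using C nonneg_normD[OF nonneg_norm_Lp f(1)] by (intro mult_right_mono) auto
    finally show "norm (pairing m R u a) \<le> ?C * nnorm (Lp m 1) f" .
  qed
  show "norm (pairing m R u b) \<le> ?C * nnorm (modulo_constants \<B>) b"
    if b: "b \<in> carr (modulo_constants \<B>)" for b
  proof (rule modulo_norm_ge[OF b C(3)])
    fix f assume f: "f \<in> carr \<B>" "mod_const f = b"
    have "norm (pairing m R u b) \<le> U * sum m R * nnorm \<B> f"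
      unfolding f(2)[symmetric] pm using f(1) R u U by (rule BMO_pairing)
    also have "\<dots> \<le> ?C * nnorm \<B> f"
      using C nonneg_normD[OF nonneg_norm_BMO f(1)] by (intro mult_right_mono) auto
    finally show "norm (pairing m R u b) \<le> ?C * nnorm \<B> f" .
  qed
qed

text \<open>A test of exponent \<open>p = 1 / \<theta>\<close> and integral zero is decomposed into
  terms \<open>l i * v i\<close>, and the pairing runs over the analytic family with terms
  \<open>l i powr (p * z) * v i\<close>. On the left line this family is bounded by \<open>C\<close>
  at each point and is paired with L^1; on the right line its terms are multiples of atoms, with
  coefficients controlled by the sum of \<open>l i powr p * sum m (R i)\<close>, and are paired with
  BMO.\<close>

lemma interpolation_of_L1_BMO_in_Lp:
  assumes \<theta>: "0 < \<theta>" "\<theta> < 1" "1 / q = 1 - \<theta>"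
  obtains D where "0 < D"
    "bounded_map D (complex_interpolation (modulo_constants (Lp m 1)) (modulo_constants \<B>) \<theta>)
       (modulo_constants (Lp m q)) id"
proof -
  let ?A0 = "modulo_constants (Lp m 1)" and ?A1 = "modulo_constants \<B>"
  define p where "p = 1 / \<theta>"
  have p: "1 < p" using \<theta> by (simp add: p_def)
  have "0 < 1 / q" "1 / q < 1" using \<theta> by auto
  then have q: "1 < q" by (simp add: divide_less_eq split: if_splits)
  have pq: "1 / p + 1 / q = 1" using \<theta> by (simp add: p_def)
  obtain C where C: "0 < C" and split:
    "\<And>(f :: 'v \<Rightarrow> complex) S \<delta>. finite S \<Longrightarrow> (\<And>x. x \<notin> S \<Longrightarrow> f x = 0) \<Longrightarrow> (\<Sum>x\<in>S. m x *\<^sub>R f x) = 0 \<Longrightarrow> 0 < \<delta> \<Longrightarrow>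
      (\<Sum>x\<in>S. m x * norm (f x) powr p) \<le> \<delta> powr p \<Longrightarrow>
      \<exists>n l R v. atomic_sum m \<A> p C \<delta> f n l R v"
    using atomic_splitting[OF p] by blast
  \<comment> \<open>\<open>C\<close> arises on the left line and \<open>C\<^sup>2\<close> on the
    right one; the sum serves for both.\<close>
  define D where "D = C + C\<^sup>2"
  have D: "0 < D" using C by (simp add: D_def add_pos_pos)
  have main: "norm (\<Sum>x\<in>S. m x *\<^sub>R (g x * h x)) \<le> D * calderon_norm ?A0 ?A1 F"
    if F: "F \<in> calderon_class ?A0 ?A1" "mod_const h = F (of_real \<theta>)" and S: "finite S"
      and g: "\<And>x. x \<notin> S \<Longrightarrow> g x = 0" "(\<Sum>x\<in>S. m x *\<^sub>R g x) = 0" "(\<Sum>x\<in>S. m x * norm (g x) powr p) \<le> 1"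
    for F h g S
  proof -
    define \<nu> where "\<nu> = calderon_norm ?A0 ?A1 F"
    have \<nu>: "0 \<le> \<nu>"
      unfolding \<nu>_def using F(1) nonneg_norm_modulo[OF nonneg_norm_Lp] by (rule calderon_norm_nonneg)
    have "(\<Sum>x\<in>S. m x * norm (g x) powr p) \<le> 1 powr p" using g(3) by simp
    from split[OF S g(1,2) zero_less_one this] obtain n l R v where
      "atomic_sum m \<A> p C 1 g n l R v" by blast
    then have el: "\<And>i. i < n \<Longrightarrow> 0 < l i \<and> R i \<in> \<A> \<and> (\<forall>x. x \<notin> R i \<longrightarrow> v i x = 0) \<and>
          (\<Sum>x\<in>R i. m x *\<^sub>R v i x) = 0"
      and gv: "\<And>x. g x = (\<Sum>i<n. of_real (l i) * v i x)"
      and vC: "\<And>x. (\<Sum>i<n. norm (v i x)) \<le> C" and lC: "(\<Sum>i<n. l i powr p * sum m (R i)) \<le> C"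
      by (simp_all add: atomic_sum_def)
    have R: "R i \<in> \<A>" and l: "0 < l i" and v0: "x \<notin> R i \<Longrightarrow> v i x = 0" if "i < n" for i x
      using el[OF that] by auto
    have finR: "finite (R i)" if "i < n" for i using admissible[OF R[OF that]] by simp
    define u where "u i x = of_real (l i) * v i x" for i x
    have vle: "norm (v i x) \<le> C" if "i < n" for i x
      using member_le_sum[of i "{..<n}" "\<lambda>i. norm (v i x)"] vC[of x] that by simp
    have ule: "norm (u i x) \<le> l i * C" if "i < n" for i x
      using vle[OF that] l[OF that] by (simp add: u_def norm_mult mult_left_mono)
    have u0: "(\<Sum>x\<in>R i. m x *\<^sub>R u i x) = 0" if "i < n" for i
    proof -
      have "(\<Sum>x\<in>R i. m x *\<^sub>R u i x) = of_real (l i) * (\<Sum>x\<in>R i. m x *\<^sub>R v i x)"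
        unfolding sum_distrib_left by (simp add: u_def)
      then show ?thesis using el[OF that] by simp
    qed
    have bound: "norm (\<Sum>i<n. pairing m (R i) (u i) (F (of_real \<theta>))) \<le> D * \<nu>"
    proof (rule calderon_pairing[OF F(1), where \<mu> = l])
      show "pairing m (R i) (u i) \<in> dual (sum_space ?A0 ?A1)" if "i \<in> {..<n}" for i
        using that by (intro pairing_dual[OF R ule u0]) auto
      fix t :: real
      have it: "F (\<i> * of_real t) \<in> carr ?A0" "F (1 + \<i> * of_real t) \<in> carr ?A1"
        using F(1) unfolding calderon_class_def by blast+
      show "norm (\<Sum>i<n. complex_of_real (l i) powr (\<i> * of_real t / of_real \<theta> - 1) *
          pairing m (R i) (u i) (F (\<i> * of_real t))) \<le> D * \<nu>" (is "norm ?X \<le> _")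
      proof -
        \<comment> \<open>Cancellation allows the choice of a representative in L^1; the size is
          then controlled at each point by the sum of the \<open>norm (v i x)\<close>.\<close>
        have "norm ?X \<le> C * nnorm ?A0 (F (\<i> * of_real t))"
        proof (rule modulo_norm_ge[OF it(1) C])
          fix f assume f: "f \<in> carr (Lp m 1)" "mod_const f = F (\<i> * of_real t)"
          define W where "W = (\<Union>i<n. R i)"
          have W: "finite W" using finR by (simp add: W_def)
          have "norm ?X \<le> (\<Sum>i<n. \<Sum>x\<in>W. norm (v i x) * (m x * norm (f x)))"
          proof (rule order_trans[OF norm_sum sum_mono])
            fix i assume "i \<in> {..<n}"
            then have i: "i < n" by simp
            have "norm (complex_of_real (l i) powr (\<i> * of_real t / of_real \<theta> - 1)) = 1 / l i"
              using l[OF i] by (simp add: norm_of_real_powr powr_minus divide_inverse)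
            moreover have "norm (pairing m (R i) (u i) (F (\<i> * of_real t))) \<le>
                (\<Sum>x\<in>R i. l i * (norm (v i x) * (m x * norm (f x))))"
              unfolding f(2)[symmetric] pairing_mod_const[OF u0[OF i]]
              using l[OF i] by (intro order_trans[OF norm_sum sum_mono]) (simp add: u_def norm_mult mult_ac)
            then have "norm (pairing m (R i) (u i) (F (\<i> * of_real t))) \<le>
                l i * (\<Sum>x\<in>R i. norm (v i x) * (m x * norm (f x)))"
              by (simp only: sum_distrib_left)
            ultimately have "norm (complex_of_real (l i) powr (\<i> * of_real t / of_real \<theta> - 1) *
                pairing m (R i) (u i) (F (\<i> * of_real t))) \<le> (\<Sum>x\<in>R i. norm (v i x) * (m x * norm (f x)))"
              using l[OF i] by (simp add: norm_mult pos_divide_le_eq mult.commute)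
            also have "\<dots> \<le> (\<Sum>x\<in>W. norm (v i x) * (m x * norm (f x)))"
              using W i by (intro sum_mono2) (auto simp: W_def)
            finally show "norm (complex_of_real (l i) powr (\<i> * of_real t / of_real \<theta> - 1) *
                pairing m (R i) (u i) (F (\<i> * of_real t))) \<le> (\<Sum>x\<in>W. norm (v i x) * (m x * norm (f x)))" .
          qed
          also have "\<dots> = (\<Sum>x\<in>W. (\<Sum>i<n. norm (v i x)) * (m x * norm (f x)))"
            unfolding sum_distrib_right by (rule sum.swap)
          also have "\<dots> \<le> (\<Sum>x\<in>W. C * (m x * norm (f x)))"
            using vC by (intro sum_mono mult_right_mono) auto
          also have "\<dots> = C * (\<Sum>x\<in>W. m x * norm (f x))" by (rule sum_distrib_left[symmetric])
          also have "\<dots> \<le> C * nnorm (Lp m 1) f" using L1_sum_le[OF f(1) W] C by (intro mult_left_mono) auto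
          finally show "norm ?X \<le> C * nnorm (Lp m 1) f" .
        qed
        also have "\<dots> \<le> C * \<nu>"
          unfolding \<nu>_def using C calderon_norm_ge(1)[OF F(1)] by (intro mult_left_mono) auto
        also have "\<dots> \<le> D * \<nu>" using \<nu> by (intro mult_right_mono) (auto simp: D_def)
        finally show ?thesis .
      qed
      show "norm (\<Sum>i<n. complex_of_real (l i) powr ((1 + \<i> * of_real t) / of_real \<theta> - 1) *
          pairing m (R i) (u i) (F (1 + \<i> * of_real t))) \<le> D * \<nu>" (is "norm ?X \<le> _")
      proof -
        have "norm ?X \<le> C\<^sup>2 * nnorm ?A1 (F (1 + \<i> * of_real t))"
        proof (rule modulo_norm_ge[OF it(2)])
          show "0 < C\<^sup>2" using C by simp
          fix f assume f: "f \<in> carr \<B>" "mod_const f = F (1 + \<i> * of_real t)"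
          define b where "b = nnorm \<B> f"
          have b: "0 \<le> b" unfolding b_def using nonneg_norm_BMO f(1) by (rule nonneg_normD)
          have "norm ?X \<le> (\<Sum>i<n. l i powr p * sum m (R i) * (C * b))"
          proof (rule order_trans[OF norm_sum sum_mono])
            fix i assume "i \<in> {..<n}"
            then have i: "i < n" by simp
            have "norm (complex_of_real (l i) powr ((1 + \<i> * of_real t) / of_real \<theta> - 1)) = l i powr (p - 1)"
              using l[OF i] by (simp add: norm_of_real_powr p_def)
            moreover have "norm (pairing m (R i) (u i) (F (1 + \<i> * of_real t))) \<le> l i * C * sum m (R i) * b"
              unfolding f(2)[symmetric] pairing_mod_const[OF u0[OF i]] b_def
              using l[OF i] C by (intro BMO_pairing[OF f(1) R[OF i] ule[OF i] u0[OF i]]) auto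
            then have "l i powr (p - 1) * norm (pairing m (R i) (u i) (F (1 + \<i> * of_real t))) \<le>
                l i powr (p - 1) * (l i * C * sum m (R i) * b)" by (intro mult_left_mono) auto
            moreover have "l i powr (p - 1) * (l i * C * sum m (R i) * b) = l i powr p * sum m (R i) * (C * b)"
            proof -
              have "l i powr (p - 1) * l i = l i powr p" using l[OF i] by (simp add: powr_diff)
              then show ?thesis by (metis mult.assoc mult.left_commute)
            qed
            ultimately show "norm (complex_of_real (l i) powr ((1 + \<i> * of_real t) / of_real \<theta> - 1) *
                pairing m (R i) (u i) (F (1 + \<i> * of_real t))) \<le> l i powr p * sum m (R i) * (C * b)"
              by (simp add: norm_mult)
          qed
          also have "\<dots> = (\<Sum>i<n. l i powr p * sum m (R i)) * (C * b)" by (rule sum_distrib_right[symmetric])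
          also have "\<dots> \<le> C * (C * b)" using lC C b by (intro mult_right_mono) auto
          finally show "norm ?X \<le> C\<^sup>2 * nnorm \<B> f"
            by (simp add: b_def power2_eq_square mult.assoc)
        qed
        also have "\<dots> \<le> C\<^sup>2 * \<nu>"
          unfolding \<nu>_def using C calderon_norm_ge(2)[OF F(1)] by (intro mult_left_mono) auto
        also have "\<dots> \<le> D * \<nu>" using \<nu> C by (intro mult_right_mono) (auto simp: D_def)
        finally show ?thesis .
      qed
    qed (use \<theta> l in auto)
    have "(\<Sum>i<n. pairing m (R i) (u i) (F (of_real \<theta>))) = (\<Sum>i<n. \<Sum>x\<in>S \<union> (\<Union>i<n. R i). m x *\<^sub>R (u i x * h x))"
    proof (rule sum.cong[OF refl])
      fix i assume "i \<in> {..<n}"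
      then have i: "i < n" by simp
      show "pairing m (R i) (u i) (F (of_real \<theta>)) = (\<Sum>x\<in>S \<union> (\<Union>i<n. R i). m x *\<^sub>R (u i x * h x))"
        unfolding F(2)[symmetric] pairing_mod_const[OF u0[OF i]]
        using S finR i v0[OF i] by (intro sum.mono_neutral_left) (auto simp: u_def)
    qed
    also have "\<dots> = (\<Sum>x\<in>S \<union> (\<Union>i<n. R i). m x *\<^sub>R (g x * h x))"
      by (subst sum.swap) (simp add: gv u_def sum_distrib_right scaleR_sum_right)
    also have "\<dots> = (\<Sum>x\<in>S. m x *\<^sub>R (g x * h x))"
      using S finR g(1) by (intro sum.mono_neutral_right) auto
    finally show ?thesis using bound by (simp add: \<nu>_def)
  qed
  show ?thesis
  proof (rule that[of "8 * D"])
    show "0 < 8 * D" using D by simp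
    have res: "mod_const h \<in> carr (modulo_constants (Lp m q)) \<and>
        nnorm (modulo_constants (Lp m q)) (mod_const h) \<le> 8 * D * calderon_norm ?A0 ?A1 F"
      if F: "F \<in> calderon_class ?A0 ?A1" "mod_const h = F (of_real \<theta>)" for F h
    proof -
      have "0 \<le> calderon_norm ?A0 ?A1 F"
        using F(1) nonneg_norm_modulo[OF nonneg_norm_Lp] by (rule calderon_norm_nonneg)
      then have "0 \<le> D * calderon_norm ?A0 ?A1 F" using D by simp
      then have "\<exists>c. (\<lambda>x. h x - c) \<in> carr (Lp m q) \<and>
          nnorm (Lp m q) (\<lambda>x. h x - c) \<le> 8 * (D * calderon_norm ?A0 ?A1 F)"
        by (rule Lp_modulo_constants[OF p q pq]) (rule main[OF F]; blast)
      then obtain c where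
        c: "(\<lambda>x. h x - c) \<in> carr (Lp m q)" "nnorm (Lp m q) (\<lambda>x. h x - c) \<le> 8 * (D * calderon_norm ?A0 ?A1 F)"
        by blast
      have "mod_const h = mod_const (\<lambda>x. h x - c)" unfolding mod_const_eq_iff by (intro exI[of _ c]) simp
      then show ?thesis using modulo_norm_le[OF c(1) nonneg_norm_Lp] c(2) by (simp add: mult.assoc)
    qed
    show "bounded_map (8 * D) (complex_interpolation ?A0 ?A1 \<theta>) (modulo_constants (Lp m q)) id"
      unfolding bounded_map_def
    proof (intro ballI conjI)
      fix w assume w: "w \<in> carr (complex_interpolation ?A0 ?A1 \<theta>)"
      then obtain F where "F \<in> calderon_class ?A0 ?A1" "w = F (of_real \<theta>)"
        by (auto simp: complex_interpolation_def)
      then show "id w \<in> carr (modulo_constants (Lp m q))"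
        using res[of F "rep_mod_const w"] by (simp add: mod_const_rep)
      show "nnorm (modulo_constants (Lp m q)) (id w) \<le> 8 * D * nnorm (complex_interpolation ?A0 ?A1 \<theta>) w"
      proof (rule interpolation_norm_ge[OF w])
        show "0 < 8 * D" using D by simp
        fix G assume "G \<in> calderon_class ?A0 ?A1" "G (of_real \<theta>) = w"
        then show "nnorm (modulo_constants (Lp m q)) (id w) \<le> 8 * D * calderon_norm ?A0 ?A1 G"
          using res[of G "rep_mod_const w"] by (simp add: mod_const_rep)
      qed
    qed
  qed
qed

text \<open>The Riesz-Thorin argument for (L^1, L^infinity), applied through the inclusion of H^1 in
  L^1. No constants are factored out here, so point evaluations are functionals on the sum space and
  the tests are arbitrary functions on a finite set.\<close>

lemma interpolation_of_H1_Linf_in_Lp: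
  assumes \<theta>: "0 < \<theta>" "\<theta> < 1" "1 / q = 1 - \<theta>"
  shows "bounded_map 1 (complex_interpolation \<H> Linf \<theta>) (Lp m q) id"
proof -
  let ?A0 = \<H>
  define p where "p = 1 / \<theta>"
  have "0 < 1 / q" "1 / q < 1" using \<theta> by auto
  then have q: "1 < q" by (simp add: divide_less_eq split: if_splits)
  have pq: "1 / p + 1 / q = 1" using \<theta> by (simp add: p_def)
  have main: "F (of_real \<theta>) \<in> carr (Lp m q) \<and> nnorm (Lp m q) (F (of_real \<theta>)) \<le> calderon_norm ?A0 Linf F"
    if F: "F \<in> calderon_class ?A0 Linf" for F
  proof -
    define \<nu> where "\<nu> = calderon_norm ?A0 Linf F"
    have \<nu>: "0 \<le> \<nu>" unfolding \<nu>_def using F nonneg_norm_H1 by (rule calderon_norm_nonneg)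
    have "(\<Sum>x\<in>S. m x * norm (F (of_real \<theta>) x) powr q) \<le> \<nu> powr q" if S: "finite S" for S
    proof (rule norm_sum_powr_le[OF S q pq])
      fix g :: "'v \<Rightarrow> complex" assume g: "(\<Sum>x\<in>S. m x * norm (g x) powr p) \<le> 1"
      \<comment> \<open>\<open>calderon_pairing\<close> asks for positive weights, so the zeros of
        \<open>g\<close> are left out.\<close>
      define I where "I = {x \<in> S. g x \<noteq> 0}"
      have I: "finite I" using S by (simp add: I_def)
      define \<Lambda> where "\<Lambda> x f = m x *\<^sub>R (g x * f x)" for x and f :: "'v \<Rightarrow> complex"
      have it: "F (\<i> * of_real t) \<in> carr ?A0" "F (1 + \<i> * of_real t) \<in> carr Linf" for t
        using F unfolding calderon_class_def by blast+
      have pt: "m x * norm (f x) \<le> nnorm ?A0 f" if "f \<in> carr ?A0" for x f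
        using L1_sum_le[of f "{x}"] bounded_mapD[OF bounded_map_H1_L1 that] by simp
      \<comment> \<open>The analytic family is \<open>g\<close> with its modulus raised to the power
        \<open>z / \<theta>\<close>: of modulus 1 on the left line and
        \<open>norm (g x) powr p\<close> on the right one.\<close>
      have "norm (\<Sum>x\<in>I. \<Lambda> x (F (of_real \<theta>))) \<le> \<nu>"
      proof (rule calderon_pairing[OF F I, where \<mu> = "\<lambda>x. norm (g x)"])
        show "\<Lambda> x \<in> dual (sum_space ?A0 Linf)" for x
        proof (rule dual_sum_spaceI)
          let ?C = "norm (g x) * (1 + m x) + 1"
          show "\<Lambda> x (f + h) = \<Lambda> x f + \<Lambda> x h" for f h by (simp add: \<Lambda>_def algebra_simps)
          show "\<Lambda> x (c *\<^sub>C f) = c * \<Lambda> x f" for c f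
            by (simp add: \<Lambda>_def scaleC_fun_def scaleC_complex_def)
          show "0 < ?C" by (intro add_nonneg_pos mult_nonneg_nonneg) auto
          show "norm (\<Lambda> x f) \<le> ?C * nnorm ?A0 f" if f: "f \<in> carr ?A0" for f
          proof -
            have "norm (\<Lambda> x f) = norm (g x) * (m x * norm (f x))" by (simp add: \<Lambda>_def norm_mult)
            also have "\<dots> \<le> norm (g x) * nnorm ?A0 f" using pt[OF f] by (intro mult_left_mono) auto
            also have "\<dots> \<le> ?C * nnorm ?A0 f"
              using nonneg_normD[OF nonneg_norm_H1 f] by (intro mult_right_mono) (auto simp: distrib_left)
            finally show ?thesis .
          qed
          show "norm (\<Lambda> x f) \<le> ?C * nnorm Linf f" if f: "f \<in> carr Linf" for f
          proof -
            have "norm (\<Lambda> x f) = norm (g x) * m x * norm (f x)" by (simp add: \<Lambda>_def norm_mult)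
            also have "\<dots> \<le> norm (g x) * m x * nnorm Linf f" using Linf_norm_ge[OF f] by (intro mult_left_mono) auto
            also have "\<dots> \<le> ?C * nnorm Linf f"
              using nonneg_normD[OF nonneg_norm_Linf f] by (intro mult_right_mono) (auto simp: distrib_left)
            finally show ?thesis .
          qed
        qed
        show "0 < norm (g x)" if "x \<in> I" for x using that by (simp add: I_def)
        fix t :: real
        let ?f = "F (\<i> * of_real t)"
        have "norm (\<Sum>x\<in>I. complex_of_real (norm (g x)) powr (\<i> * of_real t / of_real \<theta> - 1) * \<Lambda> x ?f)
            \<le> (\<Sum>x\<in>I. m x * norm (?f x))"
        proof (rule order_trans[OF norm_sum sum_mono])
          fix x assume "x \<in> I"
          then have "g x \<noteq> 0" by (simp add: I_def)
          then show "norm (complex_of_real (norm (g x)) powr (\<i> * of_real t / of_real \<theta> - 1) * \<Lambda> x ?f) \<le> m x * norm (?f x)"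
            by (simp add: norm_mult norm_of_real_powr \<Lambda>_def powr_minus field_simps)
        qed
        also have "\<dots> \<le> nnorm (Lp m 1) ?f"
          using bounded_mapD(1)[OF bounded_map_H1_L1 it(1)] I by (intro L1_sum_le) auto
        also have "\<dots> \<le> nnorm ?A0 ?f" using bounded_mapD(2)[OF bounded_map_H1_L1 it(1)] by simp
        also have "\<dots> \<le> \<nu>" unfolding \<nu>_def by (rule calderon_norm_ge(1)[OF F])
        finally show "norm (\<Sum>x\<in>I. complex_of_real (norm (g x)) powr (\<i> * of_real t / of_real \<theta> - 1) * \<Lambda> x ?f) \<le> \<nu>" .
        let ?h = "F (1 + \<i> * of_real t)"
        have "norm (\<Sum>x\<in>I. complex_of_real (norm (g x)) powr ((1 + \<i> * of_real t) / of_real \<theta> - 1) * \<Lambda> x ?h)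
            \<le> (\<Sum>x\<in>I. m x * norm (g x) powr p * \<nu>)"
        proof (rule order_trans[OF norm_sum sum_mono])
          fix x assume "x \<in> I"
          then have gx: "g x \<noteq> 0" by (simp add: I_def)
          then have "norm (g x) powr (p - 1) * norm (g x) = norm (g x) powr p" by (simp add: powr_diff)
          then have "norm (complex_of_real (norm (g x)) powr ((1 + \<i> * of_real t) / of_real \<theta> - 1) * \<Lambda> x ?h) =
              m x * norm (g x) powr p * norm (?h x)"
            by (simp add: norm_mult norm_of_real_powr \<Lambda>_def p_def mult_ac)
          also have "norm (?h x) \<le> \<nu>"
            using Linf_norm_ge[OF it(2)] calderon_norm_ge(2)[OF F] unfolding \<nu>_def by (rule order_trans)
          then have "m x * norm (g x) powr p * norm (?h x) \<le> m x * norm (g x) powr p * \<nu>"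
            by (intro mult_left_mono) auto
          finally show "norm (complex_of_real (norm (g x)) powr ((1 + \<i> * of_real t) / of_real \<theta> - 1) * \<Lambda> x ?h)
              \<le> m x * norm (g x) powr p * \<nu>" .
        qed
        also have "\<dots> = (\<Sum>x\<in>I. m x * norm (g x) powr p) * \<nu>" by (rule sum_distrib_right[symmetric])
        also have "(\<Sum>x\<in>I. m x * norm (g x) powr p) \<le> (\<Sum>x\<in>S. m x * norm (g x) powr p)"
          using S by (intro sum_mono2) (auto simp: I_def)
        then have "(\<Sum>x\<in>I. m x * norm (g x) powr p) * \<nu> \<le> 1 * \<nu>" using g \<nu> by (intro mult_right_mono) auto
        finally show "norm (\<Sum>x\<in>I. complex_of_real (norm (g x)) powr ((1 + \<i> * of_real t) / of_real \<theta> - 1) * \<Lambda> x ?h) \<le> \<nu>"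
          by simp
      qed (use \<theta> in auto)
      also have "(\<Sum>x\<in>I. \<Lambda> x (F (of_real \<theta>))) = (\<Sum>x\<in>S. m x *\<^sub>R (g x * F (of_real \<theta>) x))"
        unfolding \<Lambda>_def using S by (intro sum.mono_neutral_left) (auto simp: I_def)
      finally show "norm (\<Sum>x\<in>S. m x *\<^sub>R (g x * F (of_real \<theta>) x)) \<le> \<nu>" .
    qed
    then show ?thesis using LpI[of q \<nu> "F (of_real \<theta>)"] q \<nu> by (auto simp: \<nu>_def)
  qed
  show ?thesis
    unfolding bounded_map_def
  proof (intro ballI conjI)
    fix f assume f: "f \<in> carr (complex_interpolation ?A0 Linf \<theta>)"
    then show "id f \<in> carr (Lp m q)" using main by (auto simp: complex_interpolation_def)
    show "nnorm (Lp m q) (id f) \<le> 1 * nnorm (complex_interpolation ?A0 Linf \<theta>) f"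
      by (rule interpolation_norm_ge[OF f]) (use main in auto)
  qed
qed

end

section \<open>The three identities from a cycle of inclusions\<close>

theorem theorem5p7:
  fixes E :: "'v \<Rightarrow> 'v \<Rightarrow> bool" and \<gamma> :: "nat \<Rightarrow> 'v" and m :: "'v \<Rightarrow> real"
    and \<beta> \<theta> q :: real
  assumes "tree E" and "geodesic_ray E \<gamma>"
    and "flow E \<gamma> m" and "locally_doubling E m"
    and "12 \<le> \<beta>"
    and "0 < \<theta>" and "\<theta> < 1" and "1 / q = 1 - \<theta>"
  shows "complex_interpolation (modulo_constants (Lp m 1)) (modulo_constants (BMO E \<gamma> m \<beta>)) \<theta>
           \<doteq> modulo_constants (Lp m q) \<and>
         complex_interpolation (H1 E \<gamma> m \<beta>) Linf \<theta> \<doteq> Lp m q \<and>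
         complex_interpolation (modulo_constants (H1 E \<gamma> m \<beta>)) (modulo_constants (BMO E \<gamma> m \<beta>)) \<theta>
           \<doteq> modulo_constants (Lp m q)"
proof -
  interpret bmo_tree E \<gamma> m \<beta>
    by unfold_locales (use assms in auto)
  let ?L1 = "modulo_constants (Lp m 1)" and ?H1 = "modulo_constants (H1 E \<gamma> m \<beta>)"
    and ?BMO = "modulo_constants (BMO E \<gamma> m \<beta>)" and ?Lq = "modulo_constants (Lp m q)"
  note nn = nonneg_norm_Lp nonneg_norm_H1 nonneg_norm_BMO nonneg_norm_Linf
    nonneg_norm_modulo[OF nonneg_norm_Lp] nonneg_norm_modulo[OF nonneg_norm_H1]
    nonneg_norm_modulo[OF nonneg_norm_BMO]
  obtain D where D: "0 < D" "bounded_map D (Lp m q) (complex_interpolation (H1 E \<gamma> m \<beta>) Linf \<theta>) id"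
    using Lp_in_interpolation_of_H1_Linf[OF assms(6-8)] by blast
  obtain B where B: "bounded_map B (complex_interpolation ?L1 ?BMO \<theta>) ?Lq id"
    using interpolation_of_L1_BMO_in_Lp[OF assms(6-8)] by blast
  have id: "bounded_map 1 X X id" for X :: "'a nspace" by (simp add: bounded_map_def)
  \<comment> \<open>The quotient map carries (H^1, L^infinity) to (H^1, BMO) modulo constants; 2 is
    the bound for the inclusion of L^infinity in BMO.\<close>
  have "bounded_map 2 (complex_interpolation (H1 E \<gamma> m \<beta>) Linf \<theta>) (complex_interpolation ?H1 ?BMO \<theta>) mod_const"
  proof (rule interpolation_map[where T = mod_const])
    show "mod_const (f + g) = mod_const f + mod_const g" for f g :: "'v \<Rightarrow> complex"
      by (rule mod_const_add)
    show "mod_const (c *\<^sub>C f) = c *\<^sub>C mod_const f" for c and f :: "'v \<Rightarrow> complex"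
      by (rule mod_const_scaleC)
    show "bounded_map 2 (H1 E \<gamma> m \<beta>) ?H1 mod_const"
      using bounded_map_weaken[OF bounded_map_mod_const[OF id nn(2)] _ nn(2)] by simp
    show "bounded_map 2 Linf ?BMO mod_const"
      by (rule bounded_map_mod_const[OF bounded_map_Linf_BMO nn(3)])
  qed (use nn in auto)
  from bounded_map_comp[OF D(2) this]
  have "bounded_map (2 * D) (Lp m q) (complex_interpolation ?H1 ?BMO \<theta>) mod_const" by simp
  then have H: "bounded_map (2 * D) ?Lq (complex_interpolation ?H1 ?BMO \<theta>) id"
    using D(1) by (intro bounded_map_modulo) auto
  \<comment> \<open>This closes a cycle modulo constants, from L^q into (H^1, BMO), then into (L^1,
    BMO) and back into L^q; two of the three identities are read off from it.\<close>
  have HL: "bounded_map 1 (complex_interpolation ?H1 ?BMO \<theta>) (complex_interpolation ?L1 ?BMO \<theta>) id"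
  proof (rule interpolation_map)
    show "bounded_map 1 ?H1 ?L1 id"
      by (intro bounded_map_modulo bounded_map_mod_const bounded_map_H1_L1 nn) simp
  qed (use nn id in auto)
  have "complex_interpolation ?L1 ?BMO \<theta> \<doteq> ?Lq"
  proof (rule equal_spacesI[OF B])
    show "bounded_map (1 * (2 * D)) ?Lq (complex_interpolation ?L1 ?BMO \<theta>) id"
      using bounded_map_comp[OF H HL] by simp
  qed (simp_all add: nn nonneg_norm_interpolation)
  moreover have "complex_interpolation (H1 E \<gamma> m \<beta>) Linf \<theta> \<doteq> Lp m q"
    by (rule equal_spacesI[OF interpolation_of_H1_Linf_in_Lp[OF assms(6-8)] D(2)])
      (simp_all add: nn nonneg_norm_interpolation)
  moreover have "complex_interpolation ?H1 ?BMO \<theta> \<doteq> ?Lq"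
  proof (rule equal_spacesI[OF _ H])
    \<comment> \<open>\<open>B\<close> is known only as a real number, and
      \<open>bounded_map_comp\<close> asks for a nonnegative outer factor.\<close>
    show "bounded_map (\<bar>B\<bar> * 1) (complex_interpolation ?H1 ?BMO \<theta>) ?Lq id"
      using bounded_map_comp[OF HL bounded_map_weaken[OF B abs_ge_self]]
      by (simp add: nn nonneg_norm_interpolation)
  qed (simp_all add: nn nonneg_norm_interpolation)
  ultimately show ?thesis by blast
qed

end
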